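(* Let $r\geq 3$ and let $G$ be a $K_r$ minor-free graph of sufficiently large order $n$. Then for any $0<\alpha<1$, $$\rho_\alpha(G)\leq \rho_\alpha(K_{r-2}\nabla \overline{K}_{n-r+2}),$$ with equality if and only if $G=K_{r-2}\nabla \overline{K}_{n-r+2}$.
   Context: All graphs are finite, simple and undirected; the order of a graph is its number of vertices. For a graph $G$ with adjacency matrix $A(G)$ and diagonal degree matrix $D(G)$, and a real number $0\le\alpha\le 1$, let $A_\alpha(G)=\alpha D(G)+(1-\alpha)A(G)$; the $\alpha$-index $\rho_\alpha(G)$ is the largest eigenvalue of $A_\alpha(G)$. $K_m$ is the complete graph on $m$ vertices, $\overline{K}_m$ its complement (the edgeless graph on $m$ vertices), and $G\nabla H$ is the join of vertex-disjoint graphs $G,H$, obtained by joining every vertex of $G$ to every vertex of $H$. A graph $H$ is a minor of $G$ if it can be obtained from $G$ by deleting edges, contracting edges or deleting vertices; $G$ is $H$ minor-free if it does not contain $H$ as a minor. *)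

theory Defs
  imports "Jordan_Normal_Form.Char_Poly"
begin

record 'a ugraph =
  uverts :: "'a set"
  uedges :: "'a set set"

definition simple_graph :: "'a ugraph \<Rightarrow> bool" where
  "simple_graph G \<longleftrightarrow>
     finite (uverts G) \<and> (\<forall>e\<in>uedges G. e \<subseteq> uverts G \<and> card e = 2)"

definition graph_order :: "'a ugraph \<Rightarrow> nat" where
  "graph_order G = card (uverts G)"

definition graph_iso :: "'a ugraph \<Rightarrow> 'b ugraph \<Rightarrow> bool" where
  "graph_iso G H \<longleftrightarrow>
     (\<exists>f. bij_betw f (uverts G) (uverts H) \<and>
          (\<forall>u\<in>uverts G. \<forall>v\<in>uverts G. {u, v} \<in> uedges G \<longleftrightarrow> {f u, f v} \<in> uedges H))"

definition complete_graph :: "'a set \<Rightarrow> 'a ugraph" where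
  "complete_graph V = \<lparr>uverts = V, uedges = {e. e \<subseteq> V \<and> card e = 2}\<rparr>"

definition graph_complement :: "'a ugraph \<Rightarrow> 'a ugraph" where
  "graph_complement G =
     \<lparr>uverts = uverts G, uedges = {e. e \<subseteq> uverts G \<and> card e = 2} - uedges G\<rparr>"

text \<open>The join is meant for graphs on disjoint vertex sets.\<close>

definition graph_join :: "'a ugraph \<Rightarrow> 'a ugraph \<Rightarrow> 'a ugraph" where
  "graph_join G H =
     \<lparr>uverts = uverts G \<union> uverts H,
      uedges = uedges G \<union> uedges H \<union> {{u, v} | u v. u \<in> uverts G \<and> v \<in> uverts H}\<rparr>"

definition delete_vertex :: "'a ugraph \<Rightarrow> 'a \<Rightarrow> 'a ugraph" where
  "delete_vertex G v = \<lparr>uverts = uverts G - {v}, uedges = {e \<in> uedges G. v \<notin> e}\<rparr>"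

definition delete_edge :: "'a ugraph \<Rightarrow> 'a set \<Rightarrow> 'a ugraph" where
  "delete_edge G e = \<lparr>uverts = uverts G, uedges = uedges G - {e}\<rparr>"

text \<open>Contraction of the edge \<open>{u, v}\<close>: the merged vertex keeps the name \<open>u\<close>; the loop
  is dropped, and parallel edges coincide because the edges form a set.\<close>

definition contract_edge :: "'a ugraph \<Rightarrow> 'a \<Rightarrow> 'a \<Rightarrow> 'a ugraph" where
  "contract_edge G u v =
     \<lparr>uverts = uverts G - {v},
      uedges = {e \<in> uedges G. v \<notin> e} \<union> {{u, w} | w. {v, w} \<in> uedges G \<and> w \<noteq> u}\<rparr>"

inductive reduces_to :: "'a ugraph \<Rightarrow> 'a ugraph \<Rightarrow> bool" for G :: "'a ugraph" where
  refl: "reduces_to G G"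
| delete_vertex: "reduces_to G H \<Longrightarrow> v \<in> uverts H \<Longrightarrow> reduces_to G (delete_vertex H v)"
| delete_edge: "reduces_to G H \<Longrightarrow> e \<in> uedges H \<Longrightarrow> reduces_to G (delete_edge H e)"
| contract_edge: "reduces_to G H \<Longrightarrow> {u, v} \<in> uedges H \<Longrightarrow> reduces_to G (contract_edge H u v)"

definition is_minor :: "'b ugraph \<Rightarrow> 'a ugraph \<Rightarrow> bool" where
  "is_minor H G \<longleftrightarrow> (\<exists>G'. reduces_to G G' \<and> graph_iso G' H)"

definition minor_free :: "'b ugraph \<Rightarrow> 'a ugraph \<Rightarrow> bool" where
  "minor_free H G \<longleftrightarrow> \<not> is_minor H G"

definition vertex_degree :: "'a ugraph \<Rightarrow> 'a \<Rightarrow> nat" where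
  "vertex_degree G v = card {w \<in> uverts G. {v, w} \<in> uedges G}"

text \<open>The matrices are indexed by positions in an arbitrary enumeration of the vertices;
  by \<open>eigenvalue_alpha_matrix_iff\<close> below, the spectrum does not depend on it.\<close>

definition vertex_list :: "'a ugraph \<Rightarrow> 'a list" where
  "vertex_list G = (SOME vs. distinct vs \<and> set vs = uverts G)"

definition adjacency_matrix :: "'a ugraph \<Rightarrow> real mat" where
  "adjacency_matrix G = mat (graph_order G) (graph_order G)
     (\<lambda>(i, j). if {vertex_list G ! i, vertex_list G ! j} \<in> uedges G then 1 else 0)"

definition degree_matrix :: "'a ugraph \<Rightarrow> real mat" where
  "degree_matrix G = mat (graph_order G) (graph_order G)
     (\<lambda>(i, j). if i = j then real (vertex_degree G (vertex_list G ! i)) else 0)"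

definition alpha_matrix :: "real \<Rightarrow> 'a ugraph \<Rightarrow> real mat" where
  "alpha_matrix \<alpha> G = \<alpha> \<cdot>\<^sub>m degree_matrix G + (1 - \<alpha>) \<cdot>\<^sub>m adjacency_matrix G"

text \<open>The matrix is real symmetric, so all its eigenvalues are real.\<close>

definition alpha_index :: "real \<Rightarrow> 'a ugraph \<Rightarrow> real" where
  "alpha_index \<alpha> G = Max {k. eigenvalue (alpha_matrix \<alpha> G) k}"

lemma vertex_list:
  assumes "finite (uverts G)"
  shows "distinct (vertex_list G)" "set (vertex_list G) = uverts G"
    "length (vertex_list G) = graph_order G"
proof -
  have "\<exists>vs. distinct vs \<and> set vs = uverts G"
    using finite_distinct_list[OF assms] by blast
  then have *: "distinct (vertex_list G) \<and> set (vertex_list G) = uverts G"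
    unfolding vertex_list_def by (rule someI_ex)
  then show "distinct (vertex_list G)" "set (vertex_list G) = uverts G" by auto
  show "length (vertex_list G) = graph_order G"
    using * distinct_card[of "vertex_list G"] by (simp add: graph_order_def)
qed

lemma eigenvalue_alpha_matrix_iff:
  assumes fin: "finite (uverts G)"
  shows "eigenvalue (alpha_matrix \<alpha> G) k \<longleftrightarrow>
    (\<exists>x. (\<exists>v\<in>uverts G. x v \<noteq> 0) \<and>
      (\<forall>u\<in>uverts G. \<alpha> * real (vertex_degree G u) * x u +
        (1 - \<alpha>) * (\<Sum>v | v \<in> uverts G \<and> {u, v} \<in> uedges G. x v) = k * x u))"
    (is "?L \<longleftrightarrow> (\<exists>x. ?P x)")
proof -
  define n where "n = graph_order G"
  define p where "p = (\<lambda>i. vertex_list G ! i)"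
  have bij: "bij_betw p {0..<n} (uverts G)"
    using bij_betw_nth[OF vertex_list(1)[OF fin] _ vertex_list(2)[OF fin, symmetric], of "{0..<n}"]
      vertex_list(3)[OF fin]
    by (simp add: p_def n_def atLeast0LessThan)
  have img: "uverts G = p ` {0..<n}"
    using bij by (simp add: bij_betw_def)
  have A: "alpha_matrix \<alpha> G \<in> carrier_mat n n"
    by (simp add: alpha_matrix_def degree_matrix_def adjacency_matrix_def n_def)
  have row: "(alpha_matrix \<alpha> G *\<^sub>v y) $ i =
      \<alpha> * real (vertex_degree G (p i)) * x (p i) +
      (1 - \<alpha>) * (\<Sum>v | v \<in> uverts G \<and> {p i, v} \<in> uedges G. x v)"
    if i: "i < n" and y: "y \<in> carrier_vec n" and yx: "\<And>j. j < n \<Longrightarrow> y $ j = x (p j)" for i y x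
  proof -
    have "(alpha_matrix \<alpha> G *\<^sub>v y) $ i = (\<Sum>j = 0..<n. alpha_matrix \<alpha> G $$ (i, j) * y $ j)"
      using A i y by (auto simp: scalar_prod_def intro!: sum.cong)
    also have "\<dots> = (\<Sum>j = 0..<n. (if i = j then \<alpha> * real (vertex_degree G (p i)) * x (p j) else 0) +
        (1 - \<alpha>) * (if {p i, p j} \<in> uedges G then x (p j) else 0))"
      using i yx by (intro sum.cong)
        (auto simp: alpha_matrix_def degree_matrix_def adjacency_matrix_def n_def p_def algebra_simps)
    also have "\<dots> = \<alpha> * real (vertex_degree G (p i)) * x (p i) +
        (1 - \<alpha>) * (\<Sum>j = 0..<n. if {p i, p j} \<in> uedges G then x (p j) else 0)"
      using i by (simp add: sum.distrib sum_distrib_left)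
    also have "(\<Sum>j = 0..<n. if {p i, p j} \<in> uedges G then x (p j) else 0) =
        (\<Sum>v\<in>uverts G. if {p i, v} \<in> uedges G then x v else 0)"
      by (rule sum.reindex_bij_betw[OF bij])
    also have "\<dots> = (\<Sum>v | v \<in> uverts G \<and> {p i, v} \<in> uedges G. x v)"
      using sum.inter_filter[OF fin, of x "\<lambda>v. {p i, v} \<in> uedges G"] by simp
    finally show ?thesis .
  qed
  show ?thesis
  proof
    assume ?L
    then obtain y where y: "y \<in> carrier_vec n" "y \<noteq> 0\<^sub>v n" "alpha_matrix \<alpha> G *\<^sub>v y = k \<cdot>\<^sub>v y"
      using A unfolding eigenvalue_def eigenvector_def by auto
    define x where "x = (\<lambda>v. y $ the_inv_into {0..<n} p v)"
    have yx: "y $ j = x (p j)" if "j < n" for j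
      using that bij by (simp add: x_def the_inv_into_f_f bij_betw_def)
    obtain j where j: "j < n" "y $ j \<noteq> 0"
      using y(1,2) by (metis carrier_vecD eq_vecI index_zero_vec)
    have "?P x"
    proof (intro conjI ballI)
      show "\<exists>v\<in>uverts G. x v \<noteq> 0"
        using j yx bij by (intro bexI[of _ "p j"]) (auto simp: bij_betw_def)
    next
      fix u assume "u \<in> uverts G"
      then obtain i where i: "i < n" "u = p i" unfolding img by auto
      show "\<alpha> * real (vertex_degree G u) * x u +
        (1 - \<alpha>) * (\<Sum>v | v \<in> uverts G \<and> {u, v} \<in> uedges G. x v) = k * x u"
        using row[OF i(1) y(1) yx] y i yx by simp
    qed
    then show "\<exists>x. ?P x" by blast
  next
    assume "\<exists>x. ?P x"
    then obtain x where x: "?P x" by blast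
    define y where "y = vec n (\<lambda>i. x (p i))"
    have y: "y \<in> carrier_vec n" by (simp add: y_def)
    have yx: "\<And>j. j < n \<Longrightarrow> y $ j = x (p j)" by (simp add: y_def)
    obtain j where "j < n" "x (p j) \<noteq> 0" using x img by force
    then have "y \<noteq> 0\<^sub>v n" using yx by (metis index_zero_vec(1))
    moreover have "alpha_matrix \<alpha> G *\<^sub>v y = k \<cdot>\<^sub>v y"
    proof (rule eq_vecI)
      fix i assume "i < dim_vec (k \<cdot>\<^sub>v y)"
      then have i: "i < n" using y by simp
      then have "p i \<in> uverts G" using img by auto
      then show "(alpha_matrix \<alpha> G *\<^sub>v y) $ i = (k \<cdot>\<^sub>v y) $ i"
        using row[OF i y yx] x y i yx by simp
    qed (use A y in simp)
    ultimately show ?L using A y unfolding eigenvalue_def eigenvector_def by auto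
  qed
qed

end

theory Submission imports Defs "HOL-Analysis.Analysis"
begin

text \<open>
  Write \<open>s = r - 2\<close>, \<open>a = \<alpha>\<close>, \<open>b = 1 - \<alpha>\<close>, and let \<open>x\<close> be a nonnegative eigenvector for the
  \<open>\<alpha>\<close>-index \<open>\<rho>\<close> of \<open>G\<close>, where \<open>\<rho>\<close> is at least the \<open>\<alpha>\<close>-index of the join. A graph without
  \<open>K\<^sub>r\<close> minor has boundedly many edges per vertex in every subgraph and no \<open>K\<^sub>s\<^sub>+\<^sub>1\<^sub>,\<^sub>s\<^sub>+\<^sub>1\<close>, and a
  large common neighbourhood \<open>B\<close> of \<open>s\<close> vertices is independent and meets each outer
  neighbourhood at most once.

  First, eliminating the vertices of degree below \<open>n / M\<close> from the quadratic form leaves a form on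
  a bounded set \<open>H\<close>. Most other vertices have at most \<open>s\<close> neighbours in \<open>H\<close>, so this form is too
  small unless \<open>s\<close> vertices miss at most \<open>g n\<close> others. All errors are measured in the small
  parameter \<open>p = b / \<rho>\<close>, for which \<open>p\<^sup>2 n\<close> is bounded, which makes the threshold on \<open>n\<close>
  independent of \<open>\<alpha>\<close>.

  Second, let \<open>L\<close> consist of these \<open>s\<close> vertices. Pairing \<open>x\<close> with the Perron vector of the join
  bounds the loss from nonneighbours of \<open>L\<close> by the gain from edges outside \<open>L\<close>; those edges
  meet the few vertices not joined to all of \<open>L\<close>, where \<open>x\<close> is small. Hence nothing is missing
  and \<open>G\<close> is the join.
\<close>

section \<open>Clique minors\<close>

text \<open>The order of quantifiers shapes the proof: one threshold on \<open>n\<close> must serve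
  every \<alpha> strictly between 0 and 1. For small \<alpha> the index of the join behaves like the
  square root of \<open>s * n\<close>; for \<alpha> near 1 the degree term dominates, and competing
  graphs differ only by terms carrying the small factor \<open>b\<close>. Upper and lower estimates
  of the index are therefore arranged so that the multiples of \<open>a\<close> cancel or have a
  favourable sign, after which \<open>b\<close> is divided out. The uniform bound on
  \<open>p^2 * n\<close> comes from the equation for the Perron entry \<open>z\<close> of the join:
  dropping its nonnegative \<open>a\<close>-part lets \<open>b\<close> cancel and leaves
  \<open>z^2 * (n - s) <= s\<close>, while \<open>p * s <= z\<close>. Connectedness is not assumed,
  so the eigenvector is only known to be nonnegative. Its largest entry is scaled to 1, and lower
  bounds on other entries are derived from adjacency to that vertex or to the large common
  neighbourhood.\<close>

definition induced_subgraph :: "'a ugraph \<Rightarrow> 'a set \<Rightarrow> 'a ugraph" where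
  "induced_subgraph G S = \<lparr>uverts = S, uedges = {e \<in> uedges G. e \<subseteq> S}\<rparr>"

text \<open>Serves to raise the order of a clique minor by one: the apex survives every reduction of
  the base.\<close>

definition cone :: "'a \<Rightarrow> 'a ugraph \<Rightarrow> 'a ugraph" where
  "cone v H = \<lparr>uverts = insert v (uverts H), uedges = uedges H \<union> {{v, w} | w. w \<in> uverts H}\<rparr>"

text \<open>Contraction reuses the name of an endpoint, so the clique can be asked to live on
  vertices of the same type. This keeps isomorphisms out of the minor arguments until
  \<open>minor_free_no_clique_minor\<close>.\<close>

definition has_clique_minor :: "nat \<Rightarrow> 'a ugraph \<Rightarrow> bool" where
  "has_clique_minor k G \<longleftrightarrow> (\<exists>W. finite W \<and> card W = k \<and> reduces_to G (complete_graph W))"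

definition neighbours :: "'a ugraph \<Rightarrow> 'a \<Rightarrow> 'a set" where
  "neighbours G v = {w \<in> uverts G. {v, w} \<in> uedges G}"

lemma simple_graph_edgeD:
  assumes "simple_graph G" "{u, v} \<in> uedges G"
  shows "u \<in> uverts G" "v \<in> uverts G" "u \<noteq> v"
proof -
  have *: "{u, v} \<subseteq> uverts G" "card {u, v} = 2"
    using assms unfolding simple_graph_def by blast+
  show "u \<in> uverts G" "v \<in> uverts G" using * by auto
  show "u \<noteq> v" using *(2) by auto
qed

lemma simple_graph_finite:
  assumes "simple_graph G"
  shows "finite (uverts G)" "finite (uedges G)"
proof -
  show f: "finite (uverts G)" using assms by (simp add: simple_graph_def)
  have "uedges G \<subseteq> Pow (uverts G)" using assms by (auto simp: simple_graph_def)
  then show "finite (uedges G)" using f by (meson finite_Pow_iff finite_subset)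
qed

lemma ugraph_eqI: "uverts G = uverts H \<Longrightarrow> uedges G = uedges H \<Longrightarrow> G = (H :: 'a ugraph)"
  by (cases G; cases H) simp

lemma reduces_to_trans:
  assumes "reduces_to G H" "reduces_to H K"
  shows "reduces_to G K"
  using assms(2) by induction (auto intro: reduces_to.intros assms(1))

lemma reduces_to_delete_edges:
  assumes "finite F" "F \<subseteq> uedges G"
  shows "reduces_to G \<lparr>uverts = uverts G, uedges = uedges G - F\<rparr>"
  using assms
proof (induction F)
  case empty
  have "\<lparr>uverts = uverts G, uedges = uedges G - {}\<rparr> = G" by (cases G) simp
  then show ?case using reduces_to.refl[of G] by (simp only:)
next
  case (insert e F)
  have "reduces_to G (delete_edge \<lparr>uverts = uverts G, uedges = uedges G - F\<rparr> e)"
    using insert by (intro reduces_to.delete_edge) auto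
  moreover have "delete_edge \<lparr>uverts = uverts G, uedges = uedges G - F\<rparr> e =
      \<lparr>uverts = uverts G, uedges = uedges G - insert e F\<rparr>"
    by (auto simp: delete_edge_def)
  ultimately show ?case by simp
qed

lemma reduces_to_delete_isolated_vertices:
  assumes "finite W" "W \<inter> V = {}" "\<forall>e\<in>E. e \<subseteq> V"
  shows "reduces_to \<lparr>uverts = V \<union> W, uedges = E\<rparr> \<lparr>uverts = V, uedges = E\<rparr>"
  using assms
proof (induction W)
  case empty
  show ?case by (simp add: reduces_to.refl)
next
  case (insert w W)
  have "delete_vertex \<lparr>uverts = V \<union> insert w W, uedges = E\<rparr> w = \<lparr>uverts = V \<union> W, uedges = E\<rparr>"
    using insert by (auto simp: delete_vertex_def)
  then have "reduces_to \<lparr>uverts = V \<union> insert w W, uedges = E\<rparr> \<lparr>uverts = V \<union> W, uedges = E\<rparr>"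
    using reduces_to.delete_vertex[OF reduces_to.refl, of w "\<lparr>uverts = V \<union> insert w W, uedges = E\<rparr>"]
    by simp
  then show ?case using insert by (auto intro: reduces_to_trans)
qed

lemma reduces_to_subgraph:
  assumes G: "simple_graph G" and "uverts H \<subseteq> uverts G" "uedges H \<subseteq> uedges G"
    and H: "\<forall>e\<in>uedges H. e \<subseteq> uverts H"
  shows "reduces_to G H"
proof -
  have "reduces_to G \<lparr>uverts = uverts G, uedges = uedges G - (uedges G - uedges H)\<rparr>"
    using simple_graph_finite[OF G] by (intro reduces_to_delete_edges) auto
  moreover have "uedges G - (uedges G - uedges H) = uedges H" using assms(3) by auto
  moreover have "uverts G = uverts H \<union> (uverts G - uverts H)" using assms(2) by auto
  moreover have "reduces_to \<lparr>uverts = uverts H \<union> (uverts G - uverts H), uedges = uedges H\<rparr>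
      \<lparr>uverts = uverts H, uedges = uedges H\<rparr>"
    using H simple_graph_finite[OF G] by (intro reduces_to_delete_isolated_vertices) auto
  ultimately have "reduces_to G \<lparr>uverts = uverts H, uedges = uedges H\<rparr>"
    by (metis reduces_to_trans)
  then show ?thesis by (cases H) simp
qed

lemma has_clique_minor_subgraph:
  assumes "has_clique_minor k H" "simple_graph G" "simple_graph H"
    "uverts H \<subseteq> uverts G" "uedges H \<subseteq> uedges G"
  shows "has_clique_minor k G"
  using assms reduces_to_subgraph[of G H] reduces_to_trans
  unfolding has_clique_minor_def simple_graph_def by metis

lemma simple_graph_induced:
  assumes "simple_graph G" "S \<subseteq> uverts G"
  shows "simple_graph (induced_subgraph G S)"
  using assms by (auto simp: simple_graph_def induced_subgraph_def intro: finite_subset)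

lemma has_clique_minor_induced:
  assumes "has_clique_minor k (induced_subgraph G S)" "simple_graph G" "S \<subseteq> uverts G"
  shows "has_clique_minor k G"
  using assms simple_graph_induced[OF assms(2,3)]
  by (elim has_clique_minor_subgraph) (auto simp: induced_subgraph_def)

lemma simple_graph_contract:
  assumes G: "simple_graph G" and uv: "{u, v} \<in> uedges G"
  shows "simple_graph (contract_edge G u v)"
  unfolding simple_graph_def
proof (intro conjI ballI)
  show "finite (uverts (contract_edge G u v))"
    using simple_graph_finite[OF G] by (simp add: contract_edge_def)
  fix e assume e: "e \<in> uedges (contract_edge G u v)"
  consider "e \<in> uedges G" "v \<notin> e" | w where "e = {u, w}" "{v, w} \<in> uedges G" "w \<noteq> u"
    using e by (auto simp: contract_edge_def)
  then have "e \<subseteq> uverts (contract_edge G u v) \<and> card e = 2"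
  proof cases
    case 1
    then show ?thesis using G by (auto simp: contract_edge_def simple_graph_def)
  next
    case 2
    show ?thesis
      using simple_graph_edgeD[OF G 2(2)] simple_graph_edgeD[OF G uv] 2
      by (auto simp: contract_edge_def)
  qed
  then show "e \<subseteq> uverts (contract_edge G u v)" "card e = 2" by auto
qed

lemma edge_contract_iff:
  assumes G: "simple_graph G" and uv: "{u, v} \<in> uedges G"
  shows "{x, y} \<in> uedges (contract_edge G u v) \<longleftrightarrow>
    x \<noteq> v \<and> y \<noteq> v \<and> x \<noteq> y \<and>
    ({x, y} \<in> uedges G \<or> x = u \<and> {v, y} \<in> uedges G \<or> y = u \<and> {v, x} \<in> uedges G)"
proof -
  note d = simple_graph_edgeD[OF G]
  show ?thesis
    using d(3)[OF uv] d(3)[of x y] d(3)[of v y] d(3)[of v x] d(3)[of v]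
    by (auto simp: contract_edge_def doubleton_eq_iff insert_commute)
qed

text \<open>Each reduction step of the base can be performed in the cone without touching the apex.
  The two extra conclusions are what the induction needs: the apex stays outside the base, and the
  base stays simple.\<close>

lemma cone_reduces_to:
  assumes "reduces_to H H'" "simple_graph H" "v \<notin> uverts H"
  shows "reduces_to (cone v H) (cone v H') \<and> simple_graph H' \<and> uverts H' \<subseteq> uverts H"
  using assms(1)
proof induction
  case refl
  then show ?case using assms by (auto intro: reduces_to.refl)
next
  case (delete_vertex K w)
  have s: "simple_graph K" "v \<notin> uverts K" using delete_vertex assms by auto
  have "cone v (delete_vertex K w) = delete_vertex (cone v K) w"
    using delete_vertex s by (auto simp: cone_def delete_vertex_def intro!: ugraph_eqI)
  moreover have "reduces_to (cone v H) (delete_vertex (cone v K) w)"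
    using delete_vertex by (intro reduces_to.delete_vertex) (auto simp: cone_def)
  ultimately show ?case using delete_vertex s
    by (auto simp: delete_vertex_def simple_graph_def)
next
  case (delete_edge K e)
  have s: "simple_graph K" "v \<notin> uverts K" using delete_edge assms by auto
  have ev: "v \<notin> e" using s delete_edge by (auto simp: simple_graph_def)
  have "cone v (delete_edge K e) = delete_edge (cone v K) e"
    using ev by (auto simp: cone_def delete_edge_def intro!: ugraph_eqI)
  moreover have "reduces_to (cone v H) (delete_edge (cone v K) e)"
    using delete_edge by (intro reduces_to.delete_edge) (auto simp: cone_def)
  ultimately show ?case using delete_edge s
    by (auto simp: delete_edge_def simple_graph_def)
next
  case (contract_edge K u w)
  have s: "simple_graph K" "v \<notin> uverts K" using contract_edge assms by auto
  note d = simple_graph_edgeD[OF s(1) contract_edge(2)]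
  have "cone v (contract_edge K u w) = contract_edge (cone v K) u w"
  proof (rule ugraph_eqI)
    show "uverts (cone v (contract_edge K u w)) = uverts (contract_edge (cone v K) u w)"
      using d s by (auto simp: cone_def contract_edge_def)
    \<comment> \<open>In the cone \<open>w\<close> is also adjacent to the apex, so contraction
      produces the further edge \<open>{u, v}\<close>; the cone over the contracted base has this
      edge anyway.\<close>
    have "{y. {w, y} \<in> uedges (cone v K) \<and> y \<noteq> u} = insert v {y. {w, y} \<in> uedges K \<and> y \<noteq> u}"
      using d s by (auto simp: cone_def doubleton_eq_iff)
    then have "{{u, y} | y. {w, y} \<in> uedges (cone v K) \<and> y \<noteq> u} =
        insert {u, v} {{u, y} | y. {w, y} \<in> uedges K \<and> y \<noteq> u}"
      by (simp only: setcompr_eq_image image_insert)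
    moreover have "{e \<in> {{v, y} | y. y \<in> uverts K}. w \<notin> e} = {{v, y} | y. y \<in> uverts K - {w}}"
      using d s by auto
    moreover have "{u, v} \<in> {{v, y} | y. y \<in> uverts K - {w}}" using d by auto
    moreover have "{e \<in> uedges (cone v K). w \<notin> e} =
        {e \<in> uedges K. w \<notin> e} \<union> {e \<in> {{v, y} | y. y \<in> uverts K}. w \<notin> e}"
      by (auto simp: cone_def)
    moreover have "uedges (cone v (contract_edge K u w)) =
        {e \<in> uedges K. w \<notin> e} \<union> {{u, y} | y. {w, y} \<in> uedges K \<and> y \<noteq> u} \<union> {{v, y} | y. y \<in> uverts K - {w}}"
      by (simp add: cone_def contract_edge_def)
    moreover have "uedges (contract_edge (cone v K) u w) =
        {e \<in> uedges (cone v K). w \<notin> e} \<union> {{u, y} | y. {w, y} \<in> uedges (cone v K) \<and> y \<noteq> u}"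
      by (simp add: contract_edge_def)
    ultimately show "uedges (cone v (contract_edge K u w)) = uedges (contract_edge (cone v K) u w)"
      by (simp only:) blast
  qed
  moreover have "reduces_to (cone v H) (contract_edge (cone v K) u w)"
    using contract_edge by (intro reduces_to.contract_edge) (auto simp: cone_def)
  moreover have "simple_graph (contract_edge K u w)"
    using simple_graph_contract[OF s(1) contract_edge(2)] .
  ultimately show ?case using contract_edge by (auto simp: contract_edge_def)
qed

lemma has_clique_minor_cone:
  assumes "has_clique_minor k H" "simple_graph H" "v \<notin> uverts H"
  shows "has_clique_minor (Suc k) (cone v H)"
proof -
  obtain W where W: "finite W" "card W = k" "reduces_to H (complete_graph W)"
    using assms(1) unfolding has_clique_minor_def by blast
  note c = cone_reduces_to[OF W(3) assms(2,3)]
  have v: "v \<notin> W" using c assms(3) by (auto simp: complete_graph_def)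
  have "cone v (complete_graph W) = complete_graph (insert v W)"
  proof (rule ugraph_eqI)
    show "uedges (cone v (complete_graph W)) = uedges (complete_graph (insert v W))"
    proof
      show "uedges (cone v (complete_graph W)) \<subseteq> uedges (complete_graph (insert v W))"
        using v by (auto simp: cone_def complete_graph_def card_insert_if)
      show "uedges (complete_graph (insert v W)) \<subseteq> uedges (cone v (complete_graph W))"
      proof
        fix e assume "e \<in> uedges (complete_graph (insert v W))"
        then have e: "e \<subseteq> insert v W" "card e = 2" by (auto simp: complete_graph_def)
        then obtain x y where xy: "e = {x, y}" "x \<noteq> y" by (meson card_2_iff)
        then show "e \<in> uedges (cone v (complete_graph W))"
          using e by (auto simp: cone_def complete_graph_def insert_commute)
      qed
    qed
  qed (simp add: cone_def complete_graph_def)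
  then show ?thesis using c W v unfolding has_clique_minor_def
    by (metis card_insert_disjoint finite_insert)
qed

section \<open>Clique minors forced by complete bipartite subgraphs\<close>

lemma has_clique_minor_contract:
  assumes "has_clique_minor k (contract_edge G u v)" "{u, v} \<in> uedges G"
  shows "has_clique_minor k G"
  using assms reduces_to_trans[OF reduces_to.contract_edge[OF reduces_to.refl assms(2)]]
  unfolding has_clique_minor_def by blast

text \<open>After contracting the edge, the merged vertex is adjacent to all of \<open>W\<close>, so
  the contracted graph contains a cone over the graph induced on \<open>W\<close>.\<close>

lemma has_clique_minor_dominating_edge:
  assumes G: "simple_graph G" and lb: "{l, b} \<in> uedges G"
    and W: "W \<subseteq> uverts G - {l, b}" "\<forall>w\<in>W. {l, w} \<in> uedges G \<or> {b, w} \<in> uedges G"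
    and k: "has_clique_minor k (induced_subgraph G W)"
  shows "has_clique_minor (Suc k) G"
proof (rule has_clique_minor_contract[OF _ lb])
  note d = simple_graph_edgeD[OF G lb]
  have s: "simple_graph (induced_subgraph G W)" using W by (intro simple_graph_induced G) auto
  have m: "has_clique_minor (Suc k) (cone l (induced_subgraph G W))"
    using W by (intro has_clique_minor_cone k s) (auto simp: induced_subgraph_def)
  show "has_clique_minor (Suc k) (contract_edge G l b)"
  proof (rule has_clique_minor_subgraph[OF m])
    show "simple_graph (contract_edge G l b)" by (rule simple_graph_contract[OF G lb])
    show "uverts (cone l (induced_subgraph G W)) \<subseteq> uverts (contract_edge G l b)"
      using W d by (auto simp: cone_def induced_subgraph_def contract_edge_def)
    show sub: "uedges (cone l (induced_subgraph G W)) \<subseteq> uedges (contract_edge G l b)"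
    proof
      fix e assume "e \<in> uedges (cone l (induced_subgraph G W))"
      then consider "e \<in> uedges G" "e \<subseteq> W" | w where "w \<in> W" "e = {l, w}"
        by (auto simp: cone_def induced_subgraph_def)
      then show "e \<in> uedges (contract_edge G l b)"
      proof cases
        case 1
        then show ?thesis using W by (auto simp: contract_edge_def)
      next
        case 2
        then show ?thesis using W d by (auto simp: edge_contract_iff[OF G lb])
      qed
    qed
    show "simple_graph (cone l (induced_subgraph G W))"
      unfolding simple_graph_def
    proof (intro conjI ballI)
      show "finite (uverts (cone l (induced_subgraph G W)))"
        using W simple_graph_finite[OF G] by (auto simp: cone_def induced_subgraph_def intro: finite_subset)
      fix e assume e: "e \<in> uedges (cone l (induced_subgraph G W))"
      then show "card e = 2"
        using simple_graph_contract[OF G lb] sub by (auto simp: simple_graph_def)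
      show "e \<subseteq> uverts (cone l (induced_subgraph G W))"
        using e by (auto simp: cone_def induced_subgraph_def)
    qed
  qed
qed

text \<open>Contract the edges of a perfect matching between \<open>L\<close> and \<open>B\<close> one after the other.\<close>

lemma has_clique_minor_complete_bipartite:
  assumes "simple_graph G" "card L = s" "card B = s" "finite L" "finite B"
    "L \<subseteq> uverts G" "B \<subseteq> uverts G" "Q \<subseteq> uverts G" "L \<inter> B = {}" "Q \<inter> L = {}" "Q \<inter> B = {}"
    "\<forall>l\<in>L. \<forall>b\<in>B. {l, b} \<in> uedges G"
    "\<forall>q\<in>Q. (\<forall>l\<in>L. {l, q} \<in> uedges G) \<or> (\<forall>b\<in>B. {b, q} \<in> uedges G)"
    "has_clique_minor k (induced_subgraph G Q)"
  shows "has_clique_minor (k + s) G"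
  using assms
proof (induction s arbitrary: G L B)
  case 0
  then show ?case using has_clique_minor_induced by (metis add.right_neutral)
next
  case (Suc s)
  obtain l L' where L: "L = insert l L'" "l \<notin> L'" "card L' = s"
    using Suc.prems(2) by (metis card_Suc_eq)
  obtain b B' where B: "B = insert b B'" "b \<notin> B'" "card B' = s"
    using Suc.prems(3) by (metis card_Suc_eq)
  define W where "W = Q \<union> L' \<union> B'"
  have sub: "Q \<subseteq> W" "L' \<subseteq> W" "B' \<subseteq> W" unfolding W_def by auto
  have WG: "W \<subseteq> uverts G - {l, b}" using Suc.prems L B unfolding W_def by auto
  then have s: "simple_graph (induced_subgraph G W)"
    using Suc.prems by (intro simple_graph_induced) auto
  have e: "{x, y} \<in> uedges (induced_subgraph G W) \<longleftrightarrow> {x, y} \<in> uedges G \<and> x \<in> W \<and> y \<in> W" for x y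
    by (auto simp: induced_subgraph_def)
  have "induced_subgraph (induced_subgraph G W) Q = induced_subgraph G Q"
    by (intro ugraph_eqI) (auto simp: induced_subgraph_def W_def)
  then have Q: "has_clique_minor k (induced_subgraph (induced_subgraph G W) Q)"
    using Suc.prems(14) by simp
  have "has_clique_minor (k + s) (induced_subgraph G W)"
  proof (rule Suc.IH[OF s L(3) B(3) _ _ _ _ _ _ _ _ _ _ Q])
    show "finite L'" "finite B'" using Suc.prems(4,5) L(1) B(1) by auto
    show "L' \<subseteq> uverts (induced_subgraph G W)" "B' \<subseteq> uverts (induced_subgraph G W)"
      "Q \<subseteq> uverts (induced_subgraph G W)"
      by (auto simp: induced_subgraph_def W_def)
    show "L' \<inter> B' = {}" "Q \<inter> L' = {}" "Q \<inter> B' = {}" using Suc.prems(9-11) L(1) B(1) by auto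
    show "\<forall>l\<in>L'. \<forall>b\<in>B'. {l, b} \<in> uedges (induced_subgraph G W)"
      using Suc.prems(12) sub unfolding e L(1) B(1) by blast
    show "\<forall>q\<in>Q. (\<forall>l\<in>L'. {l, q} \<in> uedges (induced_subgraph G W)) \<or>
        (\<forall>b\<in>B'. {b, q} \<in> uedges (induced_subgraph G W))"
      using Suc.prems(13) sub unfolding e L(1) B(1) by blast
  qed
  moreover have "{l, b} \<in> uedges G" using Suc.prems L B by auto
  moreover have "\<forall>w\<in>W. {l, w} \<in> uedges G \<or> {b, w} \<in> uedges G"
    using Suc.prems(12,13) unfolding W_def L(1) B(1) by (auto simp: insert_commute)
  ultimately show ?case
    using has_clique_minor_dominating_edge[OF Suc.prems(1)] WG by (metis add_Suc_right)
qed

lemma has_clique_minor_edge: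
  assumes G: "simple_graph G" and e: "{u, v} \<in> uedges G"
  shows "has_clique_minor 2 G"
proof -
  note d = simple_graph_edgeD[OF G e]
  have "uedges (complete_graph {u, v}) \<subseteq> {{u, v}}"
  proof
    fix f assume "f \<in> uedges (complete_graph {u, v})"
    then have "f \<subseteq> {u, v}" "card f = card {u, v}" using d by (auto simp: complete_graph_def)
    then show "f \<in> {{u, v}}" using card_subset_eq[of "{u, v}" f] by auto
  qed
  then have "uedges (complete_graph {u, v}) \<subseteq> uedges G" using e by blast
  have "reduces_to G (complete_graph {u, v})"
  proof (rule reduces_to_subgraph[OF G])
    show "uedges (complete_graph {u, v}) \<subseteq> uedges G" by fact
    show "uverts (complete_graph {u, v}) \<subseteq> uverts G" using d by (simp add: complete_graph_def)
    show "\<forall>f\<in>uedges (complete_graph {u, v}). f \<subseteq> uverts (complete_graph {u, v})"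
      by (simp add: complete_graph_def)
  qed
  then show ?thesis using d unfolding has_clique_minor_def by (intro exI[of _ "{u, v}"]) simp
qed

lemma induced_edge:
  "{x, y} \<in> uedges (induced_subgraph G W) \<longleftrightarrow> {x, y} \<in> uedges G \<and> x \<in> W \<and> y \<in> W"
  by (auto simp: induced_subgraph_def)

text \<open>With \<open>s + 1\<close> vertices on both sides, \<open>s\<close> matching edges are
  contracted and one edge \<open>{l, b}\<close> is kept as the remaining clique of order 2. It
  satisfies the disjunction in \<open>has_clique_minor_complete_bipartite\<close> because
  \<open>l\<close> sees the other side \<open>B'\<close> and \<open>b\<close> sees
  \<open>L'\<close>.\<close>

lemma no_complete_bipartite:
  assumes G: "simple_graph G" and nm: "\<not> has_clique_minor (s + 2) G"
    and LB: "finite L" "finite B" "L \<subseteq> uverts G" "B \<subseteq> uverts G" "L \<inter> B = {}"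
      "card L = Suc s" "\<forall>l\<in>L. \<forall>b\<in>B. {l, b} \<in> uedges G"
  shows "card B \<le> s"
proof (rule ccontr)
  assume "\<not> card B \<le> s"
  then obtain B0 where B0: "B0 \<subseteq> B" "card B0 = Suc s" "finite B0"
    using LB(2) by (metis not_less_eq_eq obtain_subset_with_card_n)
  obtain l L' where L: "L = insert l L'" "l \<notin> L'" "card L' = s"
    using LB by (metis card_Suc_eq)
  obtain b B' where B: "B0 = insert b B'" "b \<notin> B'" "card B' = s"
    using B0 by (metis card_Suc_eq)
  have sub: "l \<in> L" "L' \<subseteq> L" "b \<in> B" "b \<notin> L" "l \<notin> B" "B' \<subseteq> B" "L' \<inter> B = {}"
    using LB(5) L(1) B(1) B0(1) by auto
  have lb: "{l, b} \<in> uedges G" using LB(7) sub by blast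
  have Q: "has_clique_minor 2 (induced_subgraph G {l, b})"
    using lb simple_graph_edgeD[OF G lb] G
    by (intro has_clique_minor_edge[of _ l b] simple_graph_induced) (auto simp: induced_edge)
  have "has_clique_minor (2 + s) G"
  proof (rule has_clique_minor_complete_bipartite[OF G L(3) B(3) _ _ _ _ _ _ _ _ _ _ Q])
    show "finite L'" "finite B'" "L' \<subseteq> uverts G" "B' \<subseteq> uverts G" "{l, b} \<subseteq> uverts G"
      using LB(1-4) sub by (auto intro: finite_subset)
    show "L' \<inter> B' = {}" "{l, b} \<inter> L' = {}" "{l, b} \<inter> B' = {}"
      using sub L(2) B(2) by auto
    show "\<forall>l\<in>L'. \<forall>b\<in>B'. {l, b} \<in> uedges G" using LB(7) sub by blast
    have "\<forall>y\<in>B'. {l, y} \<in> uedges G" using LB(7) sub by blast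
    then have "\<forall>y\<in>B'. {y, l} \<in> uedges G" by (simp add: insert_commute)
    moreover have "\<forall>x\<in>L'. {x, b} \<in> uedges G" using LB(7) sub by blast
    ultimately show "\<forall>q\<in>{l, b}. (\<forall>x\<in>L'. {x, q} \<in> uedges G) \<or> (\<forall>y\<in>B'. {y, q} \<in> uedges G)"
      by blast
  qed
  then show False using nm by (simp add: add.commute)
qed

text \<open>An edge inside \<open>B\<close> is a clique of order 2 adjacent to all of
  \<open>L\<close>; the other vertices of \<open>B\<close> still suffice to match \<open>L\<close>,
  which gives a clique minor of order \<open>s + 2\<close>.\<close>

lemma common_neighbours_independent:
  assumes G: "simple_graph G" and nm: "\<not> has_clique_minor (s + 2) G"
    and LB: "finite L" "finite B" "L \<subseteq> uverts G" "B \<subseteq> uverts G" "L \<inter> B = {}"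
      "card L = s" "\<forall>l\<in>L. \<forall>b\<in>B. {l, b} \<in> uedges G" "card B \<ge> s + 2"
    and b: "b \<in> B" "b' \<in> B"
  shows "{b, b'} \<notin> uedges G"
proof
  assume e: "{b, b'} \<in> uedges G"
  note d = simple_graph_edgeD[OF G e]
  have "card (B - {b, b'}) = card B - card {b, b'}" using b d LB by (intro card_Diff_subset) auto
  then have "card (B - {b, b'}) \<ge> s" using LB d by simp
  then obtain B0 where B0: "B0 \<subseteq> B - {b, b'}" "card B0 = s" "finite B0"
    using LB(2) by (metis obtain_subset_with_card_n)
  have Q: "has_clique_minor 2 (induced_subgraph G {b, b'})"
    using e d G
    by (intro has_clique_minor_edge[of _ b b'] simple_graph_induced) (auto simp: induced_edge)
  have "has_clique_minor (2 + s) G"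
  proof (rule has_clique_minor_complete_bipartite[OF G LB(6) B0(2) _ _ _ _ _ _ _ _ _ _ Q])
    show "finite L" "finite B0" "L \<subseteq> uverts G" "B0 \<subseteq> uverts G" "{b, b'} \<subseteq> uverts G"
      using LB(1-4) B0 b by auto
    show "L \<inter> B0 = {}" "{b, b'} \<inter> L = {}" "{b, b'} \<inter> B0 = {}"
      using LB(5) B0 b by auto
    show "\<forall>l\<in>L. \<forall>b\<in>B0. {l, b} \<in> uedges G" using LB(7) B0(1) by blast
    show "\<forall>q\<in>{b, b'}. (\<forall>l\<in>L. {l, q} \<in> uedges G) \<or> (\<forall>y\<in>B0. {y, q} \<in> uedges G)"
      using LB(7) b by blast
  qed
  then show False using nm by (simp add: add.commute)
qed

lemma outside_neighbour_unique:
  assumes G: "simple_graph G" and nm: "\<not> has_clique_minor (s + 2) G"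
    and LB: "finite L" "finite B" "L \<subseteq> uverts G" "B \<subseteq> uverts G" "L \<inter> B = {}"
      "card L = s" "\<forall>l\<in>L. \<forall>b\<in>B. {l, b} \<in> uedges G" "card B \<ge> s + 2"
    and a: "a \<notin> L" "a \<notin> B" and b: "b \<in> B" "b' \<in> B" "{a, b} \<in> uedges G" "{a, b'} \<in> uedges G"
  shows "b = b'"
proof (rule ccontr)
  assume ne: "b \<noteq> b'"
  \<comment> \<open>contracting \<open>a\<close> into \<open>b\<close> creates an edge inside the common neighbourhood \<open>B\<close>\<close>
  have e: "{b, a} \<in> uedges G" using b by (simp add: insert_commute)
  have "{b, b'} \<notin> uedges (contract_edge G b a)"
  proof (rule common_neighbours_independent[of _ s L B])
    show "\<not> has_clique_minor (s + 2) (contract_edge G b a)"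
      using nm has_clique_minor_contract[OF _ e] by blast
    show "simple_graph (contract_edge G b a)" by (rule simple_graph_contract[OF G e])
    show "L \<subseteq> uverts (contract_edge G b a)" "B \<subseteq> uverts (contract_edge G b a)"
      using LB(3,4) a by (auto simp: contract_edge_def)
    show "\<forall>l\<in>L. \<forall>y\<in>B. {l, y} \<in> uedges (contract_edge G b a)"
    proof (intro ballI)
      fix l y assume ly: "l \<in> L" "y \<in> B"
      then have "{l, y} \<in> uedges G" "l \<noteq> y" "l \<noteq> a" "y \<noteq> a" using LB(5,7) a by auto
      then show "{l, y} \<in> uedges (contract_edge G b a)"
        unfolding edge_contract_iff[OF G e] by simp
    qed
  qed (fact LB b)+
  moreover have "b \<noteq> a" "b' \<noteq> a" using a b by auto
  ultimately show False using ne b(4) edge_contract_iff[OF G e, of b b'] by simp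
qed

section \<open>Edge density of graphs without a clique minor\<close>

lemma edge_in_neighbours_iff:
  "simple_graph G \<Longrightarrow> w \<in> neighbours G v \<longleftrightarrow> {v, w} \<in> uedges G"
  by (auto simp: neighbours_def dest: simple_graph_edgeD(2))

lemma finite_neighbours: "simple_graph G \<Longrightarrow> finite (neighbours G v)"
  by (simp add: neighbours_def simple_graph_finite(1))

lemma neighbours_sym: "simple_graph G \<Longrightarrow> w \<in> neighbours G v \<longleftrightarrow> v \<in> neighbours G w"
  by (simp add: edge_in_neighbours_iff insert_commute)

text \<open>The degree sum counts every edge twice. Contraction destroys the edge itself and
  identifies one pair of parallel edges for every common neighbour of its ends.\<close>

lemma degree_sum_contract:
  assumes G: "simple_graph G" and e: "{u, v} \<in> uedges G"
  shows "(\<Sum>x\<in>uverts G. card (neighbours G x)) \<le>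
    (\<Sum>x\<in>uverts (contract_edge G u v). card (neighbours (contract_edge G u v) x)) +
      2 * card (neighbours G u \<inter> neighbours G v) + 2"
proof -
  define C where "C = contract_edge G u v"
  define W where "W = uverts G - {u, v}"
  define I where "I = neighbours G u \<inter> neighbours G v"
  note sC = simple_graph_contract[OF G e, folded C_def]
  note eC = edge_contract_iff[OF G e, folded C_def]
  note eG = edge_in_neighbours_iff[OF G] and eCn = edge_in_neighbours_iff[OF sC]
  note d = simple_graph_edgeD[OF G e] and dG = simple_graph_edgeD[OF G]
  have fW: "finite W" using simple_graph_finite[OF G] by (auto simp: W_def)
  have V: "uverts G = insert u (insert v W)" "u \<notin> insert v W" "v \<notin> W" "uverts C = insert u W" "u \<notin> W"
    using d by (auto simp: W_def C_def contract_edge_def)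
  have IW: "I \<subseteq> W" using dG(2) dG(3)[of u u] dG(3)[of v v] by (auto simp: I_def W_def eG)
  have v: "v \<in> neighbours G u" "u \<in> neighbours G v" using e by (auto simp: eG insert_commute)
  have "neighbours C u = (neighbours G u \<union> neighbours G v) - {u, v}"
    using d dG(3)[of u u] dG(3)[of v v] unfolding set_eq_iff eCn eC eG Un_iff Diff_iff
    by (auto simp: insert_commute)
  moreover have "{u, v} \<subseteq> neighbours G u \<union> neighbours G v" using v by auto
  ultimately have "card (neighbours C u) = card (neighbours G u \<union> neighbours G v) - 2"
    using d finite_neighbours[OF G] by (simp add: card_Diff_subset)
  moreover have "card (neighbours G u) + card (neighbours G v) =
      card (neighbours G u \<union> neighbours G v) + card I"
    unfolding I_def using finite_neighbours[OF G] by (intro card_Un_Int) auto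
  ultimately have cu: "card (neighbours G u) + card (neighbours G v) \<le> card (neighbours C u) + card I + 2"
    by linarith
  have cx: "card (neighbours G x) \<le> card (neighbours C x) + (if x \<in> I then 1 else 0)" if x: "x \<in> W" for x
  proof -
    have sub: "neighbours G x - {v} \<subseteq> neighbours C x"
      using x dG(3)[of x x] unfolding subset_iff eCn eC eG Diff_iff W_def by auto
    show ?thesis
    \<comment> \<open>A vertex that sees \<open>v\<close> but not \<open>u\<close> exchanges the
      neighbour \<open>v\<close> for \<open>u\<close> and keeps its degree; only a common neighbour
      of both ends loses one.\<close>
    proof (cases "v \<in> neighbours G x \<and> u \<notin> neighbours G x")
      case True
      then have "insert u (neighbours G x - {v}) \<subseteq> neighbours C x"
        using sub x d unfolding insert_subset eCn eC eG W_def by (auto simp: insert_commute)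
      then have "card (insert u (neighbours G x - {v})) \<le> card (neighbours C x)"
        by (intro card_mono finite_neighbours sC)
      moreover have "card (insert u (neighbours G x - {v})) = card (neighbours G x)"
        using True finite_neighbours[OF G, of x] card.remove[OF finite_neighbours[OF G], of v x] by simp
      ultimately show ?thesis by simp
    next
      case False
      have "card (neighbours G x) \<le> card (neighbours G x - {v}) + (if x \<in> I then 1 else 0)"
      proof (cases "v \<in> neighbours G x")
        case True
        then have "x \<in> I" using False neighbours_sym[OF G] by (auto simp: I_def)
        then show ?thesis using card.remove[OF finite_neighbours[OF G] True] by simp
      qed simp
      also have "card (neighbours G x - {v}) \<le> card (neighbours C x)"
        by (intro card_mono finite_neighbours sC sub)
      finally show ?thesis by simp
    qed
  qed
  have "(\<Sum>x\<in>W. card (neighbours G x)) \<le> (\<Sum>x\<in>W. card (neighbours C x) + (if x \<in> I then 1 else 0))"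
    by (intro sum_mono cx)
  also have "\<dots> = (\<Sum>x\<in>W. card (neighbours C x)) + card I"
    using fW IW by (simp add: sum.distrib sum.If_cases Int_absorb1 Int_absorb2 Int_def[symmetric] flip: sum.inter_filter)
  finally have "(\<Sum>x\<in>W. card (neighbours G x)) \<le> (\<Sum>x\<in>W. card (neighbours C x)) + card I" .
  then show ?thesis
    using cu V fW unfolding C_def[symmetric] I_def[symmetric] by simp
qed

text \<open>Mader's argument: contract an edge with few common neighbours; if there is none, every
  neighbourhood is dense and contains a clique minor of order one less.\<close>

lemma dense_has_clique_minor:
  assumes "simple_graph G" "uverts G \<noteq> {}"
    "2 ^ Suc k * card (uverts G) \<le> (\<Sum>x\<in>uverts G. card (neighbours G x))"
  shows "has_clique_minor (k + 2) G"
  using assms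
proof (induction k arbitrary: G)
  case 0
  have "card (uverts G) > 0" using 0 simple_graph_finite by (simp add: card_gt_0_iff)
  then have "0 < 2 ^ Suc 0 * card (uverts G)" by simp
  then have "(\<Sum>x\<in>uverts G. card (neighbours G x)) \<noteq> 0" using 0(3) by linarith
  then obtain x where "card (neighbours G x) \<noteq> 0" by (meson sum.neutral)
  then have "neighbours G x \<noteq> {}" by auto
  then obtain y where "{x, y} \<in> uedges G" by (auto simp: neighbours_def)
  then show ?case using has_clique_minor_edge[OF 0(1)] by (simp add: numeral_2_eq_2)
next
  case (Suc k)
  show ?case using Suc.prems
  proof (induction "card (uverts G)" arbitrary: G rule: less_induct)
    case less
    note G = less.prems(1)
    have "card (uverts G) > 0" using less.prems simple_graph_finite by (simp add: card_gt_0_iff)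
    then have "0 < 2 ^ Suc (Suc k) * card (uverts G)" by simp
    then have "(\<Sum>x\<in>uverts G. card (neighbours G x)) \<noteq> 0" using less.prems(3) by linarith
    then obtain x where x: "x \<in> uverts G" "card (neighbours G x) \<noteq> 0" by (meson sum.neutral)
    show ?case
    proof (cases "\<exists>u v. {u, v} \<in> uedges G \<and> card (neighbours G u \<inter> neighbours G v) < 2 ^ Suc k")
      case True
      then obtain u v where uv: "{u, v} \<in> uedges G" "card (neighbours G u \<inter> neighbours G v) < 2 ^ Suc k"
        by blast
      note d = simple_graph_edgeD[OF G uv(1)]
      have c: "card (uverts G) = Suc (card (uverts (contract_edge G u v)))"
        using card.remove[OF simple_graph_finite(1)[OF G] d(2)] by (simp add: contract_edge_def)
      \<comment> \<open>The left side drops by \<open>2 ^ (k + 2)\<close> with the lost vertex. With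
        fewer than \<open>2 ^ (k + 1)\<close> common neighbours the degree sum drops by at most
        \<open>2 * (2 ^ (k + 1) - 1) + 2\<close>, the same amount.\<close>
      have "2 ^ Suc (Suc k) * card (uverts (contract_edge G u v)) \<le>
          (\<Sum>x\<in>uverts (contract_edge G u v). card (neighbours (contract_edge G u v) x))"
        using degree_sum_contract[OF G uv(1)] less.prems(3) uv(2) c by simp
      moreover have "uverts (contract_edge G u v) \<noteq> {}" using d by (auto simp: contract_edge_def)
      ultimately have "has_clique_minor (Suc k + 2) (contract_edge G u v)"
        using c simple_graph_contract[OF G uv(1)] by (intro less.hyps) auto
      then show ?thesis by (rule has_clique_minor_contract[OF _ uv(1)])
    next
      case False
      define N where "N = neighbours G x"
      define H where "H = induced_subgraph G N"
      have "neighbours G x \<noteq> {}" using x by auto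
      then have N: "N \<subseteq> uverts G" "N \<noteq> {}" "finite N" "x \<notin> N"
        using x simple_graph_edgeD(3)[OF G, of x x] finite_neighbours[OF G, of x]
        by (auto simp: N_def neighbours_def)
      have H: "simple_graph H" unfolding H_def by (rule simple_graph_induced[OF G N(1)])
      have nH: "neighbours H y = neighbours G x \<inter> neighbours G y" if "y \<in> N" for y
        using that by (auto simp: H_def induced_subgraph_def neighbours_def N_def)
      have "2 ^ Suc k * card N = (\<Sum>y\<in>N. 2 ^ Suc k)" by simp
      \<comment> \<open>The degree of \<open>y\<close> inside the neighbourhood of \<open>x\<close>
        is the number of common neighbours of \<open>x\<close> and \<open>y\<close>, which is at
        least \<open>2 ^ Suc k\<close> as no edge can be contracted cheaply.\<close>
      also have "\<dots> \<le> (\<Sum>y\<in>N. card (neighbours H y))"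
      proof (rule sum_mono)
        fix y assume y: "y \<in> N"
        then have "{x, y} \<in> uedges G" by (simp add: N_def edge_in_neighbours_iff[OF G])
        then show "2 ^ Suc k \<le> card (neighbours H y)" using False nH[OF y] by (metis not_less)
      qed
      finally have "has_clique_minor (k + 2) H"
        using Suc.IH[OF H] N by (simp add: H_def induced_subgraph_def)
      then have m: "has_clique_minor (Suc (k + 2)) (cone x H)"
        using N by (intro has_clique_minor_cone H) (auto simp: H_def induced_subgraph_def)
      have sub: "uverts (cone x H) \<subseteq> uverts G" "uedges (cone x H) \<subseteq> uedges G"
        using x N by (auto simp: cone_def H_def induced_subgraph_def N_def edge_in_neighbours_iff[OF G])
      moreover have "simple_graph (cone x H)"
      proof -
        have "\<forall>e\<in>uedges (cone x H). e \<subseteq> uverts (cone x H)"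
          by (auto simp: cone_def H_def induced_subgraph_def)
        then show ?thesis using G sub unfolding simple_graph_def by (meson finite_subset subsetD)
      qed
      ultimately show ?thesis using has_clique_minor_subgraph[OF m G] by simp
    qed
  qed
qed

text \<open>A minor of an induced subgraph is a minor of the whole graph, so the density bound holds
  on every vertex set. This hereditary form is what degeneracy requires.\<close>

lemma degree_sum_less:
  assumes G: "simple_graph G" and nm: "\<not> has_clique_minor (k + 2) G" and S: "S \<subseteq> uverts G"
  shows "(\<Sum>v\<in>S. card (neighbours G v \<inter> S)) \<le> 2 ^ Suc k * card S"
proof (cases "S = {}")
  case False
  have n: "neighbours (induced_subgraph G S) v = neighbours G v \<inter> S" if "v \<in> S" for v
    using that S by (auto simp: neighbours_def induced_subgraph_def)
  have "\<not> has_clique_minor (k + 2) (induced_subgraph G S)"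
    using has_clique_minor_induced[OF _ G S] nm by blast
  then have "\<not> 2 ^ Suc k * card (uverts (induced_subgraph G S)) \<le>
      (\<Sum>x\<in>uverts (induced_subgraph G S). card (neighbours (induced_subgraph G S) x))"
    using dense_has_clique_minor[OF simple_graph_induced[OF G S]] False
    by (auto simp: induced_subgraph_def)
  then show ?thesis using n by (simp add: induced_subgraph_def)
qed simp

lemma minor_free_no_clique_minor:
  assumes "minor_free (complete_graph {..<r}) G"
  shows "\<not> has_clique_minor r G"
proof
  assume "has_clique_minor r G"
  then obtain W where W: "finite W" "card W = r" "reduces_to G (complete_graph W)"
    unfolding has_clique_minor_def by blast
  obtain f where f: "bij_betw f W {..<r}" using W finite_same_card_bij[of W "{..<r}"] by auto
  have "graph_iso (complete_graph W) (complete_graph {..<r})"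
    unfolding graph_iso_def
  proof (intro exI conjI ballI)
    show "bij_betw f (uverts (complete_graph W)) (uverts (complete_graph {..<r}))"
      using f by (simp add: complete_graph_def)
    fix u v assume "u \<in> uverts (complete_graph W)" "v \<in> uverts (complete_graph W)"
    then have uv: "u \<in> W" "v \<in> W" by (auto simp: complete_graph_def)
    then have "f u = f v \<longleftrightarrow> u = v" "f u < r" "f v < r"
      using f by (auto simp: bij_betw_def inj_on_def)
    then show "{u, v} \<in> uedges (complete_graph W) \<longleftrightarrow> {f u, f v} \<in> uedges (complete_graph {..<r})"
      using uv by (auto simp: complete_graph_def card_insert_if)
  qed
  then show False using assms W unfolding minor_free_def is_minor_def by blast
qed

section \<open>Sparse graphs with a Perron vector\<close>

text \<open>Collects the consequences of excluding a clique minor of order \<open>s + 2\<close>,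
  phrased with a neighbourhood function; the spectral argument below works from these alone and
  never mentions minors.\<close>

locale sparse_graph =
  fixes V :: "'a set" and N :: "'a \<Rightarrow> 'a set" and c s :: nat
  assumes finite_V: "finite V"
    and N_subset: "N v \<subseteq> V"
    and N_sym: "w \<in> N v \<longleftrightarrow> v \<in> N w"
    and N_irrefl: "v \<notin> N v"
    and sparse: "S \<subseteq> V \<Longrightarrow> (\<Sum>v\<in>S. card (N v \<inter> S)) \<le> c * card S"
    and common_few: "\<lbrakk>L \<subseteq> V; B \<subseteq> V; L \<inter> B = {}; card L = Suc s; \<forall>l\<in>L. B \<subseteq> N l\<rbrakk> \<Longrightarrow> card B \<le> s"
    and common_independent: "\<lbrakk>L \<subseteq> V; B \<subseteq> V; L \<inter> B = {}; card L = s; \<forall>l\<in>L. B \<subseteq> N l;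
      s + 2 \<le> card B; v \<in> B\<rbrakk> \<Longrightarrow> N v \<inter> B = {}"
    and common_unique: "\<lbrakk>L \<subseteq> V; B \<subseteq> V; L \<inter> B = {}; card L = s; \<forall>l\<in>L. B \<subseteq> N l;
      s + 2 \<le> card B; v \<in> V - L - B\<rbrakk> \<Longrightarrow> card (N v \<inter> B) \<le> 1"
    and s_pos: "1 \<le> s"
begin

lemma finite_N: "finite (N v)"
  using finite_V N_subset by (rule finite_subset[rotated])

lemma finite_sub: "S \<subseteq> V \<Longrightarrow> finite S"
  using finite_V by (rule finite_subset[rotated])

lemma sum_neighbours_remove:
  fixes f :: "'a \<Rightarrow> real"
  assumes "v \<in> S"
  shows "(\<Sum>w\<in>N u \<inter> S. f w) = (\<Sum>w\<in>N u \<inter> (S - {v}). f w) + (if u \<in> N v then f v else 0)"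
proof (cases "u \<in> N v")
  case True
  then have "N u \<inter> S = insert v (N u \<inter> (S - {v}))" using assms N_sym by auto
  then show ?thesis using True finite_N by simp
next
  case False
  then have "N u \<inter> S = N u \<inter> (S - {v})" using N_sym by auto
  then show ?thesis using False by simp
qed

text \<open>Remove a vertex of degree at most \<open>c\<close> and weight each of its edges by AM-GM.\<close>

lemma degeneracy_bound:
  fixes x :: "'a \<Rightarrow> real" and t :: real
  assumes "0 < t" "S \<subseteq> V"
  shows "(\<Sum>u\<in>S. \<Sum>w\<in>N u \<inter> S. x u * x w) \<le>
    (\<Sum>u\<in>S. (c * t + card (N u \<inter> S) / t) * (x u)\<^sup>2)"
  using assms(2)
proof (induction "card S" arbitrary: S)
  case 0
  then show ?case using finite_sub by auto
next
  case (Suc k)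
  note fS = finite_sub[OF Suc.prems]
  obtain v where v: "v \<in> S" "card (N v \<inter> S) \<le> c"
  proof (rule ccontr)
    assume "\<not> thesis"
    then have "\<forall>v\<in>S. c < card (N v \<inter> S)" using that by (meson not_less)
    then have "(\<Sum>v\<in>S. c) < (\<Sum>v\<in>S. card (N v \<inter> S))"
      using fS Suc.hyps(2) by (intro sum_strict_mono) auto
    then show False using sparse[OF Suc.prems] by (simp add: mult.commute)
  qed
  define S' where "S' = S - {v}"
  define M where "M = N v \<inter> S"
  have S: "S = insert v S'" "v \<notin> S'" "finite S'" using v fS by (auto simp: S'_def)
  have M: "M = N v \<inter> S'" "M \<subseteq> S'" using N_irrefl by (auto simp: M_def S'_def)
  have IH: "(\<Sum>u\<in>S'. \<Sum>w\<in>N u \<inter> S'. x u * x w) \<le>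
      (\<Sum>u\<in>S'. (c * t + card (N u \<inter> S') / t) * (x u)\<^sup>2)"
    using Suc v fS by (intro Suc.hyps) (auto simp: S'_def)
  have on_M: "(\<Sum>u\<in>S'. if u \<in> N v then h u else 0) = (\<Sum>u\<in>M. h u)" for h :: "'a \<Rightarrow> real"
    unfolding M(1) using S(3) by (simp add: Int_commute sum.inter_restrict)
  note rem = sum_neighbours_remove[OF v(1), folded S'_def]
  have card_rem: "real (card (N u \<inter> S)) = real (card (N u \<inter> S')) + (if u \<in> N v then 1 else 0)" for u
    using rem[of "\<lambda>_. 1" u] by simp
  have "(\<Sum>u\<in>S. \<Sum>w\<in>N u \<inter> S. x u * x w) =
      (\<Sum>w\<in>M. x v * x w) + (\<Sum>u\<in>S'. (\<Sum>w\<in>N u \<inter> S'. x u * x w) + (if u \<in> N v then x u * x v else 0))"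
    using S rem by (simp add: M_def)
  also have "\<dots> = (\<Sum>u\<in>S'. \<Sum>w\<in>N u \<inter> S'. x u * x w) + (\<Sum>w\<in>M. 2 * (x v * x w))"
    by (simp add: sum.distrib on_M mult.commute flip: sum_distrib_left)
  also have "\<dots> \<le> (\<Sum>u\<in>S'. (c * t + card (N u \<inter> S') / t) * (x u)\<^sup>2) +
      (\<Sum>w\<in>M. t * (x v)\<^sup>2 + (x w)\<^sup>2 / t)"
  \<comment> \<open>The weights are asymmetric: the removed vertex pays \<open>t\<close> for each of
    at most \<open>c\<close> edges, and a remaining neighbour pays \<open>1 / t\<close>, over the
    whole induction at most once per incident edge.\<close>
  proof (intro add_mono IH sum_mono)
    fix w
    have "0 \<le> (t * x v - x w)\<^sup>2 / t" using assms by simp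
    also have "\<dots> = t * (x v)\<^sup>2 + (x w)\<^sup>2 / t - 2 * (x v * x w)"
      using assms by (simp add: field_simps power2_eq_square)
    finally show "2 * (x v * x w) \<le> t * (x v)\<^sup>2 + (x w)\<^sup>2 / t" by simp
  qed
  also have "\<dots> = (\<Sum>u\<in>S'. (c * t + card (N u \<inter> S') / t) * (x u)\<^sup>2) +
      (\<Sum>w\<in>M. (x w)\<^sup>2 / t) + card M * t * (x v)\<^sup>2"
    by (simp add: sum.distrib)
  also have "(\<Sum>w\<in>M. (x w)\<^sup>2 / t) = (\<Sum>u\<in>S'. if u \<in> N v then (x u)\<^sup>2 / t else 0)"
    by (rule on_M[symmetric])
  also have "(\<Sum>u\<in>S'. (c * t + card (N u \<inter> S') / t) * (x u)\<^sup>2) +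
      (\<Sum>u\<in>S'. if u \<in> N v then (x u)\<^sup>2 / t else 0) = (\<Sum>u\<in>S'. (c * t + card (N u \<inter> S) / t) * (x u)\<^sup>2)"
    unfolding sum.distrib[symmetric] by (intro sum.cong) (auto simp: card_rem add_divide_distrib distrib_right)
  also have "\<dots> + card M * t * (x v)\<^sup>2 \<le>
      (\<Sum>u\<in>S'. (c * t + card (N u \<inter> S) / t) * (x u)\<^sup>2) + (c * t + card (N v \<inter> S) / t) * (x v)\<^sup>2"
  proof -
    have "card M * t \<le> c * t" using v assms by (simp add: M_def)
    moreover have "0 \<le> card (N v \<inter> S) / t" using assms by simp
    ultimately have "card M * t * (x v)\<^sup>2 \<le> (c * t + card (N v \<inter> S) / t) * (x v)\<^sup>2"
      by (intro mult_right_mono) auto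
    then show ?thesis by simp
  qed
  also have "\<dots> = (\<Sum>u\<in>S. (c * t + card (N u \<inter> S) / t) * (x u)\<^sup>2)"
    by (simp add: sum.remove[OF fS v(1), folded S'_def])
  finally show ?case .
qed

text \<open>Each such vertex sees all of some \<open>(s + 1)\<close>-subset of \<open>H\<close>.
  Every such subset has at most \<open>s\<close> common neighbours outside \<open>H\<close>, and
  there are at most \<open>2 ^ card H\<close> subsets.\<close>

lemma card_many_neighbours:
  assumes H: "H \<subseteq> V"
  shows "card {w \<in> V - H. s < card (N w \<inter> H)} \<le> s * 2 ^ card H"
proof -
  define T where "T = {T. T \<subseteq> H \<and> card T = Suc s}"
  define K where "K = (\<lambda>T. {w \<in> V - H. T \<subseteq> N w})"
  note fH = finite_sub[OF H]
  have fT: "finite T" unfolding T_def using fH by simp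
  have K: "card (K S) \<le> s" if "S \<in> T" for S
    using that H N_sym by (intro common_few[of S]) (auto simp: T_def K_def)
  have "{w \<in> V - H. s < card (N w \<inter> H)} \<subseteq> (\<Union>S\<in>T. K S)"
  proof
    fix w assume w: "w \<in> {w \<in> V - H. s < card (N w \<inter> H)}"
    then obtain S where "S \<subseteq> N w \<inter> H" "card S = Suc s"
      by (metis (no_types, lifting) Suc_leI mem_Collect_eq obtain_subset_with_card_n)
    then show "w \<in> (\<Union>S\<in>T. K S)" using w by (auto simp: T_def K_def)
  qed
  then have "card {w \<in> V - H. s < card (N w \<inter> H)} \<le> card (\<Union>S\<in>T. K S)"
    using fT finite_V by (intro card_mono) (auto simp: K_def)
  also have "\<dots> \<le> (\<Sum>S\<in>T. card (K S))" by (rule card_UN_le[OF fT])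
  also have "\<dots> \<le> (\<Sum>S\<in>T. s)" by (intro sum_mono K)
  also have "\<dots> = card T * s" by simp
  also have "card T \<le> card (Pow H)" using fH by (intro card_mono) (auto simp: T_def)
  also have "card (Pow H) = 2 ^ card H" by (rule card_Pow[OF fH])
  finally show ?thesis by (simp add: mult.commute)
qed

end

text \<open>The parameter \<open>z\<close> is the entry off the clique of the Perron vector of the join of \<open>K\<^sub>s\<close> with
  \<open>n - s\<close> isolated vertices, scaled to \<open>1\<close> on the clique; the lower bound for \<open>\<rho>\<close> is the \<open>\<alpha>\<close>-index of that graph.\<close>

locale perron_graph = sparse_graph +
  fixes a b \<rho> z :: real and x :: "'a \<Rightarrow> real"
  assumes a_pos: "0 < a" and b_pos: "0 < b" and ab: "a + b = 1"
    and x_nonneg: "0 \<le> x v"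
    and x_nonzero: "\<exists>v\<in>V. x v \<noteq> 0"
    and eigen: "v \<in> V \<Longrightarrow> \<rho> * x v = a * card (N v) * x v + b * (\<Sum>w\<in>N v. x w)"
    and z_pos: "0 < z" and z_le_1: "z \<le> 1"
    and z_eq: "z * (a * (real (card V) - 1) + b * (real s - 1) + b * (real (card V) - s) * z - a * s) = b * s"
    and \<rho>_ge: "a * (real (card V) - 1) + b * (real s - 1) + b * (real (card V) - s) * z \<le> \<rho>"
    and s_le: "4 * (s + 1) \<le> card V"
begin

section \<open>Bounds on \<open>p\<close>, \<open>z\<close> and \<open>\<rho>\<close> uniform in
  \<open>a\<close>\<close>

abbreviation n :: real where "n \<equiv> real (card V)"

definition p :: real where "p = b / \<rho>"

lemma s_le': "4 * real s + 4 \<le> n"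
  using of_nat_mono[OF s_le, where 'a = real] by simp

lemma s_pos': "1 \<le> real s" using s_pos by linarith

lemma \<rho>_pos: "0 < \<rho>"
proof -
  have "0 < a * (n - 1)" using a_pos s_le' s_pos' by simp
  moreover have "0 \<le> b * (real s - 1)" using b_pos s_pos' by simp
  moreover have "0 \<le> b * (n - s) * z" using b_pos z_pos s_le' s_pos' by simp
  ultimately show ?thesis using \<rho>_ge by linarith
qed

lemma p_pos: "0 < p" using b_pos \<rho>_pos by (simp add: p_def)

lemma a_bound: "a * n \<le> 2 * \<rho>"
proof -
  have "0 \<le> b * (real s - 1)" "0 \<le> b * (n - s) * z"
    using b_pos s_pos' z_pos s_le' by simp_all
  then have "a * (n - 1) \<le> \<rho>" using \<rho>_ge by linarith
  moreover have "a * n \<le> a * (2 * (n - 1))" using a_pos s_le' s_pos' by (intro mult_left_mono) auto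
  ultimately show ?thesis by linarith
qed

text \<open>By \<open>z_eq\<close>, \<open>z\<close> is \<open>b * s\<close> divided by the index of
  the join less \<open>a * s\<close>; replacing that denominator by the larger \<open>\<rho>\<close>
  gives \<open>p * s\<close>.\<close>

lemma p_le_z: "p * s \<le> z"
proof -
  have "0 \<le> a * s" using a_pos by simp
  then have "z * (a * (n - 1) + b * (real s - 1) + b * (n - s) * z - a * s) \<le> z * \<rho>"
    using z_pos \<rho>_ge by (intro mult_left_mono) auto
  then have "b * s \<le> z * \<rho>" using z_eq by simp
  then show ?thesis using \<rho>_pos by (simp add: p_def field_simps)
qed

text \<open>Dropping the nonnegative \<open>a\<close>-part of \<open>z_eq\<close> leaves an
  inequality with the factor \<open>b\<close> on both sides. Cancelling it is the source of all
  uniformity in \<open>a\<close>.\<close>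

lemma z_square: "z\<^sup>2 * (n - s) \<le> s"
proof -
  have "0 \<le> a * (n - 1 - s)" "0 \<le> b * (real s - 1)"
    using a_pos b_pos s_pos' s_le' by simp_all
  then have "b * (n - s) * z \<le> a * (n - 1) + b * (real s - 1) + b * (n - s) * z - a * s"
    by (simp add: algebra_simps)
  then have "z * (b * (n - s) * z) \<le> b * s"
    unfolding z_eq[symmetric] using z_pos by (intro mult_left_mono) auto
  then have "b * (z\<^sup>2 * (n - s)) \<le> b * s" by (simp add: power2_eq_square mult_ac)
  then show ?thesis using b_pos by simp
qed

lemma z_square_n: "z\<^sup>2 * n \<le> 2 * s"
proof -
  have "z\<^sup>2 * n \<le> z\<^sup>2 * (2 * (n - s))" using s_le' by (intro mult_left_mono) auto
  then show ?thesis using z_square by linarith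
qed

lemma p_square_n: "s * (p\<^sup>2 * n) \<le> 2"
proof -
  have "(p * s)\<^sup>2 * n \<le> z\<^sup>2 * n"
    using p_le_z p_pos by (intro mult_right_mono power_mono) auto
  then have "s * (s * (p\<^sup>2 * n)) \<le> s * 2" using z_square_n by (simp add: power2_eq_square mult_ac)
  then show ?thesis using s_pos' by simp
qed

lemma p_square_n_le: "p\<^sup>2 * n \<le> 2"
proof -
  have "1 * (p\<^sup>2 * n) \<le> s * (p\<^sup>2 * n)" using s_pos' by (intro mult_right_mono) auto
  then show ?thesis using p_square_n by simp
qed

text \<open>Restates the lower bound in terms of \<open>p\<close> instead of \<open>z\<close>, so
  that it can be compared term by term with upper bounds obtained by elimination, which are
  expressed in \<open>p\<close>.\<close>

lemma \<rho>_ge_p: "a * (n - 1) + b * (real s - 1) + b * s * (n - s) * p \<le> \<rho>"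
proof -
  have "b * (n - s) * (p * s) \<le> b * (n - s) * z"
    using p_le_z b_pos s_le' s_pos' by (intro mult_left_mono) auto
  then show ?thesis using \<rho>_ge by (simp add: mult_ac)
qed

abbreviation d :: "'a \<Rightarrow> real" where "d v \<equiv> real (card (N v))"

lemma d_le: "v \<in> V \<Longrightarrow> d v \<le> n - 1"
proof -
  assume v: "v \<in> V"
  have "card (N v) \<le> card (V - {v})"
    using N_subset N_irrefl finite_V by (intro card_mono) auto
  also have "\<dots> = card V - 1" using v by simp
  finally have "real (card (N v)) \<le> real (card V - 1)" by (rule of_nat_mono)
  then show ?thesis using s_le by (simp add: of_nat_diff)
qed

lemma sum_Int_if: "finite R \<Longrightarrow> (\<Sum>w\<in>M \<inter> R. f w) = (\<Sum>w\<in>R. if w \<in> M then f w else (0 :: real))"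
  by (subst Int_commute) (simp add: sum.inter_restrict)

lemma b_mult: "b * y = \<rho> * (p * y)"
  using \<rho>_pos by (simp add: p_def)

lemma square_sum_le_card:
  assumes "finite S" "card S \<le> m"
  shows "(\<Sum>u\<in>S. x u)\<^sup>2 \<le> m * (\<Sum>u\<in>S. (x u)\<^sup>2)"
proof -
  have "(\<Sum>u\<in>S. x u)\<^sup>2 \<le> (\<Sum>u\<in>S. (x u)\<^sup>2) * card S"
    by (rule sum_squared_le_sum_of_squares)
  also have "\<dots> \<le> (\<Sum>u\<in>S. (x u)\<^sup>2) * m"
    using assms by (intro mult_left_mono) (auto simp: sum_nonneg)
  finally show ?thesis by (simp add: mult.commute)
qed

section \<open>Elimination of the vertices outside \<open>H\<close>\<close>

lemma sum_split_neighbours: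
  fixes f :: "'a \<Rightarrow> real"
  assumes "H \<subseteq> V"
  shows "(\<Sum>w\<in>N v. f w) = (\<Sum>w\<in>N v \<inter> H. f w) + (\<Sum>w\<in>N v \<inter> (V - H). f w)"
proof -
  have "N v = (N v \<inter> H) \<union> (N v \<inter> (V - H))" using N_subset by auto
  then show ?thesis using finite_N
    by (metis (no_types, lifting) Int_Diff Diff_disjoint finite_Int inf_commute sum.union_disjoint inf_assoc inf_bot_right)
qed

text \<open>Multiply the eigenvalue equation by \<open>x w\<close> and sum outside \<open>H\<close>.
  By \<open>degeneracy_bound\<close> the edges inside the complement of \<open>H\<close> cost no
  more than a diagonal form, which \<open>small\<close> absorbs together with the degree
  term.\<close>

lemma rest_bound:
  fixes t :: real
  assumes H: "H \<subseteq> V" and t: "0 < t"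
    and small: "\<And>w. w \<in> V - H \<Longrightarrow> a * d w + b * (c * t + d w / t) \<le> k * \<rho>"
  shows "(1 - k) * \<rho> * (\<Sum>w\<in>V - H. (x w)\<^sup>2) \<le> b * (\<Sum>w\<in>V - H. x w * (\<Sum>u\<in>N w \<inter> H. x u))"
proof -
  define R where "R = V - H"
  define sig where "sig = (\<lambda>w. \<Sum>u\<in>N w \<inter> H. x u)"
  define Y where "Y = (\<Sum>w\<in>R. (x w)\<^sup>2)"
  define T where "T = (\<Sum>w\<in>R. x w * sig w)"
  have R: "R \<subseteq> V" "finite R" "finite H" using H finite_sub by (auto simp: R_def)
  have "\<rho> * Y = (\<Sum>w\<in>R. x w * (\<rho> * x w))"
    by (simp add: Y_def sum_distrib_left power2_eq_square mult_ac)
  also have "\<dots> = (\<Sum>w\<in>R. a * d w * (x w)\<^sup>2 + b * (\<Sum>u\<in>N w \<inter> R. x w * x u) + b * (x w * sig w))"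
  proof (intro sum.cong HOL.refl)
    fix w assume "w \<in> R"
    then have "\<rho> * x w = a * d w * x w + b * (sig w + (\<Sum>u\<in>N w \<inter> R. x u))"
      using eigen sum_split_neighbours[OF H] R by (auto simp: sig_def R_def)
    then show "x w * (\<rho> * x w) = a * d w * (x w)\<^sup>2 + b * (\<Sum>u\<in>N w \<inter> R. x w * x u) + b * (x w * sig w)"
      by (simp add: power2_eq_square algebra_simps sum_distrib_left)
  qed
  also have "\<dots> = (\<Sum>w\<in>R. a * d w * (x w)\<^sup>2) + b * (\<Sum>w\<in>R. \<Sum>u\<in>N w \<inter> R. x w * x u) + b * T"
    by (simp add: sum.distrib sum_distrib_left T_def)
  also have "\<dots> \<le> (\<Sum>w\<in>R. a * d w * (x w)\<^sup>2) +
      b * (\<Sum>w\<in>R. (c * t + card (N w \<inter> R) / t) * (x w)\<^sup>2) + b * T"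
    using degeneracy_bound[OF t R(1)] b_pos by simp
  also have "(\<Sum>w\<in>R. (c * t + card (N w \<inter> R) / t) * (x w)\<^sup>2) \<le> (\<Sum>w\<in>R. (c * t + d w / t) * (x w)\<^sup>2)"
    using t finite_N by (intro sum_mono mult_right_mono add_left_mono divide_right_mono) (auto intro: card_mono)
  also have "(\<Sum>w\<in>R. a * d w * (x w)\<^sup>2) + b * (\<Sum>w\<in>R. (c * t + d w / t) * (x w)\<^sup>2) =
      (\<Sum>w\<in>R. (a * d w + b * (c * t + d w / t)) * (x w)\<^sup>2)"
    unfolding sum_distrib_left sum.distrib[symmetric] by (intro sum.cong HOL.refl) (simp add: algebra_simps)
  also have "\<dots> \<le> (\<Sum>w\<in>R. k * \<rho> * (x w)\<^sup>2)"
    using small by (intro sum_mono mult_right_mono) (auto simp: R_def)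
  also have "\<dots> = k * \<rho> * Y" by (simp add: Y_def sum_distrib_left)
  finally have "(1 - k) * \<rho> * Y \<le> b * T" using b_pos by (simp add: algebra_simps)
  then show ?thesis by (simp add: Y_def T_def sig_def R_def)
qed

text \<open>Outside \<open>H\<close> the form \<open>\<rho> - a D - b A\<close> is at least \<open>(1 - k) \<rho>\<close>, so these vertices can be
  eliminated at the cost of the last term.\<close>

lemma quadratic_bound:
  fixes t :: real
  assumes H: "H \<subseteq> V" and k: "0 \<le> k" "k \<le> 1 / 2" and t: "0 < t"
    and small: "\<And>w. w \<in> V - H \<Longrightarrow> a * d w + b * (c * t + d w / t) \<le> k * \<rho>"
  shows "\<rho> * (\<Sum>u\<in>H. (x u)\<^sup>2) \<le> a * (\<Sum>u\<in>H. d u * (x u)\<^sup>2)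
    + b * (\<Sum>u\<in>H. \<Sum>w\<in>N u \<inter> H. x u * x w)
    + b * (p * (1 + 2 * k)) * (\<Sum>w\<in>V - H. (\<Sum>u\<in>N w \<inter> H. x u)\<^sup>2)"
proof -
  define R where "R = V - H"
  define sig where "sig = (\<lambda>w. \<Sum>u\<in>N w \<inter> H. x u)"
  define Y where "Y = (\<Sum>w\<in>R. (x w)\<^sup>2)"
  define T where "T = (\<Sum>w\<in>R. x w * sig w)"
  define Z where "Z = (\<Sum>w\<in>R. (sig w)\<^sup>2)"
  have R: "R \<subseteq> V" "finite R" "finite H" using H finite_sub by (auto simp: R_def)
  have Z0: "0 \<le> Z" "0 \<le> Y" by (auto simp: Z_def Y_def sum_nonneg)
  have Y: "(1 - k) * \<rho> * Y \<le> b * T"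
    using rest_bound[OF H t small] by (simp add: Y_def T_def sig_def R_def)
  have T2: "T\<^sup>2 \<le> Y * Z"
    unfolding T_def Y_def Z_def by (rule Cauchy_Schwarz_ineq_sum)
  have T: "T \<le> p * (1 + 2 * k) * Z"
  proof (cases "T \<le> 0")
    case True
    have "0 \<le> p * (1 + 2 * k) * Z" using p_pos k Z0 by simp
    then show ?thesis using True by linarith
  next
    case False
    have "(1 - k) * \<rho> * T\<^sup>2 \<le> (1 - k) * \<rho> * (Y * Z)"
      using k \<rho>_pos T2 by (intro mult_left_mono) auto
    also have "\<dots> = ((1 - k) * \<rho> * Y) * Z" by (simp only: mult.assoc)
    also have "\<dots> \<le> (b * T) * Z" by (rule mult_right_mono[OF Y Z0(1)])
    also have "\<dots> = (b * Z) * T" by (simp only: mult.assoc mult.commute[of T Z])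
    finally have "((1 - k) * \<rho> * T) * T \<le> (b * Z) * T" by (simp only: power2_eq_square mult.assoc)
    then have "(1 - k) * \<rho> * T \<le> b * Z" using False by simp
    also have "\<dots> = \<rho> * (p * Z)" by (rule b_mult)
    finally have "\<rho> * ((1 - k) * T) \<le> \<rho> * (p * Z)" by (simp only: mult.assoc mult.left_commute[of \<rho> "1 - k"])
    then have "(1 - k) * T \<le> p * Z" using \<rho>_pos by simp
    \<comment> \<open>For \<open>k\<close> between 0 and 1/2, \<open>(1 + 2 * k) * (1 - k)\<close>
      is at least 1, so \<open>1 + 2 * k\<close> replaces division by \<open>1 - k\<close>.\<close>
    then have "(1 + 2 * k) * ((1 - k) * T) \<le> (1 + 2 * k) * (p * Z)"
      using k by (intro mult_left_mono) auto
    moreover have "T \<le> (1 + 2 * k) * ((1 - k) * T)"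
    proof -
      have "0 \<le> k * (1 - 2 * k)" using k by simp
      then have "0 \<le> k * (1 - 2 * k) * T" using False by simp
      then show ?thesis by (simp add: algebra_simps)
    qed
    ultimately show ?thesis by (simp add: mult_ac)
  qed
  have "\<rho> * (\<Sum>u\<in>H. (x u)\<^sup>2) = (\<Sum>u\<in>H. x u * (\<rho> * x u))"
    by (simp add: sum_distrib_left power2_eq_square mult_ac)
  also have "\<dots> = (\<Sum>u\<in>H. a * (d u * (x u)\<^sup>2) + b * (\<Sum>w\<in>N u \<inter> H. x u * x w) + b * (\<Sum>w\<in>N u \<inter> R. x u * x w))"
  proof (intro sum.cong HOL.refl)
    fix u assume "u \<in> H"
    then have "\<rho> * x u = a * d u * x u + b * ((\<Sum>w\<in>N u \<inter> H. x w) + (\<Sum>w\<in>N u \<inter> R. x w))"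
      using eigen sum_split_neighbours[OF H] H by (auto simp: R_def)
    then show "x u * (\<rho> * x u) = a * (d u * (x u)\<^sup>2) + b * (\<Sum>w\<in>N u \<inter> H. x u * x w) + b * (\<Sum>w\<in>N u \<inter> R. x u * x w)"
      by (simp add: power2_eq_square algebra_simps sum_distrib_left)
  qed
  also have "\<dots> = a * (\<Sum>u\<in>H. d u * (x u)\<^sup>2) + b * (\<Sum>u\<in>H. \<Sum>w\<in>N u \<inter> H. x u * x w)
      + b * (\<Sum>u\<in>H. \<Sum>w\<in>N u \<inter> R. x u * x w)"
    by (simp add: sum.distrib sum_distrib_left)
  also have "(\<Sum>u\<in>H. \<Sum>w\<in>N u \<inter> R. x u * x w) = (\<Sum>u\<in>H. \<Sum>w\<in>R. if w \<in> N u then x u * x w else 0)"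
    using R by (simp only: sum_Int_if)
  also have "\<dots> = (\<Sum>w\<in>R. \<Sum>u\<in>H. if w \<in> N u then x u * x w else 0)" by (rule sum.swap)
  also have "\<dots> = T"
    unfolding T_def sig_def sum_distrib_left sum_Int_if[OF R(3)]
    by (intro sum.cong HOL.refl) (simp add: N_sym mult.commute)
  also have "a * (\<Sum>u\<in>H. d u * (x u)\<^sup>2) + b * (\<Sum>u\<in>H. \<Sum>w\<in>N u \<inter> H. x u * x w) + b * T \<le>
      a * (\<Sum>u\<in>H. d u * (x u)\<^sup>2) + b * (\<Sum>u\<in>H. \<Sum>w\<in>N u \<inter> H. x u * x w) + b * (p * (1 + 2 * k) * Z)"
    using T b_pos by simp
  finally show ?thesis by (simp add: Z_def sig_def R_def mult.assoc)
qed

text \<open>The exceptional vertices with more than \<open>s\<close> neighbours in \<open>H\<close>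
  number at most \<open>s * 2 ^ h\<close>, and by Cauchy-Schwarz each contributes at most
  \<open>h\<close> times the square sum over \<open>H\<close>. The majorant \<open>q\<close> for the
  others is left free since two different ones are needed.\<close>

lemma sum_square_le_exceptional:
  assumes H: "H \<subseteq> V" "card H \<le> h" and q: "\<And>w. 0 \<le> q w"
    and good: "\<And>w. w \<in> V - H \<Longrightarrow> card (N w \<inter> H) \<le> s \<Longrightarrow> (\<Sum>u\<in>N w \<inter> H. x u)\<^sup>2 \<le> q w"
  shows "(\<Sum>w\<in>V - H. (\<Sum>u\<in>N w \<inter> H. x u)\<^sup>2) \<le>
    (\<Sum>w\<in>V - H. q w) + real (s * 2 ^ h * h) * (\<Sum>u\<in>H. (x u)\<^sup>2)"
proof -
  define X where "X = (\<Sum>u\<in>H. (x u)\<^sup>2)"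
  define W where "W = {w \<in> V - H. s < card (N w \<inter> H)}"
  have fH: "finite H" by (rule finite_sub[OF H(1)])
  have X: "0 \<le> X" by (simp add: X_def sum_nonneg)
  have "(\<Sum>w\<in>V - H. (\<Sum>u\<in>N w \<inter> H. x u)\<^sup>2) \<le> (\<Sum>w\<in>V - H. q w + (if w \<in> W then h * X else 0))"
  proof (rule sum_mono)
    fix w assume w: "w \<in> V - H"
    show "(\<Sum>u\<in>N w \<inter> H. x u)\<^sup>2 \<le> q w + (if w \<in> W then h * X else 0)"
    proof (cases "w \<in> W")
      case True
      have "card (N w \<inter> H) \<le> h" using card_mono[OF fH, of "N w \<inter> H"] H(2) by simp
      then have "(\<Sum>u\<in>N w \<inter> H. x u)\<^sup>2 \<le> h * (\<Sum>u\<in>N w \<inter> H. (x u)\<^sup>2)"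
        using fH by (intro square_sum_le_card) auto
      also have "\<dots> \<le> h * X" unfolding X_def using fH by (intro mult_left_mono sum_mono2) auto
      finally show ?thesis using True q[of w] by simp
    next
      case False
      then show ?thesis using good[OF w] w by (simp add: W_def not_less)
    qed
  qed
  also have "\<dots> = (\<Sum>w\<in>V - H. q w) + card W * (h * X)"
  proof -
    have "W \<subseteq> V - H" by (auto simp: W_def)
    then have "(V - H) \<inter> W = W" by auto
    then have "(\<Sum>w\<in>V - H. if w \<in> W then h * X else 0) = card W * (h * X)"
      using finite_V sum.inter_restrict[of "V - H" "\<lambda>_. h * X" W] by simp
    then show ?thesis by (simp add: sum.distrib)
  qed
  also have "card W * (h * X) \<le> real (s * 2 ^ h) * (h * X)"
  proof -
    have "card W \<le> s * 2 ^ card H" unfolding W_def by (rule card_many_neighbours[OF H(1)])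
    also have "\<dots> \<le> s * 2 ^ h" using H(2) by (simp add: power_increasing)
    finally have "real (card W) \<le> real (s * 2 ^ h)" by (rule of_nat_mono)
    then show ?thesis using X by (intro mult_right_mono) auto
  qed
  finally show ?thesis by (simp add: X_def mult.assoc)
qed

text \<open>Cauchy-Schwarz with at most \<open>s\<close> terms at each ordinary vertex; after
  exchanging the sums, every \<open>u\<close> in \<open>H\<close> is counted at most
  \<open>d u\<close> times.\<close>

lemma sum_square_le_degrees:
  assumes H: "H \<subseteq> V" "card H \<le> h"
  shows "(\<Sum>w\<in>V - H. (\<Sum>u\<in>N w \<inter> H. x u)\<^sup>2) \<le>
    s * (\<Sum>u\<in>H. d u * (x u)\<^sup>2) + real (s * 2 ^ h * h) * (\<Sum>u\<in>H. (x u)\<^sup>2)"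
proof -
  have fH: "finite H" by (rule finite_sub[OF H(1)])
  have "(\<Sum>w\<in>V - H. (\<Sum>u\<in>N w \<inter> H. x u)\<^sup>2) \<le>
      (\<Sum>w\<in>V - H. s * (\<Sum>u\<in>N w \<inter> H. (x u)\<^sup>2)) + real (s * 2 ^ h * h) * (\<Sum>u\<in>H. (x u)\<^sup>2)"
    using finite_N by (intro sum_square_le_exceptional H square_sum_le_card) (auto simp: sum_nonneg)
  also have "(\<Sum>w\<in>V - H. s * (\<Sum>u\<in>N w \<inter> H. (x u)\<^sup>2)) =
      s * (\<Sum>w\<in>V - H. \<Sum>u\<in>H. if u \<in> N w then (x u)\<^sup>2 else 0)"
    by (simp only: sum_distrib_left sum_Int_if[OF fH])
  also have "(\<Sum>w\<in>V - H. \<Sum>u\<in>H. if u \<in> N w then (x u)\<^sup>2 else 0) =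
      (\<Sum>u\<in>H. \<Sum>w\<in>V - H. if u \<in> N w then (x u)\<^sup>2 else 0)" by (rule sum.swap)
  also have "\<dots> = (\<Sum>u\<in>H. card ((V - H) \<inter> N u) * (x u)\<^sup>2)"
  proof (intro sum.cong HOL.refl)
    fix u
    have "(\<Sum>w\<in>V - H. if u \<in> N w then (x u)\<^sup>2 else 0) = (\<Sum>w\<in>N u \<inter> (V - H). (x u)\<^sup>2)"
      using finite_V by (subst sum_Int_if) (simp_all add: N_sym[of u])
    then show "(\<Sum>w\<in>V - H. if u \<in> N w then (x u)\<^sup>2 else 0) = card ((V - H) \<inter> N u) * (x u)\<^sup>2"
      by (simp add: Int_commute)
  qed
  also have "\<dots> \<le> (\<Sum>u\<in>H. d u * (x u)\<^sup>2)"
    using finite_N by (intro sum_mono mult_right_mono) (auto intro: card_mono)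
  finally show ?thesis using s_pos' by (simp add: mult_left_mono)
qed

text \<open>An ordinary vertex sees at most \<open>s - 1\<close> members of \<open>H1\<close>, which
  improves the Cauchy-Schwarz factor on \<open>H1\<close> from \<open>s\<close> to
  \<open>s - 1\<close>. Separating the mixed term costs a further 1/4 there and a large constant on
  \<open>H - H1\<close>, whose weight is shown to be small elsewhere.\<close>

lemma sum_square_le_few_large:
  assumes H: "H \<subseteq> V" "card H \<le> h" and H1: "H1 \<subseteq> H" "real (card H1) \<le> real s - 1"
  shows "(\<Sum>w\<in>V - H. (\<Sum>u\<in>N w \<inter> H. x u)\<^sup>2) \<le>
    n * ((real s - 3 / 4) * (\<Sum>u\<in>H1. (x u)\<^sup>2) + 5 * (real s)\<^sup>2 * (\<Sum>u\<in>H - H1. (x u)\<^sup>2))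
    + real (s * 2 ^ h * h) * (\<Sum>u\<in>H. (x u)\<^sup>2)"
proof -
  define X1 where "X1 = (\<Sum>u\<in>H1. (x u)\<^sup>2)"
  define X2 where "X2 = (\<Sum>u\<in>H - H1. (x u)\<^sup>2)"
  define q where "q = (real s - 3 / 4) * X1 + 5 * (real s)\<^sup>2 * X2"
  have fH: "finite H" "finite H1" using finite_sub[OF H(1)] H1(1) by (auto intro: finite_subset)
  have X: "0 \<le> X1" "0 \<le> X2" by (auto simp: X1_def X2_def sum_nonneg)
  have q: "0 \<le> q" unfolding q_def using X s_pos' by simp
  have "(\<Sum>w\<in>V - H. (\<Sum>u\<in>N w \<inter> H. x u)\<^sup>2) \<le>
      (\<Sum>w\<in>V - H. q) + real (s * 2 ^ h * h) * (\<Sum>u\<in>H. (x u)\<^sup>2)"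
  proof (intro sum_square_le_exceptional H q)
    fix w assume w: "w \<in> V - H" "card (N w \<inter> H) \<le> s"
    define A B where "A = (\<Sum>u\<in>N w \<inter> H1. x u)" and "B = (\<Sum>u\<in>N w \<inter> (H - H1). x u)"
    have "N w \<inter> H = (N w \<inter> H1) \<union> (N w \<inter> (H - H1))" using H1 by auto
    then have AB: "(\<Sum>u\<in>N w \<inter> H. x u) = A + B"
      unfolding A_def B_def using fH by (subst sum.union_disjoint[symmetric]) auto
    have "card (N w \<inter> H1) \<le> card H1" using fH by (intro card_mono) auto
    then have c1: "card (N w \<inter> H1) \<le> s - 1" using H1(2) s_pos by linarith
    have "A\<^sup>2 \<le> real (s - 1) * (\<Sum>u\<in>N w \<inter> H1. (x u)\<^sup>2)"
      unfolding A_def using c1 fH by (intro square_sum_le_card) auto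
    also have "\<dots> \<le> real (s - 1) * X1"
      unfolding X1_def using fH by (intro mult_left_mono sum_mono2) auto
    finally have A: "A\<^sup>2 \<le> (real s - 1) * X1" using s_pos by (simp add: of_nat_diff)
    have "card (N w \<inter> (H - H1)) \<le> card (N w \<inter> H)" using fH by (intro card_mono) auto
    then have "B\<^sup>2 \<le> s * (\<Sum>u\<in>N w \<inter> (H - H1). (x u)\<^sup>2)"
      unfolding B_def using w fH by (intro square_sum_le_card) auto
    also have "\<dots> \<le> s * X2"
      unfolding X2_def using fH by (intro mult_left_mono sum_mono2) auto
    finally have B: "B\<^sup>2 \<le> s * X2" .
    have s0: "0 < real s" using s_pos' by simp
    \<comment> \<open>AM-GM with weight \<open>4 * s\<close>, chosen because
      \<open>(1 + 1 / (4 * s)) * (s - 1)\<close> is at most \<open>s - 3 / 4\<close>.\<close>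
    have AB2: "(A + B)\<^sup>2 \<le> (1 + 1 / (4 * real s)) * A\<^sup>2 + (1 + 4 * real s) * B\<^sup>2"
    proof -
      have "0 \<le> (A - 4 * real s * B)\<^sup>2 / (4 * real s)" using s0 by simp
      also have "\<dots> = A\<^sup>2 / (4 * real s) + 4 * real s * B\<^sup>2 - 2 * A * B"
        using s0 by (simp add: field_simps power2_eq_square)
      finally show ?thesis by (simp add: power2_sum algebra_simps)
    qed
    have "(1 + 1 / (4 * real s)) * A\<^sup>2 \<le> (1 + 1 / (4 * real s)) * ((real s - 1) * X1)"
      using A by (intro mult_left_mono) auto
    also have "\<dots> = ((1 + 1 / (4 * real s)) * (real s - 1)) * X1" by simp
    also have "\<dots> \<le> (real s - 3 / 4) * X1"
      using X s0 by (intro mult_right_mono) (auto simp: field_simps)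
    finally have 1: "(1 + 1 / (4 * real s)) * A\<^sup>2 \<le> (real s - 3 / 4) * X1" .
    have "(1 + 4 * real s) * B\<^sup>2 \<le> (5 * real s) * (s * X2)"
      using B s_pos' by (intro mult_mono) auto
    then have "(1 + 4 * real s) * B\<^sup>2 \<le> 5 * (real s)\<^sup>2 * X2" by (simp add: power2_eq_square)
    then show "(\<Sum>u\<in>N w \<inter> H. x u)\<^sup>2 \<le> q"
      unfolding AB q_def using AB2 1 by linarith
  qed
  moreover have "(\<Sum>w\<in>V - H. q) \<le> n * q"
  proof -
    have "real (card (V - H)) \<le> n" using finite_V by (simp add: card_mono)
    then show ?thesis using q by (simp add: mult_right_mono)
  qed
  ultimately show ?thesis by (simp add: q_def X1_def X2_def)
qed

section \<open>The form on \<open>H\<close> and the vertices of nearly full degree\<close>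

lemma sum_H_products:
  assumes H: "H \<subseteq> V" "card H \<le> h"
  shows "(\<Sum>u\<in>H. \<Sum>w\<in>N u \<inter> H. x u * x w) \<le> h * (\<Sum>u\<in>H. (x u)\<^sup>2)"
proof -
  have fH: "finite H" by (rule finite_sub[OF H(1)])
  have "(\<Sum>u\<in>H. \<Sum>w\<in>N u \<inter> H. x u * x w) \<le> (\<Sum>u\<in>H. \<Sum>w\<in>H. x u * x w)"
    using fH x_nonneg by (intro sum_mono sum_mono2) auto
  also have "\<dots> = (\<Sum>u\<in>H. x u)\<^sup>2" by (simp add: power2_eq_square sum_product)
  also have "\<dots> \<le> h * (\<Sum>u\<in>H. (x u)\<^sup>2)" using fH H by (intro square_sum_le_card) auto
  finally show ?thesis .
qed

text \<open>The coefficient \<open>s - 7/4\<close> is \<open>s - 1\<close> from Cauchy-Schwarz on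
  \<open>H1\<close>, plus 1/4 for separating the mixed term, minus 1 for the diagonal, which is
  absent as there are no loops.\<close>

lemma sum_H_products_few_large:
  assumes H: "H \<subseteq> V" "card H \<le> h" "1 \<le> h" and H1: "H1 \<subseteq> H" "real (card H1) \<le> real s - 1"
  shows "(\<Sum>u\<in>H. \<Sum>w\<in>N u \<inter> H. x u * x w) \<le>
    (real s - 7 / 4) * (\<Sum>u\<in>H. (x u)\<^sup>2) + 6 * real s * real h * (\<Sum>u\<in>H - H1. (x u)\<^sup>2)"
proof -
  define H2 where "H2 = H - H1"
  define X1 where "X1 = (\<Sum>u\<in>H1. (x u)\<^sup>2)"
  define X2 where "X2 = (\<Sum>u\<in>H2. (x u)\<^sup>2)"
  define A B where "A = (\<Sum>u\<in>H1. x u)" and "B = (\<Sum>u\<in>H2. x u)"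
  have fH: "finite H" "finite H1" "finite H2"
    using finite_sub[OF H(1)] H1(1) by (auto simp: H2_def intro: finite_subset)
  have HH: "H = H1 \<union> H2" "H1 \<inter> H2 = {}" using H1 by (auto simp: H2_def)
  have X: "0 \<le> X1" "0 \<le> X2" by (auto simp: X1_def X2_def sum_nonneg)
  have "(\<Sum>u\<in>H. \<Sum>w\<in>N u \<inter> H. x u * x w) \<le> (\<Sum>u\<in>H. \<Sum>w\<in>H - {u}. x u * x w)"
    using fH x_nonneg N_irrefl by (intro sum_mono sum_mono2) auto
  also have "\<dots> = (\<Sum>u\<in>H. (\<Sum>w\<in>H. x u * x w) - (x u)\<^sup>2)"
    using fH by (intro sum.cong HOL.refl) (simp add: sum_diff1 power2_eq_square)
  also have "\<dots> = (A + B)\<^sup>2 - (X1 + X2)"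
    using fH HH by (simp add: sum_subtractf sum.union_disjoint X1_def X2_def A_def B_def
      power2_eq_square sum_product[symmetric] flip: sum_distrib_left sum_distrib_right)
  finally have 1: "(\<Sum>u\<in>H. \<Sum>w\<in>N u \<inter> H. x u * x w) \<le> (A + B)\<^sup>2 - (X1 + X2)" .
  have "A\<^sup>2 \<le> real (card H1) * X1" unfolding X1_def A_def using fH by (intro square_sum_le_card) auto
  also have "\<dots> \<le> (real s - 1) * X1" using H1 X by (intro mult_right_mono) auto
  finally have A: "A\<^sup>2 \<le> (real s - 1) * X1" .
  have "card H2 \<le> h" using card_mono[OF fH(1), of H2] H(2) HH by auto
  then have B: "B\<^sup>2 \<le> h * X2" unfolding X2_def B_def using fH by (intro square_sum_le_card) auto
  have s0: "0 < real s" using s_pos' by simp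
  have "0 \<le> (A - 4 * real s * B)\<^sup>2 / (4 * real s)" using s0 by simp
  also have "\<dots> = A\<^sup>2 / (4 * real s) + 4 * real s * B\<^sup>2 - 2 * A * B"
    using s0 by (simp add: field_simps power2_eq_square)
  finally have AB: "(A + B)\<^sup>2 \<le> A\<^sup>2 + A\<^sup>2 / (4 * real s) + (4 * real s + 1) * B\<^sup>2"
    by (simp add: power2_sum algebra_simps)
  have "A\<^sup>2 / (4 * real s) \<le> (real s - 1) * X1 / (4 * real s)" using A s0 by (intro divide_right_mono) auto
  also have "\<dots> = ((real s - 1) / (4 * real s)) * X1" by simp
  also have "\<dots> \<le> (1 / 4) * X1" using X s0 by (intro mult_right_mono) (auto simp: field_simps)
  finally have A4: "A\<^sup>2 / (4 * real s) \<le> X1 / 4" by simp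
  have "(4 * real s + 1) * B\<^sup>2 \<le> (5 * real s) * (real h * X2)" using B s_pos' by (intro mult_mono) auto
  then have B4: "(4 * real s + 1) * B\<^sup>2 \<le> 5 * (real s * real h * X2)" by (simp add: mult_ac)
  have "1 * X2 \<le> h * X2" using H(3) X by (intro mult_right_mono) auto
  then have "real s * (1 * X2) \<le> real s * (real h * X2)" using s0 by (intro mult_left_mono) auto
  then have h2: "s * X2 \<le> real s * real h * X2" by simp
  have "(\<Sum>u\<in>H. (x u)\<^sup>2) = X1 + X2" using fH HH by (simp add: sum.union_disjoint X1_def X2_def)
  moreover have "(A + B)\<^sup>2 - (X1 + X2) \<le> (real s - 7 / 4) * (X1 + X2) + 6 * (real s * real h * X2)"
  proof -
    have "(A + B)\<^sup>2 - (X1 + X2) \<le> (real s - 1) * X1 + X1 / 4 + 5 * (real s * real h * X2) - (X1 + X2)"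
      using AB A A4 B4 by linarith
    also have "\<dots> = (real s - 7 / 4) * (X1 + X2) + 5 * (real s * real h * X2) + (3 / 4) * X2 - s * X2"
      by (simp add: algebra_simps)
    also have "\<dots> \<le> (real s - 7 / 4) * (X1 + X2) + 6 * (real s * real h * X2)"
    proof -
      have "X2 \<le> s * X2" using s_pos' X by (simp add: mult_right_mono[of 1 "real s" X2, simplified])
      then show ?thesis using h2 X by linarith
    qed
    finally show ?thesis .
  qed
  ultimately show ?thesis using 1 by (simp add: X2_def H2_def mult_ac)
qed

text \<open>The upper bound from \<open>quadratic_bound\<close> meets the lower bound
  \<open>\<rho>_ge_p\<close>. Writing degrees as \<open>n - 1\<close> minus the missing part, the
  terms of leading order cancel; the missing part remains on one side and errors with factor
  \<open>b\<close> on the other. The second claim shows that \<open>(a + b * p * s) * n\<close> has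
  at least the order of \<open>\<rho>\<close>.\<close>

lemma missing_degree_bound:
  fixes t k :: real
  assumes H: "H \<subseteq> V" "card H \<le> h" and k: "0 \<le> k" "k \<le> 1 / 2" and t: "0 < t"
    and small: "\<And>w. w \<in> V - H \<Longrightarrow> a * d w + b * (c * t + d w / t) \<le> k * \<rho>"
    and C: "C = real (s * 2 ^ h * h)" and X: "X = (\<Sum>u\<in>H. (x u)\<^sup>2)"
  shows "(a + b * p * s) * (\<Sum>u\<in>H. (n - 1 - d u) * (x u)\<^sup>2) \<le>
      b * (X * (h + 2 * k * s * p * n + 2 * p * C + p * (real s)\<^sup>2))" (is "?A")
    and "\<rho> * X \<le> (2 * (a + b * p * s) * n + b * h + 2 * b * p * C) * X" (is "?B")
proof -
  define D where "D = (\<Sum>u\<in>H. d u * (x u)\<^sup>2)"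
  define m where "m = (\<Sum>u\<in>H. (n - 1 - d u) * (x u)\<^sup>2)"
  have C0: "0 \<le> C" using C by simp
  have X0: "0 \<le> X" using X by (simp add: sum_nonneg)
  have m0: "0 \<le> m" unfolding m_def using d_le H by (intro sum_nonneg mult_nonneg_nonneg) auto
  have D0: "0 \<le> D" unfolding D_def by (intro sum_nonneg mult_nonneg_nonneg) auto
  have D: "D = (n - 1) * X - m"
    by (simp add: D_def m_def X sum_distrib_left left_diff_distrib flip: sum_subtractf)
  have pk: "0 \<le> b * (p * (1 + 2 * k))" using b_pos p_pos k by simp
  have "\<rho> * X \<le> a * D + b * (\<Sum>u\<in>H. \<Sum>w\<in>N u \<inter> H. x u * x w)
      + b * (p * (1 + 2 * k)) * (\<Sum>w\<in>V - H. (\<Sum>u\<in>N w \<inter> H. x u)\<^sup>2)"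
    unfolding X D_def by (rule quadratic_bound[OF H(1) k t small])
  also have "\<dots> \<le> a * D + b * (h * X) + b * (p * (1 + 2 * k)) * (s * D + C * X)"
    using sum_H_products[OF H] sum_square_le_degrees[OF H] pk b_pos a_pos
    by (intro add_mono mult_left_mono) (auto simp: X C D_def)
  finally have 1: "\<rho> * X \<le> a * D + b * (h * X) + b * (p * (1 + 2 * k)) * (s * D + C * X)" .
  have bp: "0 \<le> b * p" using b_pos p_pos by simp
  have k2: "b * p * (2 * k) * (C * X) \<le> b * p * (C * X)"
  proof -
    have "b * p * (2 * k) \<le> b * p * 1" using k bp by (intro mult_left_mono) auto
    then show ?thesis using C0 X0 by (intro mult_right_mono) auto
  qed
  have nX: "D \<le> n * X" using D m0 X0 by (simp add: algebra_simps)
  have k1: "b * p * (2 * k) * (s * D) \<le> b * p * (2 * k) * (s * (n * X))"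
    using nX bp k by (intro mult_left_mono) auto
  have k3: "b * p * (2 * k) * (s * D) \<le> b * p * 1 * (s * D)"
    using bp k D0 by (intro mult_right_mono mult_left_mono) auto
  have e: "b * (p * (1 + 2 * k)) * (s * D + C * X) =
      b * p * (s * D) + b * p * (2 * k) * (s * D) + b * p * (C * X) + b * p * (2 * k) * (C * X)"
    by (simp add: algebra_simps)
  have "(a * (n - 1) + b * s * (n - s) * p) * X \<le> \<rho> * X"
  proof (rule mult_right_mono[OF _ X0])
    have "0 \<le> b * (real s - 1)" using b_pos s_pos' by simp
    then show "a * (n - 1) + b * s * (n - s) * p \<le> \<rho>" using \<rho>_ge_p by linarith
  qed
  then have 2: "a * ((n - 1) * X) + b * p * (s * ((n - s) * X)) \<le> \<rho> * X" by (simp add: algebra_simps)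
  have 3: "a * D = a * ((n - 1) * X) - a * m" "b * p * (s * D) = b * p * (s * ((n - 1) * X)) - b * p * (s * m)"
    unfolding D by (simp_all add: algebra_simps)
  have "b * p * (s * ((n - 1) * X)) - b * p * (s * ((n - s) * X)) = b * p * X * (s * (real s - 1))"
    by (simp add: algebra_simps)
  also have "\<dots> \<le> b * p * X * (real s)\<^sup>2"
    using bp X0 by (intro mult_left_mono) (auto simp: power2_eq_square algebra_simps)
  finally have 4: "b * p * (s * ((n - 1) * X)) - b * p * (s * ((n - s) * X)) \<le> b * p * X * (real s)\<^sup>2" .
  have "a * m + b * p * (s * m) \<le> b * (h * X) + b * p * (2 * k) * (s * (n * X)) + 2 * (b * p * (C * X)) + b * p * X * (real s)\<^sup>2"
    using 1 e k1 k2 2 3 4 by linarith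
  then show ?A unfolding m_def[symmetric] by (simp add: algebra_simps)
  have "\<rho> * X \<le> a * D + b * (h * X) + 2 * (b * p * (s * D)) + 2 * (b * p * (C * X))"
    using 1 e k2 k3 by linarith
  also have "\<dots> \<le> a * (n * X) + b * (h * X) + 2 * (b * p * (s * (n * X))) + 2 * (b * p * (C * X))"
    using nX a_pos bp by (intro add_mono mult_left_mono order_refl) auto
  also have "\<dots> \<le> (2 * (a + b * p * s) * n + b * h + 2 * b * p * C) * X"
  proof -
    have "0 \<le> a * (n * X)" using a_pos X0 by simp
    then show ?thesis by (simp add: algebra_simps)
  qed
  finally show ?B .
qed

text \<open>Each vertex of \<open>H2\<close> contributes at least \<open>g * n\<close> times its
  square to the weighted missing degree. Since \<open>\<rho>\<close> is at most
  \<open>4 * q * n\<close>, both \<open>q * n\<close> and \<open>\<rho>\<close> can be eliminated,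
  leaving an estimate in \<open>p\<close> alone.\<close>

lemma low_degree_weight:
  fixes t k :: real
  assumes H: "H \<subseteq> V" "card H \<le> h" and k: "0 \<le> k" "k \<le> 1 / 2" and t: "0 < t"
    and small: "\<And>w. w \<in> V - H \<Longrightarrow> a * d w + b * (c * t + d w / t) \<le> k * \<rho>"
    and C: "C = real (s * 2 ^ h * h)" and X: "X = (\<Sum>u\<in>H. (x u)\<^sup>2)"
    and e: "e = h + 2 * C + (real s)\<^sup>2" and pe: "p * e \<le> 1 / 8" and X_pos: "0 < X"
    and g: "0 < g" and H2: "H2 = {u \<in> H. g * n < n - 1 - d u}"
  shows "g * (\<Sum>u\<in>H2. (x u)\<^sup>2) \<le> 4 * p * (e + 2 * k * s * p * n) * X"
proof -
  define q where "q = a + b * p * s"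
  define X2 where "X2 = (\<Sum>u\<in>H2. (x u)\<^sup>2)"
  have q: "0 < q" unfolding q_def using a_pos b_pos p_pos by (simp add: add_pos_nonneg)
  have C0: "0 \<le> C" using C by simp
  have s2: "1 \<le> (real s)\<^sup>2" using s_pos' by simp
  have pe1: "p * 1 \<le> p * e" "p * h \<le> p * e" "p * (2 * C) \<le> p * e"
    using C0 s2 p_pos by (auto intro!: mult_left_mono simp: e)
  then have p1: "p \<le> 1" "p * h \<le> 1 / 4" "p * C \<le> 1 / 8" using pe by linarith+
  have fH: "finite H" by (rule finite_sub[OF H(1)])
  have "\<rho> * X \<le> (2 * q * n + b * h + 2 * b * p * C) * X"
    unfolding q_def by (rule missing_degree_bound(2)[OF H k t small C X])
  then have "\<rho> \<le> 2 * q * n + b * h + 2 * b * p * C" using X_pos by simp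
  moreover have "b * h \<le> \<rho> * (1 / 4)"
    unfolding b_mult[of h] using p1 \<rho>_pos by (intro mult_left_mono) auto
  moreover have "2 * b * p * C \<le> \<rho> * (1 / 4)"
  proof -
    have "p * (2 * p * C) \<le> 1 * (1 / 4)" using p1 p_pos C0 by (intro mult_mono) auto
    then have "\<rho> * (p * (2 * p * C)) \<le> \<rho> * (1 / 4)" using \<rho>_pos by (intro mult_left_mono) auto
    moreover have "2 * b * p * C = b * (2 * p * C)" by simp
    ultimately show ?thesis using b_mult[of "2 * p * C"] by linarith
  qed
  \<comment> \<open>Two error terms of size at most \<open>\<rho> / 4\<close> are absorbed on the
    left.\<close>
  ultimately have \<rho>q: "\<rho> \<le> 4 * (q * n)" by linarith
  have "g * n * X2 \<le> (\<Sum>u\<in>H2. (n - 1 - d u) * (x u)\<^sup>2)"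
    unfolding X2_def sum_distrib_left by (intro sum_mono mult_right_mono) (auto simp: H2)
  also have "\<dots> \<le> (\<Sum>u\<in>H. (n - 1 - d u) * (x u)\<^sup>2)"
    using fH d_le H(1) by (intro sum_mono2 mult_nonneg_nonneg) (auto simp: H2)
  finally have "q * (g * n * X2) \<le> q * (\<Sum>u\<in>H. (n - 1 - d u) * (x u)\<^sup>2)"
    using q by (intro mult_left_mono) auto
  also have "\<dots> \<le> b * (X * (h + 2 * k * s * p * n + 2 * p * C + p * (real s)\<^sup>2))"
    unfolding q_def by (rule missing_degree_bound(1)[OF H k t small C X])
  also have "\<dots> \<le> b * (X * (e + 2 * k * s * p * n))"
  proof -
    have "p * (2 * C) \<le> 1 * (2 * C)" "p * (real s)\<^sup>2 \<le> 1 * (real s)\<^sup>2"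
      using p1 C0 by (intro mult_right_mono; simp)+
    then have "h + 2 * k * s * p * n + 2 * p * C + p * (real s)\<^sup>2 \<le> e + 2 * k * s * p * n"
      by (simp add: e)
    then show ?thesis using b_pos X_pos by (intro mult_left_mono) auto
  qed
  also have "\<dots> = \<rho> * (p * (X * (e + 2 * k * s * p * n)))" by (rule b_mult)
  finally have "4 * (q * (g * n * X2)) \<le> 4 * (\<rho> * (p * (X * (e + 2 * k * s * p * n))))"
    by simp
  then have "4 * (q * n) * (g * X2) \<le> \<rho> * (4 * p * (e + 2 * k * s * p * n) * X)"
    by (simp only: mult_ac)
  moreover have "\<rho> * (g * X2) \<le> 4 * (q * n) * (g * X2)"
    using \<rho>q g by (intro mult_right_mono) (auto simp: X2_def sum_nonneg)
  ultimately have "\<rho> * (g * X2) \<le> \<rho> * (4 * p * (e + 2 * k * s * p * n) * X)" by linarith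
  then show ?thesis using \<rho>_pos by (simp add: X2_def)
qed

text \<open>With at most \<open>s - 1\<close> vertices of nearly full degree, the coefficient of \<open>b\<close> in the upper bound
  for \<open>\<rho>\<close> is about \<open>s - 7/4 + (s - 1/2) p n\<close>, below the required \<open>s - 1 + s p n\<close>.\<close>

lemma many_large_degrees:
  fixes t :: real
  assumes H: "H \<subseteq> V" "card H \<le> h" and t: "0 < t" and g: "0 < g" "g \<le> 1"
    and k: "k = g / (1280 * (real s)\<^sup>2)"
    and small: "\<And>w. w \<in> V - H \<Longrightarrow> a * d w + b * (c * t + d w / t) \<le> k * \<rho>"
    and C: "C = real (s * 2 ^ h * h)"
    and e: "e = h + 2 * C + (real s)\<^sup>2" and pe: "p * e * (384 * (real s)\<^sup>2 * (real h + 1)) \<le> g"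
  shows "s \<le> card {u \<in> H. n - 1 - d u \<le> g * n}"
proof (rule ccontr)
  define H1 where "H1 = {u \<in> H. n - 1 - d u \<le> g * n}"
  define H2 where "H2 = {u \<in> H. g * n < n - 1 - d u}"
  define X where "X = (\<Sum>u\<in>H. (x u)\<^sup>2)"
  define X2 where "X2 = (\<Sum>u\<in>H2. (x u)\<^sup>2)"
  define F where "F = 4 * p * (e + 2 * k * s * p * n) / g"
  define y where "y = p * n"
  assume "\<not> s \<le> card {u \<in> H. n - 1 - d u \<le> g * n}"
  then have c1: "real (card H1) \<le> real s - 1" unfolding H1_def using s_pos by linarith
  have H12: "H1 \<subseteq> H" "H - H1 = H2" by (auto simp: H1_def H2_def)
  have fH: "finite H" by (rule finite_sub[OF H(1)])
  have C0: "0 \<le> C" using C by simp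
  have s2: "1 \<le> (real s)\<^sup>2" using s_pos' by simp
  have y: "0 \<le> y" using p_pos by (simp add: y_def)
  have s0: "0 < real s" using s_pos' by simp
  have sk: "(real s)\<^sup>2 * k = g / 1280" using s0 by (simp add: k)
  have k0: "0 < k" using g s0 by (simp add: k)
  have sk1: "1 * k \<le> (real s)\<^sup>2 * k" "real s * k \<le> (real s)\<^sup>2 * k"
    using k0 s2 s_pos' by (auto intro!: mult_right_mono simp: power2_eq_square)
  then have k1: "k \<le> 1 / 2" "real s * k \<le> 1 / 1280" using sk g by linarith+
  have e1: "1 \<le> e" "0 \<le> e" using C0 s2 by (simp_all add: e)
  define P where "P = p * e"
  have P0: "0 \<le> P" using p_pos e1 by (simp add: P_def)
  have P_s: "384 * ((real s)\<^sup>2 * P) \<le> g" and P_h: "384 * ((real s)\<^sup>2 * real h * P) \<le> g"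
  proof -
    have "0 \<le> 384 * ((real s)\<^sup>2 * P)" "0 \<le> 384 * ((real s)\<^sup>2 * real h * P)" using P0 by simp_all
    moreover have "384 * ((real s)\<^sup>2 * P) + 384 * ((real s)\<^sup>2 * real h * P) \<le> g"
      using pe by (simp add: P_def algebra_simps)
    ultimately show "384 * ((real s)\<^sup>2 * P) \<le> g" "384 * ((real s)\<^sup>2 * real h * P) \<le> g" by linarith+
  qed
  have "1 * P \<le> (real s)\<^sup>2 * P" using s2 P0 by (intro mult_right_mono) auto
  then have P: "384 * P \<le> 1" using P_s g by linarith
  have "p * (2 * C) \<le> p * e" "p * (real s)\<^sup>2 \<le> p * e" "p * h \<le> p * e"
    using p_pos C0 by (auto intro!: mult_left_mono simp: e)
  then have pC: "p * (2 * C) \<le> 1 / 384" "p * (real s)\<^sup>2 \<le> 1 / 384" "p * h \<le> 1"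
    using P by (auto simp: P_def)
  \<comment> \<open>If \<open>x\<close> vanished on \<open>H\<close>, \<open>rest_bound\<close>
    would force it to vanish everywhere.\<close>
  have X_pos: "0 < X"
  proof (rule ccontr)
    assume "\<not> 0 < X"
    then have "X = 0" unfolding X_def by (meson antisym_conv not_le sum_nonneg zero_le_power2)
    then have xH: "x u = 0" if "u \<in> H" for u
      using that fH unfolding X_def by (simp add: sum_nonneg_eq_0_iff)
    have "(\<Sum>w\<in>V - H. x w * (\<Sum>u\<in>N w \<inter> H. x u)) = 0" by (simp add: xH)
    then have "(1 - k) * \<rho> * (\<Sum>w\<in>V - H. (x w)\<^sup>2) \<le> 0"
      using rest_bound[OF H(1) t small] by simp
    moreover have "0 < (1 - k) * \<rho>" using k1 \<rho>_pos by simp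
    ultimately have "(\<Sum>w\<in>V - H. (x w)\<^sup>2) \<le> 0" by (meson mult_pos_pos not_le)
    then have "(\<Sum>w\<in>V - H. (x w)\<^sup>2) = 0" by (meson antisym sum_nonneg zero_le_power2)
    then have "x u = 0" if "u \<in> V - H" for u
      using that finite_V by (simp add: sum_nonneg_eq_0_iff)
    then show False using x_nonzero xH by blast
  qed
  have h1: "1 \<le> h"
  proof (rule ccontr)
    assume "\<not> 1 \<le> h"
    then have "card H = 0" using H(2) by simp
    then have "H = {}" using fH by simp
    then show False using X_pos by (simp add: X_def)
  qed
  have pe8: "p * e \<le> 1 / 8" using P by (simp add: P_def)
  have "g * X2 \<le> 4 * p * (e + 2 * k * s * p * n) * X"
    unfolding X2_def
    by (rule low_degree_weight[OF H _ k1(1) t small C X_def e pe8 X_pos g(1) H2_def]) (use k0 in auto)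
  then have X2: "X2 \<le> F * X" using g by (simp add: F_def field_simps)
  have X20: "0 \<le> X2" by (simp add: X2_def sum_nonneg)
  have py: "real s * (p * y) \<le> 2" "0 \<le> p * y" "p * y \<le> 2"
    using p_square_n p_square_n_le y p_pos by (simp_all add: y_def power2_eq_square mult_ac)
  have F: "g * F = 4 * P + 8 * (k * (s * (p * y)))"
  proof -
    have "g * F = 4 * p * (e + 2 * k * s * p * n)" using g by (simp add: F_def)
    then show ?thesis by (simp add: P_def y_def algebra_simps)
  qed
  \<comment> \<open>The constants 384 and 1280 enter through \<open>4/384 + 16/1280 <= 1/40\<close>.
    The vertices of low degree then raise the coefficient \<open>s - 3/4\<close> by at most
    1/8.\<close>
  have F1: "5 * ((real s)\<^sup>2 * F) \<le> 1 / 8"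
  proof -
    have "k * (s * (p * y)) \<le> k * 2" using k0 py by (intro mult_left_mono) auto
    then have "g * F \<le> 4 * P + 16 * k" using F by linarith
    then have "(real s)\<^sup>2 * (g * F) \<le> (real s)\<^sup>2 * (4 * P + 16 * k)" by (intro mult_left_mono) auto
    also have "\<dots> = 4 * ((real s)\<^sup>2 * P) + 16 * ((real s)\<^sup>2 * k)" by (simp add: algebra_simps)
    also have "\<dots> \<le> g * (1 / 40)" using P_s sk g by linarith
    finally have "g * ((real s)\<^sup>2 * F) \<le> g * (1 / 40)" by (simp add: mult_ac)
    then show ?thesis using g by simp
  qed
  \<comment> \<open>Here \<open>F\<close> is multiplied by \<open>h\<close>, which depends on
    \<open>k\<close> and need not be small against \<open>1 / k\<close>, so the smallness of
    \<open>k\<close> alone does not help. Instead one factor \<open>p\<close> of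
    \<open>p * y\<close> is spent on \<open>h\<close>, leaving a multiple of \<open>y\<close> that
    the main inequality can afford.\<close>
  have F2: "6 * (real s * real h * F) \<le> 1 / 16 + y / 8"
  proof -
    have "real s * real h * P \<le> (real s)\<^sup>2 * real h * P"
      using s_pos' P0 by (intro mult_right_mono) (auto simp: power2_eq_square)
    then have 1: "384 * (real s * real h * P) \<le> g" using P_h by linarith
    have "(real s)\<^sup>2 * k * ((p * h) * y) \<le> g / 1280 * (1 * y)"
      unfolding sk using pC y p_pos g by (intro mult_left_mono mult_right_mono) auto
    then have 2: "(real s)\<^sup>2 * k * ((p * h) * y) \<le> g / 1280 * y" by simp
    have "g * (real s * real h * F) = real s * real h * (4 * P + 8 * (k * (s * (p * y))))"
      using F by (simp add: mult_ac)
    also have "\<dots> = 4 * (real s * real h * P) + 8 * ((real s)\<^sup>2 * k * ((p * h) * y))"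
      by (simp add: algebra_simps power2_eq_square)
    also have "\<dots> \<le> g * (1 / 96 + y / 160)" using 1 2 by (simp add: algebra_simps)
    finally have "real s * real h * F \<le> 1 / 96 + y / 160" using g by simp
    then show ?thesis using y by simp
  qed
  define G where "G = real s - 3 / 4 + 1 / 8"
  define Z where "Z = (\<Sum>w\<in>V - H. (\<Sum>u\<in>N w \<inter> H. x u)\<^sup>2)"
  have X12: "(\<Sum>u\<in>H1. (x u)\<^sup>2) \<le> X" unfolding X_def using fH H12 by (intro sum_mono2) auto
  have "Z \<le> n * ((real s - 3 / 4) * (\<Sum>u\<in>H1. (x u)\<^sup>2) + 5 * (real s)\<^sup>2 * X2) + C * X"
    using sum_square_le_few_large[OF H H12(1) c1] unfolding Z_def X_def X2_def C H12(2) .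
  also have "\<dots> \<le> n * ((real s - 3 / 4) * X + 5 * (real s)\<^sup>2 * (F * X)) + C * X"
    using X12 X2 s_pos' by (intro add_mono mult_left_mono order_refl) auto
  also have "\<dots> = n * (real s - 3 / 4 + 5 * ((real s)\<^sup>2 * F)) * X + C * X" by (simp add: algebra_simps)
  also have "\<dots> \<le> n * G * X + C * X"
    using F1 X_pos by (intro add_mono mult_left_mono mult_right_mono) (auto simp: G_def)
  finally have Z: "Z \<le> (n * G + C) * X" by (simp add: algebra_simps)
  define S where "S = (\<Sum>u\<in>H. \<Sum>w\<in>N u \<inter> H. x u * x w)"
  have "S \<le> (real s - 7 / 4) * X + 6 * real s * real h * X2"
    using sum_H_products_few_large[OF H h1 H12(1) c1] unfolding S_def X_def X2_def H12(2) .
  also have "\<dots> \<le> (real s - 7 / 4) * X + 6 * real s * real h * (F * X)"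
    using X2 by (intro add_left_mono mult_left_mono) auto
  also have "\<dots> = (real s - 7 / 4 + 6 * (real s * real h * F)) * X" by (simp add: algebra_simps)
  also have "\<dots> \<le> (real s - 7 / 4 + (1 / 16 + y / 8)) * X"
    using F2 X_pos by (intro mult_right_mono) auto
  finally have S: "S \<le> (real s - 7 / 4 + (1 / 16 + y / 8)) * X" .
  have D: "(\<Sum>u\<in>H. d u * (x u)\<^sup>2) \<le> (n - 1) * X"
    unfolding X_def sum_distrib_left using d_le H(1) by (intro sum_mono mult_right_mono) auto
  have "\<rho> * X \<le> a * (\<Sum>u\<in>H. d u * (x u)\<^sup>2) + b * S + b * (p * (1 + 2 * k)) * Z"
    unfolding X_def S_def Z_def by (rule quadratic_bound[OF H(1) _ k1(1) t small]) (use k0 in auto)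
  also have "\<dots> \<le> a * ((n - 1) * X) + b * ((real s - 7 / 4 + (1 / 16 + y / 8)) * X)
      + b * (p * (1 + 2 * k)) * ((n * G + C) * X)"
    using D S Z a_pos b_pos p_pos k0 by (intro add_mono mult_left_mono) auto
  also have "\<dots> = (a * (n - 1) + b * (real s - 7 / 4 + (1 / 16 + y / 8) + (1 + 2 * k) * (G * y) + (1 + 2 * k) * (p * C))) * X"
    by (simp add: y_def algebra_simps)
  finally have "\<rho> \<le> a * (n - 1) + b * (real s - 7 / 4 + (1 / 16 + y / 8) + (1 + 2 * k) * (G * y) + (1 + 2 * k) * (p * C))"
    using X_pos by simp
  moreover have "a * (n - 1) + b * (real s - 1 + s * y - p * (real s)\<^sup>2) \<le> \<rho>"
    using \<rho>_ge_p by (simp add: y_def algebra_simps power2_eq_square)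
  \<comment> \<open>The terms \<open>a * (n - 1)\<close> cancel exactly; everything left carries the
    factor \<open>b\<close> and can be divided by it, however small \<open>b\<close> is.\<close>
  ultimately have "b * (real s - 1 + s * y - p * (real s)\<^sup>2) \<le>
      b * (real s - 7 / 4 + (1 / 16 + y / 8) + (1 + 2 * k) * (G * y) + (1 + 2 * k) * (p * C))"
    by linarith
  then have main: "real s - 1 + s * y - p * (real s)\<^sup>2 \<le>
      real s - 7 / 4 + (1 / 16 + y / 8) + (1 + 2 * k) * (G * y) + (1 + 2 * k) * (p * C)"
    using b_pos by simp
  have "(1 + 2 * k) * (p * C) \<le> 2 * (p * C)" using k1 p_pos C0 by (intro mult_right_mono) auto
  then have m1: "(1 + 2 * k) * (p * C) \<le> 1 / 384" using pC by linarith
  have "k * G \<le> k * s" using k0 by (intro mult_left_mono) (auto simp: G_def)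
  then have "k * G \<le> 1 / 1280" using k1 by (simp add: mult.commute)
  then have "(1 + 2 * k) * G \<le> real s - 1 / 2" by (simp add: G_def algebra_simps)
  then have "(1 + 2 * k) * G * y \<le> (real s - 1 / 2) * y" using y by (intro mult_right_mono) auto
  then have m2: "(1 + 2 * k) * (G * y) \<le> s * y - y / 2" by (simp add: algebra_simps)
  \<comment> \<open>The constants differ by at least \<open>3/4 - 1/16 - 2/384\<close>, and the
    multiples of \<open>y\<close> by \<open>1/2 - 1/8\<close>, both in the contradictory
    direction.\<close>
  show False using main m1 m2 pC y by linarith
qed

text \<open>\<open>H\<close> consists of the vertices of degree at least \<open>n / M\<close>; as
  the degree sum is at most \<open>c * n\<close>, it has at most \<open>c * M\<close> members. Below
  that degree both the \<open>a\<close>-part and the \<open>b\<close>-part of \<open>small\<close>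
  are at most \<open>k / 2\<close> times \<open>\<rho>\<close>.\<close>

lemma exists_large_degree_set:
  fixes M :: real
  assumes g: "0 < g" "g \<le> 1"
    and k: "k = g / (1280 * (real s)\<^sup>2)" and M: "M = (4 * (real c + 1) / k)\<^sup>2"
    and h: "h = nat \<lceil>c * M\<rceil>" and C: "C = real (s * 2 ^ h * h)"
    and e: "e = h + 2 * C + (real s)\<^sup>2" and pe: "p * e * (384 * (real s)\<^sup>2 * (real h + 1)) \<le> g"
  shows "\<exists>L\<subseteq>V. card L = s \<and> (\<forall>u\<in>L. n - 1 - d u \<le> g * n)"
proof -
  define r where "r = 4 * (real c + 1) / k"
  \<comment> \<open>With \<open>M\<close> equal to \<open>r^2\<close>, this choice turns
    \<open>d w / t\<close> into at most \<open>t\<close>. As \<open>p * sqrt n\<close> is at most 2,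
    the \<open>b\<close>-part relative to \<open>\<rho>\<close> is at most
    \<open>2 * (c + 1) / r\<close>, which is \<open>k / 2\<close>.\<close>
  define t where "t = sqrt n / r"
  define H where "H = {v \<in> V. n / M \<le> d v}"
  have s2: "1 \<le> (real s)\<^sup>2" using s_pos' by simp
  have s0: "0 < real s" using s_pos' by simp
  have k0: "0 < k" using g s0 by (simp add: k)
  have k1: "k \<le> 1"
  proof -
    have "g / (1280 * (real s)\<^sup>2) \<le> 1 / 1" using g s2 by (intro frac_le) auto
    then show ?thesis by (simp add: k)
  qed
  have r: "0 < r" "M = r\<^sup>2" "r * k = 4 * (real c + 1)" using k0 by (simp_all add: r_def M)
  have r4: "4 \<le> r * k" using r(3) by simp
  have "r * k \<le> r * 1" using k1 r by (intro mult_left_mono) auto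
  then have r1: "4 \<le> r" using r4 by linarith
  have n0: "0 < n" using s_le' s_pos' by simp
  have t: "0 < t" using n0 r by (simp add: t_def)
  have M0: "0 < M" using r by simp
  have HV: "H \<subseteq> V" by (auto simp: H_def)
  have "card H * (n / M) = (\<Sum>v\<in>H. n / M)" by simp
  also have "\<dots> \<le> (\<Sum>v\<in>H. d v)" by (intro sum_mono) (auto simp: H_def)
  also have "\<dots> \<le> (\<Sum>v\<in>V. d v)" using finite_V HV by (intro sum_mono2) auto
  also have "\<dots> = real (\<Sum>v\<in>V. card (N v \<inter> V))" using N_subset by (simp add: Int_absorb2)
  also have "\<dots> \<le> real (c * card V)" by (intro of_nat_mono sparse) simp
  finally have "card H * n \<le> c * M * n" using M0 by (simp add: field_simps)
  then have "real (card H) \<le> c * M" using n0 by simp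
  then have Hh: "card H \<le> h" unfolding h by linarith
  have small: "a * d w + b * (c * t + d w / t) \<le> k * \<rho>" if "w \<in> V - H" for w
  proof -
    have dw: "d w \<le> n / M" using that by (auto simp: H_def not_le)
    have "a * d w \<le> a * (n / M)" using dw a_pos by (intro mult_left_mono) auto
    also have "\<dots> \<le> 2 * \<rho> / M" using a_bound M0 by (simp add: divide_right_mono)
    also have "\<dots> \<le> \<rho> * (k / 2)"
    proof -
      have "4 * 1 \<le> (r * k) * r" using r4 r1 by (intro mult_mono) auto
      then have "4 \<le> k * M" by (simp add: r(2) power2_eq_square mult_ac)
      then have "2 / M \<le> k / 2" using M0 by (simp add: field_simps)
      then have "\<rho> * (2 / M) \<le> \<rho> * (k / 2)" using \<rho>_pos by (intro mult_left_mono) auto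
      then show ?thesis by (simp add: mult.commute)
    qed
    finally have 1: "a * d w \<le> \<rho> * (k / 2)" .
    have "d w / t \<le> (n / M) / t" using dw t by (intro divide_right_mono) auto
    also have "(n / M) / t = t"
      using n0 r by (simp add: t_def r(2) field_simps power2_eq_square)
    finally have "c * t + d w / t \<le> (c + 1) * t" by (simp add: algebra_simps)
    then have "p * (c * t + d w / t) \<le> p * ((c + 1) * t)" using p_pos by (intro mult_left_mono) auto
    also have "\<dots> = (c + 1) / r * (p * sqrt n)" by (simp add: t_def)
    also have "\<dots> \<le> (c + 1) / r * 2"
    proof -
      have "(p * sqrt n)\<^sup>2 \<le> 2\<^sup>2" using p_square_n_le n0 by (simp add: power_mult_distrib)
      then have "p * sqrt n \<le> 2" by (rule power2_le_imp_le) simp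
      then show ?thesis using r by (intro mult_left_mono) auto
    qed
    also have "(c + 1) / r * 2 = k / 2" using r by (simp add: field_simps)
    finally have "b * (c * t + d w / t) \<le> \<rho> * (k / 2)"
      unfolding b_mult[of "c * t + d w / t"] using \<rho>_pos by (intro mult_left_mono) auto
    moreover have "k * \<rho> = \<rho> * (k / 2) + \<rho> * (k / 2)" by simp
    ultimately show ?thesis using 1 by linarith
  qed
  have "s \<le> card {u \<in> H. n - 1 - d u \<le> g * n}"
    by (rule many_large_degrees[OF HV Hh t g k small C e pe])
  then obtain L where "L \<subseteq> {u \<in> H. n - 1 - d u \<le> g * n}" "card L = s"
    by (meson obtain_subset_with_card_n)
  then show ?thesis using HV by (intro exI[of _ L]) auto
qed

section \<open>Comparison with the join\<close>

text \<open>Testing the eigenvalue equation against the Perron vector of the extremal graph,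
  which is \<open>1\<close> on \<open>L\<close> and \<open>z\<close> elsewhere.\<close>

lemma test_extremal_vector:
  assumes L: "L \<subseteq> V" "card L = s"
  shows "(a + b * z) * (\<Sum>u\<in>L. (n - 1 - d u) * x u) \<le> z * (\<Sum>v\<in>V - L. card (N v - L) * x v)"
proof -
  define lam where "lam = a * (n - 1) + b * (real s - 1) + b * (n - s) * z"
  define w where "w = (\<lambda>v. if v \<in> L then 1 else z)"
  have fL: "finite L" by (rule finite_sub[OF L(1)])
  have lamz: "lam * z = a * s * z + b * s" using z_eq by (simp add: lam_def algebra_simps)
  have dsplit: "d v = real (card (N v \<inter> L)) + real (card (N v - L))" for v
  proof -
    have "card (N v) = card (N v \<inter> L) + card (N v - L)"
      using card_Int_Diff finite_N by blast
    then show ?thesis by simp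
  qed
  have wN: "(\<Sum>u\<in>N v. w u) = real (card (N v \<inter> L)) + z * card (N v - L)" for v
  proof -
    have "(\<Sum>u\<in>N v. w u) = (\<Sum>u\<in>N v \<inter> L. w u) + (\<Sum>u\<in>N v - L. w u)"
      using finite_N sum.Int_Diff by blast
    also have "(\<Sum>u\<in>N v \<inter> L. w u) = (\<Sum>u\<in>N v \<inter> L. 1)" by (intro sum.cong) (auto simp: w_def)
    also have "(\<Sum>u\<in>N v - L. w u) = (\<Sum>u\<in>N v - L. z)" by (intro sum.cong) (auto simp: w_def)
    finally show ?thesis by simp
  qed
  \<comment> \<open>Relative to the row of the join, every missing neighbour of a vertex of
    \<open>L\<close> costs at least \<open>a + b * z\<close>: it lowers the degree by one and
    removes an entry that is at least \<open>z\<close>, as \<open>z\<close> is at most 1.\<close>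
  have on_L: "w v * (a * d v * x v) + b * (x v * (\<Sum>u\<in>N v. w u)) \<le> (lam - (a + b * z) * (n - 1 - d v)) * x v"
    if v: "v \<in> L" for v
  proof -
    have "card (N v \<inter> L) \<le> card (L - {v})" using fL N_irrefl by (intro card_mono) auto
    also have "\<dots> = s - 1" using v L by simp
    finally have "real (card (N v \<inter> L)) \<le> real (s - 1)" by (rule of_nat_mono)
    then have l: "real (card (N v \<inter> L)) \<le> real s - 1" using s_pos by (simp add: of_nat_diff)
    have "a * d v + b * (\<Sum>u\<in>N v. w u) =
        a * d v + b * z * d v + (b * (1 - z)) * real (card (N v \<inter> L))"
      unfolding wN dsplit[of v] by (simp add: algebra_simps)
    also have "\<dots> \<le> a * d v + b * z * d v + (b * (1 - z)) * (real s - 1)"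
      using l b_pos z_le_1 by (intro add_left_mono mult_left_mono) auto
    also have "\<dots> = lam - (a + b * z) * (n - 1 - d v)" by (simp add: lam_def algebra_simps)
    finally have "(a * d v + b * (\<Sum>u\<in>N v. w u)) * x v \<le> (lam - (a + b * z) * (n - 1 - d v)) * x v"
      using x_nonneg by (intro mult_right_mono) auto
    then show ?thesis using v by (simp add: w_def algebra_simps)
  qed
  \<comment> \<open>In the join such a vertex has exactly the \<open>s\<close> neighbours in
    \<open>L\<close>, which gives \<open>lam * z\<close>. Each edge leaving \<open>L\<close> aside
    adds \<open>z * (a + b)\<close>, that is \<open>z\<close>.\<close>
  have off_L: "w v * (a * d v * x v) + b * (x v * (\<Sum>u\<in>N v. w u)) \<le> (lam * z + z * card (N v - L)) * x v"
    if v: "v \<in> V - L" for v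
  proof -
    have "card (N v \<inter> L) \<le> card L" using fL by (intro card_mono) auto
    then have l: "real (card (N v \<inter> L)) \<le> real s" using L by simp
    have "z * (a * d v) + b * (\<Sum>u\<in>N v. w u) =
        real (card (N v \<inter> L)) * (a * z + b) + z * ((a + b) * card (N v - L))"
      unfolding wN dsplit[of v] by (simp add: algebra_simps)
    also have "\<dots> \<le> real s * (a * z + b) + z * ((a + b) * card (N v - L))"
      using l b_pos a_pos z_pos by (intro add_right_mono mult_right_mono) auto
    also have "\<dots> = lam * z + z * card (N v - L)" by (simp add: lamz ab algebra_simps)
    finally have "(z * (a * d v) + b * (\<Sum>u\<in>N v. w u)) * x v \<le> (lam * z + z * card (N v - L)) * x v"
      using x_nonneg by (intro mult_right_mono) auto
    then show ?thesis using v by (simp add: w_def algebra_simps)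
  qed
  have wx: "(\<Sum>v\<in>V. w v * x v) = (\<Sum>v\<in>L. x v) + z * (\<Sum>v\<in>V - L. x v)"
  proof -
    have "(\<Sum>v\<in>V. w v * x v) = (\<Sum>v\<in>V - L. w v * x v) + (\<Sum>v\<in>L. w v * x v)"
      by (rule sum.subset_diff[OF L(1) finite_V])
    also have "(\<Sum>v\<in>V - L. w v * x v) = (\<Sum>v\<in>V - L. z * x v)" by (intro sum.cong) (auto simp: w_def)
    also have "(\<Sum>v\<in>L. w v * x v) = (\<Sum>v\<in>L. x v)" by (intro sum.cong) (auto simp: w_def)
    finally show ?thesis by (simp add: sum_distrib_left)
  qed
  have wx0: "0 \<le> (\<Sum>v\<in>V. w v * x v)"
    using x_nonneg z_pos by (intro sum_nonneg mult_nonneg_nonneg) (auto simp: w_def)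
  have "lam * (\<Sum>v\<in>V. w v * x v) \<le> \<rho> * (\<Sum>v\<in>V. w v * x v)"
    using \<rho>_ge wx0 by (intro mult_right_mono) (auto simp: lam_def)
  also have "\<dots> = (\<Sum>v\<in>V. w v * (\<rho> * x v))" by (simp add: sum_distrib_left mult_ac)
  also have "\<dots> = (\<Sum>v\<in>V. w v * (a * d v * x v) + b * (\<Sum>u\<in>N v. w v * x u))"
    using eigen by (intro sum.cong HOL.refl) (simp add: distrib_left sum_distrib_left mult_ac)
  also have "\<dots> = (\<Sum>v\<in>V. w v * (a * d v * x v)) + b * (\<Sum>v\<in>V. \<Sum>u\<in>N v. w v * x u)"
    by (simp add: sum.distrib sum_distrib_left)
  \<comment> \<open>Symmetry moves the adjacency matrix from \<open>x\<close> to the test vector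
    \<open>w\<close>.\<close>
  also have "(\<Sum>v\<in>V. \<Sum>u\<in>N v. w v * x u) = (\<Sum>v\<in>V. \<Sum>u\<in>N v. x v * w u)"
  proof -
    have NV: "N v = N v \<inter> V" for v using N_subset by auto
    have "(\<Sum>v\<in>V. \<Sum>u\<in>N v. w v * x u) = (\<Sum>v\<in>V. \<Sum>u\<in>V. if u \<in> N v then w v * x u else 0)"
      by (subst NV) (simp only: sum_Int_if[OF finite_V])
    also have "\<dots> = (\<Sum>u\<in>V. \<Sum>v\<in>V. if u \<in> N v then w v * x u else 0)" by (rule sum.swap)
    also have "\<dots> = (\<Sum>u\<in>V. \<Sum>v\<in>V. if v \<in> N u then x u * w v else 0)"
      by (intro sum.cong HOL.refl) (simp add: mult.commute N_sym)
    also have "\<dots> = (\<Sum>v\<in>V. \<Sum>u\<in>N v. x v * w u)"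
      by (subst (2) NV) (simp only: sum_Int_if[OF finite_V])
    finally show ?thesis .
  qed
  also have "(\<Sum>v\<in>V. w v * (a * d v * x v)) + b * (\<Sum>v\<in>V. \<Sum>u\<in>N v. x v * w u) =
      (\<Sum>v\<in>V. w v * (a * d v * x v) + b * (x v * (\<Sum>u\<in>N v. w u)))"
    by (simp add: sum.distrib sum_distrib_left)
  also have "\<dots> = (\<Sum>v\<in>V - L. w v * (a * d v * x v) + b * (x v * (\<Sum>u\<in>N v. w u))) +
      (\<Sum>v\<in>L. w v * (a * d v * x v) + b * (x v * (\<Sum>u\<in>N v. w u)))"
    by (rule sum.subset_diff[OF L(1) finite_V])
  also have "\<dots> \<le> (\<Sum>v\<in>V - L. (lam * z + z * card (N v - L)) * x v) +
      (\<Sum>v\<in>L. (lam - (a + b * z) * (n - 1 - d v)) * x v)"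
    using on_L off_L by (intro add_mono sum_mono) auto
  also have "(\<Sum>v\<in>V - L. (lam * z + z * card (N v - L)) * x v) =
      lam * (z * (\<Sum>v\<in>V - L. x v)) + z * (\<Sum>v\<in>V - L. card (N v - L) * x v)"
    unfolding sum_distrib_left sum.distrib[symmetric] by (intro sum.cong HOL.refl) (simp add: algebra_simps)
  also have "(\<Sum>v\<in>L. (lam - (a + b * z) * (n - 1 - d v)) * x v) =
      lam * (\<Sum>v\<in>L. x v) - (a + b * z) * (\<Sum>u\<in>L. (n - 1 - d u) * x u)"
    unfolding sum_distrib_left sum_subtractf[symmetric] by (intro sum.cong HOL.refl) (simp add: algebra_simps)
  finally show ?thesis unfolding wx by (simp add: algebra_simps)
qed

text \<open>The bracket in \<open>z_eq\<close> is at least half of \<open>a * n\<close>. Together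
  with \<open>zpn_bound\<close> this keeps \<open>z * T\<close> in
  \<open>few_missing_imp_none\<close> below a constant multiple of \<open>b\<close>.\<close>

lemma zan_bound: "z * (a * n) \<le> 2 * (b * s)"
proof -
  have b1: "0 \<le> b * (real s - 1)" "0 \<le> b * (n - s) * z"
    using b_pos s_pos' z_pos s_le' by simp_all
  have "a * n \<le> a * (2 * (n - 1 - s))" using a_pos s_le' by (intro mult_left_mono) auto
  then have "a * n \<le> 2 * (a * (n - 1) + b * (real s - 1) + b * (n - s) * z - a * s)"
    using b1 by (simp add: algebra_simps)
  then have "z * (a * n) \<le> z * (2 * (a * (n - 1) + b * (real s - 1) + b * (n - s) * z - a * s))"
    using z_pos by (intro mult_left_mono) auto
  then show ?thesis by (simp only: mult.left_commute[of z 2] z_eq)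
qed

lemma zpn_bound: "z * (p * n) \<le> 2"
proof -
  have "z * n * (p * s) \<le> z * n * z" using p_le_z z_pos by (intro mult_left_mono) auto
  also have "\<dots> \<le> 2 * s" using z_square_n by (simp add: power2_eq_square mult_ac)
  finally have "s * (z * (p * n)) \<le> s * 2" by (simp add: mult_ac)
  then show ?thesis using s_pos' by simp
qed

text \<open>The quantity \<open>(a + b z) n\<close> tends to infinity with \<open>n\<close>, uniformly in \<open>a\<close>.\<close>

lemma order_bounded:
  assumes Q: "(a + b * z) * n \<le> K"
  shows "n \<le> 2 * K \<or> n \<le> 4 * K * (K + s)"
proof (cases "b \<le> 1 / 2")
  case True
  then have "1 / 2 \<le> a + b * z" using ab b_pos z_pos by (simp add: add_increasing2)
  then have "1 / 2 * n \<le> (a + b * z) * n" by (intro mult_right_mono) auto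
  then show ?thesis using Q by simp
next
  case False
  \<comment> \<open>For \<open>b\<close> above 1/2, \<open>n * z\<close> is at most
    \<open>2 * Q'\<close>, while \<open>z_eq\<close> bounds \<open>z\<close> from below by
    \<open>b * s / (Q' + s)\<close>; the two together bound \<open>n\<close>.\<close>
  define Q' where "Q' = (a + b * z) * n"
  have Q0: "0 \<le> Q'" using a_pos b_pos z_pos by (simp add: Q'_def)
  have nz: "n * z \<le> 2 * Q'"
  proof -
    have "1 / 2 * z \<le> b * z" using False z_pos by (intro mult_right_mono) auto
    then have "z \<le> 2 * (a + b * z)" using a_pos by simp
    then have "n * z \<le> n * (2 * (a + b * z))" by (intro mult_left_mono) auto
    then show ?thesis by (simp add: Q'_def mult_ac)
  qed
  have "b * s \<le> 1 * real s" using a_pos ab by (intro mult_right_mono) auto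
  moreover have "0 \<le> a * s" "0 \<le> b * s * z" "0 \<le> a" "0 \<le> b"
    using a_pos b_pos z_pos by simp_all
  moreover have "a * (n - 1) + b * (real s - 1) + b * (n - s) * z - a * s =
      Q' + b * s - a - b - b * s * z - a * s"
    by (simp add: Q'_def algebra_simps)
  ultimately have "a * (n - 1) + b * (real s - 1) + b * (n - s) * z - a * s \<le> Q' + s"
    by linarith
  then have "b * s \<le> z * (Q' + s)"
    unfolding z_eq[symmetric] using z_pos by (intro mult_left_mono) auto
  then have "n * (b * s) \<le> n * (z * (Q' + s))" by (intro mult_left_mono) auto
  also have "\<dots> = n * z * (Q' + s)" by simp
  also have "\<dots> \<le> 2 * Q' * (Q' + s)" using nz Q0 by (intro mult_right_mono) auto
  also have "\<dots> \<le> 2 * K * (K + s)" using Q Q0 by (intro mult_mono) (auto simp: Q'_def)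
  finally have 1: "n * (b * s) \<le> 2 * K * (K + s)" .
  have "1 / 2 * 1 \<le> b * s" using False s_pos' b_pos by (intro mult_mono) auto
  then have "n * (1 / 2) \<le> n * (b * s)" by (intro mult_left_mono) auto
  then show ?thesis using 1 by simp
qed

lemma pn_le: "p * n \<le> 2 * ((a + b * z) * n)"
proof -
  have "p * 1 \<le> p * s" using s_pos' p_pos by (intro mult_left_mono) auto
  then have pz: "p \<le> z" using p_le_z by linarith
  have "z \<le> 2 * (a + b * z)"
  proof (cases "b \<le> 1 / 2")
    case True
    then have "1 / 2 \<le> a" using ab by linarith
    moreover have "0 \<le> b * z" using b_pos z_pos by simp
    ultimately show ?thesis using z_le_1 by (simp add: distrib_left)
  next
    case False
    then have "1 / 2 * z \<le> b * z" using z_pos by (intro mult_right_mono) auto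
    then show ?thesis using a_pos by simp
  qed
  then have "p * n \<le> 2 * (a + b * z) * n" using pz by (intro mult_right_mono) linarith+
  then show ?thesis by (simp only: mult.assoc)
qed

text \<open>If the largest number \<open>m\<close> of nonneighbours of a vertex of \<open>L\<close> were positive, then
  \<open>(a + b z) n\<close> would be bounded, contrary to \<open>order_bounded\<close>.\<close>

lemma few_missing_imp_none:
  assumes L: "L \<subseteq> V" "card L = s" and miss: "\<And>u. u \<in> L \<Longrightarrow> n - 1 - d u \<le> g * n"
    and x_le: "\<And>v. v \<in> V \<Longrightarrow> x v \<le> 1" and u1: "u1 \<in> V" "x u1 = 1"
    and c1: "c1 = real s + 1 + c" and K: "K = 4 * ((real c + 2) * s * (6 * real s + 4))"
    and g: "0 < g" "g * (32 * c1 * s) \<le> 1" "g * (8 * K * c1 * s) \<le> 1"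
    and p_small: "p * (8 * (real s + 1)) \<le> 1"
    and n_large: "8 * (real s + 1) \<le> n" "2 * (2 * K * (s + 1)) < n"
      "4 * (2 * K * (s + 1)) * (2 * K * (s + 1) + s) < n"
  shows "\<forall>u\<in>L. N u = V - {u}" "\<forall>v\<in>V - L. N v = L"
proof -
  define B where "B = {v \<in> V - L. L \<subseteq> N v}"
  define A where "A = V - L - B"
  define m where "m = Max ((\<lambda>u. n - 1 - d u) ` L)"
  have fL: "finite L" "L \<noteq> {}" using finite_sub[OF L(1)] L(2) s_pos by auto
  have sub: "A \<subseteq> V" "B \<subseteq> V" "finite A" "finite B"
    using finite_V by (auto simp: A_def B_def)
  have m_ge: "n - 1 - d u \<le> m" if "u \<in> L" for u using that fL by (simp add: m_def)
  have "m \<in> (\<lambda>u. n - 1 - d u) ` L" unfolding m_def using fL by (intro Max_in) auto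
  then obtain u where u: "u \<in> L" "m = n - 1 - d u" by blast
  have miss0: "0 \<le> n - 1 - d u" if "u \<in> L" for u using that d_le L by force
  have m0: "0 \<le> m" using u miss0 by simp
  have mg: "m \<le> g * n" using u miss by simp
  have c1_ge: "1 \<le> c1" by (simp add: c1)
  have card_miss: "real (card (V - {u} - N u)) = n - 1 - d u" if "u \<in> V" for u
  proof -
    have "card (V - {u} - N u) = card (V - {u}) - card (N u)"
      using N_subset N_irrefl finite_N by (intro card_Diff_subset) auto
    also have "card (V - {u}) = card V - 1" using that by simp
    finally have "card (V - {u} - N u) = card V - 1 - card (N u)" .
    moreover have "card (N u) \<le> card V - 1" using d_le[OF that] s_le by linarith
    moreover have "1 \<le> card V" using s_le by simp
    ultimately show ?thesis by (simp add: of_nat_diff)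
  qed
  have A_card: "real (card A) \<le> s * m"
  proof -
    have "A \<subseteq> (\<Union>u\<in>L. V - {u} - N u)" using N_sym by (auto simp: A_def B_def)
    then have "card A \<le> card (\<Union>u\<in>L. V - {u} - N u)" using finite_V fL by (intro card_mono) auto
    also have "\<dots> \<le> (\<Sum>u\<in>L. card (V - {u} - N u))" by (rule card_UN_le[OF fL(1)])
    finally have "real (card A) \<le> real (\<Sum>u\<in>L. card (V - {u} - N u))" by (rule of_nat_mono)
    also have "\<dots> = (\<Sum>u\<in>L. n - 1 - d u)" unfolding of_nat_sum using L card_miss by (intro sum.cong) auto
    also have "\<dots> \<le> (\<Sum>u\<in>L. m)" by (intro sum_mono m_ge)
    finally show ?thesis using L by simp
  qed
  have sg: "32 * (s * g) \<le> 1"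
  proof -
    have "32 * (s * g) * 1 \<le> 32 * (s * g) * c1" using c1_ge g by (intro mult_left_mono) auto
    then show ?thesis using g(2) by (simp add: mult_ac)
  qed
  have A_card': "real (card A) \<le> s * g * n"
  proof -
    have "s * m \<le> s * (g * n)" using mg by (intro mult_left_mono) auto
    then show ?thesis using A_card by simp
  qed
  have "(32 * (s * g)) * n \<le> 1 * n" using sg by (intro mult_right_mono) auto
  then have sgn: "32 * (s * g * n) \<le> n" by simp
  have cardV: "n = real s + real (card A) + real (card B)"
  proof -
    have "card V = card (L \<union> (A \<union> B))" using L by (intro arg_cong[of _ _ card]) (auto simp: A_def B_def)
    also have "\<dots> = card L + card (A \<union> B)" using fL sub by (intro card_Un_disjoint) (auto simp: A_def B_def)
    also have "card (A \<union> B) = card A + card B" using sub by (intro card_Un_disjoint) (auto simp: A_def)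
    finally show ?thesis using L by simp
  qed
  have A32: "32 * real (card A) \<le> n" using A_card' sgn by linarith
  then have B_card: "n / 2 \<le> card B" using cardV n_large(1) by simp
  have "real (s + 2) \<le> real (card B)" using B_card n_large(1) s_pos' by simp
  then have B_big: "s + 2 \<le> card B" by (simp only: of_nat_le_iff)
  have LB: "\<forall>l\<in>L. B \<subseteq> N l" using N_sym by (auto simp: B_def)
  have LB_disjoint: "L \<inter> B = {}" by (auto simp: B_def)
  have B_ind: "N v \<inter> B = {}" if "v \<in> B" for v
    by (rule common_independent[OF L(1) sub(2) LB_disjoint L(2) LB B_big that])
  have A_one: "card (N v \<inter> B) \<le> 1" if "v \<in> A" for v
    using that by (intro common_unique[OF L(1) sub(2) LB_disjoint L(2) LB B_big]) (simp add: A_def)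
  have split3: "(\<Sum>w\<in>N v. f w) = (\<Sum>w\<in>N v \<inter> L. f w) + (\<Sum>w\<in>N v \<inter> A. f w) + (\<Sum>w\<in>N v \<inter> B. f w)"
    for v and f :: "'a \<Rightarrow> real"
  proof -
    have "(\<Sum>w\<in>N v. f w) = (\<Sum>w\<in>N v \<inter> L. f w) + (\<Sum>w\<in>N v \<inter> (V - L). f w)"
      by (rule sum_split_neighbours[OF L(1)])
    also have "N v \<inter> (V - L) = (N v \<inter> A) \<union> (N v \<inter> B)" by (auto simp: A_def B_def)
    also have "(\<Sum>w\<in>(N v \<inter> A) \<union> (N v \<inter> B). f w) = (\<Sum>w\<in>N v \<inter> A. f w) + (\<Sum>w\<in>N v \<inter> B. f w)"
      using sub by (intro sum.union_disjoint) (auto simp: A_def)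
    finally show ?thesis by simp
  qed
  have cards: "card (N v \<inter> L) \<le> s" "card (N v \<inter> A) \<le> card A" for v
    using L fL sub by (auto intro: card_mono)
  have one_B: "card (N v \<inter> B) \<le> 1" if "v \<in> V - L" for v
    using that A_one B_ind by (cases "v \<in> B") (auto simp: A_def)
  have x_sum: "(\<Sum>w\<in>S. x w) \<le> card S" if "S \<subseteq> V" for S
  proof -
    have "(\<Sum>w\<in>S. x w) \<le> (\<Sum>w\<in>S. 1)" using that x_le by (intro sum_mono) auto
    then show ?thesis by simp
  qed
  \<comment> \<open>Off \<open>L\<close> degrees are at most \<open>n / 4\<close>, so the degree
    term uses up at most half of \<open>\<rho>\<close>; this is the factor 2.\<close>
  have x_off: "x v \<le> 2 * p * (\<Sum>w\<in>N v. x w)" if v: "v \<in> V - L" for v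
  proof -
    have "d v = real (card (N v \<inter> L)) + real (card (N v \<inter> A)) + real (card (N v \<inter> B))"
      using split3[of "\<lambda>_. 1" v] by simp
    also have "\<dots> \<le> real s + real (card A) + 1" using cards[of v] one_B[OF v] by linarith
    also have "\<dots> \<le> n / 4" using A32 n_large(1) s_pos' by simp
    finally have "a * d v \<le> a * (n / 4)" using a_pos by (intro mult_left_mono) auto
    then have ad: "a * d v \<le> \<rho> / 2" using a_bound by simp
    have "\<rho> * x v = a * d v * x v + b * (\<Sum>w\<in>N v. x w)" using v eigen by simp
    moreover have "a * d v * x v \<le> \<rho> / 2 * x v" using ad x_nonneg by (intro mult_right_mono) auto
    moreover have "\<rho> / 2 * x v = \<rho> * x v / 2" by simp
    ultimately have "\<rho> * x v \<le> 2 * (b * (\<Sum>w\<in>N v. x w))" by linarith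
    also have "\<dots> = \<rho> * (2 * p * (\<Sum>w\<in>N v. x w))" using b_mult[of "\<Sum>w\<in>N v. x w"] by simp
    finally show ?thesis using \<rho>_pos by simp
  qed
  define XA where "XA = (\<Sum>v\<in>A. x v)"
  have XA0: "0 \<le> XA" unfolding XA_def using x_nonneg by (intro sum_nonneg) auto
  have xL: "(\<Sum>w\<in>N v \<inter> L. x w) \<le> s" for v
    using x_sum[of "N v \<inter> L"] L cards(1)[of v] by force
  have xA: "(\<Sum>w\<in>N v \<inter> A. x w) \<le> XA" for v
    unfolding XA_def using sub x_nonneg by (intro sum_mono2) auto
  have xB: "(\<Sum>w\<in>N v \<inter> B. x w) \<le> 1" if "v \<in> V - L" for v
    using x_sum[of "N v \<inter> B"] sub one_B[OF that] by force
  define \<delta> where "\<delta> = 2 * p * (real s + 1 + XA)"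
  have x_\<delta>: "x v \<le> \<delta>" if "v \<in> V - L" for v
  proof -
    have "(\<Sum>w\<in>N v. x w) \<le> real s + 1 + XA"
      using xL[of v] xA[of v] xB[OF that] split3[of x v] by linarith
    then have "2 * p * (\<Sum>w\<in>N v. x w) \<le> \<delta>" unfolding \<delta>_def using p_pos by (intro mult_left_mono) auto
    then show ?thesis using x_off[OF that] by linarith
  qed
  have sparse_A: "(\<Sum>v\<in>A. real (card (N v \<inter> A))) \<le> real c * real (card A)"
    using sparse[OF sub(1)] by (metis of_nat_le_iff of_nat_mult of_nat_sum)
  have XA_le: "XA \<le> 2 * p * c1 * card A"
  proof -
    have "XA \<le> (\<Sum>v\<in>A. 2 * p * (real s + 1 + card (N v \<inter> A)))"
      unfolding XA_def
    proof (rule sum_mono)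
      fix v assume v: "v \<in> A"
      then have vV: "v \<in> V - L" by (auto simp: A_def)
      have "(\<Sum>w\<in>N v \<inter> A. x w) \<le> card (N v \<inter> A)" using sub by (intro x_sum) auto
      then have "(\<Sum>w\<in>N v. x w) \<le> real s + 1 + card (N v \<inter> A)"
        using xL[of v] xB[OF vV] split3[of x v] by linarith
      then have "2 * p * (\<Sum>w\<in>N v. x w) \<le> 2 * p * (real s + 1 + card (N v \<inter> A))"
        using p_pos by (intro mult_left_mono) auto
      then show "x v \<le> 2 * p * (real s + 1 + card (N v \<inter> A))" using x_off[OF vV] by linarith
    qed
    also have "\<dots> = 2 * p * ((real s + 1) * card A + (\<Sum>v\<in>A. real (card (N v \<inter> A))))"
      by (simp add: sum.distrib mult.commute flip: sum_distrib_left)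
    also have "\<dots> \<le> 2 * p * ((real s + 1) * card A + real c * real (card A))"
      using sparse_A p_pos by (intro mult_left_mono add_left_mono) auto
    finally show ?thesis by (simp add: c1 algebra_simps)
  qed
  have XA_n: "XA \<le> 2 * c1 * s * g * (p * n)"
  proof -
    have "2 * p * c1 * card A \<le> 2 * p * c1 * (s * g * n)"
      using A_card' p_pos c1_ge by (intro mult_left_mono) auto
    then show ?thesis using XA_le by (simp add: mult_ac)
  qed
  have pn0: "0 \<le> p * n" using p_pos by simp
  have c1sg: "2 * c1 * s * g \<le> 1 / 16" using g(2) by (simp add: mult_ac)
  have XA_pn: "XA \<le> p * n"
  proof -
    have "2 * c1 * s * g * (p * n) \<le> 1 / 16 * (p * n)" using c1sg pn0 by (intro mult_right_mono) auto
    then show ?thesis using XA_n pn0 by linarith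
  qed
  have p_half: "p \<le> 1 / 2"
  proof -
    have "p * 2 \<le> p * (8 * (real s + 1))" using p_pos by (intro mult_left_mono) auto
    then show ?thesis using p_small by linarith
  qed
  have \<delta>1: "\<delta> < 1"
  proof -
    have "2 * p * XA \<le> 2 * p * (2 * c1 * s * g * (p * n))" using XA_n p_pos by (intro mult_left_mono) auto
    also have "\<dots> = 2 * (2 * c1 * s * g) * (p\<^sup>2 * n)" by (simp add: power2_eq_square)
    also have "\<dots> \<le> 2 * (1 / 16) * 2" using c1sg p_square_n_le c1_ge g(1) by (intro mult_mono) auto
    finally have "2 * p * XA \<le> 1 / 4" by simp
    moreover have "2 * p * (real s + 1) \<le> 1 / 4" using p_small by (simp add: algebra_simps)
    moreover have "\<delta> = 2 * p * (real s + 1) + 2 * p * XA" by (simp add: \<delta>_def algebra_simps)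
    ultimately show ?thesis by linarith
  qed
  \<comment> \<open>Entries off \<open>L\<close> are at most \<delta>, which is below 1, so the
    vertex carrying the maximum 1 lies in \<open>L\<close>. Hence it is adjacent to all of
    \<open>B\<close>, which forces entries of at least \<open>p\<close> there.\<close>
  have u1L: "u1 \<in> L" using x_\<delta>[of u1] \<delta>1 u1 by auto
  have xB_ge: "p \<le> x v" if v: "v \<in> B" for v
  proof -
    have vV: "v \<in> V" and "u1 \<in> N v" using v u1L by (auto simp: B_def)
    then have "x u1 \<le> (\<Sum>w\<in>N v. x w)" using finite_N x_nonneg by (intro member_le_sum) auto
    then have "b * 1 \<le> b * (\<Sum>w\<in>N v. x w)" using u1 b_pos by (intro mult_left_mono) auto
    moreover have "0 \<le> a * d v * x v" using a_pos x_nonneg by simp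
    ultimately have "b \<le> \<rho> * x v" using eigen[OF vV] by simp
    then show ?thesis using \<rho>_pos by (simp add: p_def field_simps)
  qed
  define SB where "SB = (\<Sum>v\<in>B. x v)"
  have SB_ge: "p * n / 2 \<le> SB"
  proof -
    have "p * (n / 2) \<le> p * card B" using B_card p_pos by (intro mult_left_mono) auto
    also have "\<dots> = (\<Sum>v\<in>B. p)" by simp
    also have "\<dots> \<le> SB" unfolding SB_def by (intro sum_mono xB_ge)
    finally show ?thesis by simp
  qed
  \<comment> \<open>Double counting: every vertex of \<open>A\<close> has at most one neighbour in
    \<open>B\<close>.\<close>
  have count: "(\<Sum>v\<in>B. \<Sum>w\<in>N v \<inter> A. f w) \<le> (\<Sum>w\<in>A. f w)" if f: "\<And>w. 0 \<le> f w" for f :: "'a \<Rightarrow> real"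
  proof -
    have "(\<Sum>v\<in>B. \<Sum>w\<in>N v \<inter> A. f w) = (\<Sum>v\<in>B. \<Sum>w\<in>A. if w \<in> N v then f w else 0)"
      by (simp only: sum_Int_if[OF sub(3)])
    also have "\<dots> = (\<Sum>w\<in>A. \<Sum>v\<in>B. if w \<in> N v then f w else 0)" by (rule sum.swap)
    also have "\<dots> = (\<Sum>w\<in>A. card (N w \<inter> B) * f w)"
    proof (intro sum.cong HOL.refl)
      fix w
      have "(\<Sum>v\<in>B. if w \<in> N v then f w else 0) = (\<Sum>v\<in>N w \<inter> B. f w)"
        by (simp only: sum_Int_if[OF sub(4)] N_sym[of w])
      then show "(\<Sum>v\<in>B. if w \<in> N v then f w else 0) = card (N w \<inter> B) * f w" by simp
    qed
    also have "\<dots> \<le> (\<Sum>w\<in>A. 1 * f w)" using A_one f by (intro sum_mono mult_right_mono) force+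
    finally show ?thesis by simp
  qed
  have SB_le: "SB \<le> 2 * p * (s * n + XA)"
  proof -
    have "SB \<le> (\<Sum>v\<in>B. 2 * p * (s + (\<Sum>w\<in>N v \<inter> A. x w)))"
      unfolding SB_def
    proof (rule sum_mono)
      fix v assume v: "v \<in> B"
      then have vV: "v \<in> V - L" by (auto simp: B_def)
      have "(\<Sum>w\<in>N v. x w) \<le> s + (\<Sum>w\<in>N v \<inter> A. x w)"
        using xL[of v] split3[of x v] B_ind[OF v] by simp
      then have "2 * p * (\<Sum>w\<in>N v. x w) \<le> 2 * p * (s + (\<Sum>w\<in>N v \<inter> A. x w))"
        using p_pos by (intro mult_left_mono) auto
      then show "x v \<le> 2 * p * (s + (\<Sum>w\<in>N v \<inter> A. x w))" using x_off[OF vV] by linarith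
    qed
    also have "\<dots> = 2 * p * (s * card B + (\<Sum>v\<in>B. \<Sum>w\<in>N v \<inter> A. x w))"
      by (simp add: sum.distrib mult.commute flip: sum_distrib_left)
    also have "\<dots> \<le> 2 * p * (s * n + XA)"
    proof -
      have "real s * real (card B) \<le> real s * n" using cardV by (intro mult_left_mono) auto
      moreover have "(\<Sum>v\<in>B. \<Sum>w\<in>N v \<inter> A. x w) \<le> XA" unfolding XA_def by (rule count[OF x_nonneg])
      ultimately show ?thesis using p_pos by (intro mult_left_mono) auto
    qed
    finally show ?thesis .
  qed
  have tot: "s + XA + SB \<le> s + (2 * real s + 2) * (p * n)"
  proof -
    have "(2 * p) * XA \<le> 1 * XA" using p_half XA0 by (intro mult_right_mono) auto
    then have "SB \<le> 2 * (s * (p * n)) + XA" using SB_le by (simp add: algebra_simps)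
    then show ?thesis using XA_pn by (simp add: algebra_simps)
  qed
  have \<rho>_le: "\<rho> \<le> a * (n - 1) + b * (s + (2 * real s + 2) * (p * n))"
  proof -
    have "\<rho> = a * d u1 + b * (\<Sum>w\<in>N u1. x w)" using eigen[OF u1(1)] u1 by simp
    moreover have "a * d u1 \<le> a * (n - 1)" using d_le[OF u1(1)] a_pos by (intro mult_left_mono) auto
    moreover have "(\<Sum>w\<in>N u1 \<inter> B. x w) \<le> SB" unfolding SB_def using sub x_nonneg by (intro sum_mono2) auto
    then have "(\<Sum>w\<in>N u1. x w) \<le> s + (2 * real s + 2) * (p * n)"
      using xL[of u1] xA[of u1] split3[of x u1] tot by linarith
    then have "b * (\<Sum>w\<in>N u1. x w) \<le> b * (s + (2 * real s + 2) * (p * n))"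
      using b_pos by (intro mult_left_mono) auto
    ultimately show ?thesis by linarith
  qed
  \<comment> \<open>An upper bound for \<open>\<rho> - a * d u\<close> at the vertex
    \<open>u\<close> of \<open>L\<close> with the most nonneighbours: \<open>\<rho>_le\<close> is
    the equation at \<open>u1\<close>, and the difference of \<open>n - 1\<close> and
    \<open>d u\<close> is \<open>m\<close>. Since \<open>u\<close> sees all of \<open>B\<close>, its
    equation then yields a lower bound on \<open>x u\<close>.\<close>
  define T where "T = a * m + b * (s + (2 * real s + 2) * (p * n))"
  have xu: "b * (p * n / 2) \<le> T * x u"
  proof -
    have uV: "u \<in> V" using u L by auto
    have "B \<subseteq> N u" using LB u by auto
    then have "SB \<le> (\<Sum>w\<in>N u. x w)" unfolding SB_def using finite_N x_nonneg by (intro sum_mono2) auto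
    then have "p * n / 2 \<le> (\<Sum>w\<in>N u. x w)" using SB_ge by linarith
    then have "b * (p * n / 2) \<le> b * (\<Sum>w\<in>N u. x w)" using b_pos by (intro mult_left_mono) auto
    also have "\<dots> = (\<rho> - a * d u) * x u" using eigen[OF uV] by (simp add: algebra_simps)
    also have "\<dots> \<le> T * x u"
    proof (intro mult_right_mono x_nonneg)
      have "a * m = a * (n - 1) - a * d u" unfolding u(2) by (simp add: algebra_simps)
      then show "\<rho> - a * d u \<le> T" using \<rho>_le by (simp add: T_def)
    qed
    finally show ?thesis .
  qed
  \<comment> \<open>All degrees outside \<open>L\<close> sum to at most \<open>c + 2\<close> times
    \<open>card A\<close>: \<open>c\<close> for pairs inside \<open>A\<close>, and 1 for each
    direction of the edges between \<open>A\<close> and \<open>B\<close>. Each is weighted by at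
    most \<delta>.\<close>
  have out: "(\<Sum>v\<in>V - L. card (N v - L) * x v) \<le> \<delta> * ((real c + 2) * card A)"
  proof -
    have \<delta>0: "0 \<le> \<delta>" using p_pos XA0 by (simp add: \<delta>_def)
    have AB: "card (N v - L) = card (N v \<inter> A) + card (N v \<inter> B)" for v
    proof -
      have "N v - L = (N v \<inter> A) \<union> (N v \<inter> B)" using N_subset by (auto simp: A_def B_def)
      moreover have "card ((N v \<inter> A) \<union> (N v \<inter> B)) = card (N v \<inter> A) + card (N v \<inter> B)"
        using sub by (intro card_Un_disjoint) (auto simp: A_def)
      ultimately show ?thesis by simp
    qed
    have VL: "V - L = A \<union> B" "A \<inter> B = {}" by (auto simp: A_def B_def)
    have "(\<Sum>v\<in>V - L. card (N v - L) * x v) \<le> (\<Sum>v\<in>V - L. card (N v - L) * \<delta>)"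
      using x_\<delta> by (intro sum_mono mult_left_mono) auto
    also have "\<dots> = \<delta> * (\<Sum>v\<in>V - L. real (card (N v - L)))" by (simp add: sum_distrib_left mult.commute)
    also have "(\<Sum>v\<in>V - L. real (card (N v - L))) =
        (\<Sum>v\<in>A. real (card (N v - L))) + (\<Sum>v\<in>B. real (card (N v - L)))"
      unfolding VL(1) using sub VL(2) by (intro sum.union_disjoint) auto
    also have "(\<Sum>v\<in>A. real (card (N v - L))) \<le> (\<Sum>v\<in>A. real (card (N v \<inter> A)) + 1)"
      using A_one by (intro sum_mono) (force simp: AB)
    also have "\<dots> \<le> real c * real (card A) + card A" using sparse_A by (simp add: sum.distrib)
    also have "(\<Sum>v\<in>B. real (card (N v - L))) = (\<Sum>v\<in>B. \<Sum>w\<in>N v \<inter> A. 1)"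
      using B_ind by (intro sum.cong) (auto simp: AB)
    also have "\<dots> \<le> (\<Sum>w\<in>A. 1)" by (rule count) simp
    finally have "(\<Sum>v\<in>V - L. card (N v - L) * x v) \<le> \<delta> * (real c * real (card A) + card A + (\<Sum>w\<in>A. 1))"
      using \<delta>0 by (simp add: mult_left_mono)
    then show ?thesis by (simp add: algebra_simps)
  qed
  have "m = 0"
  proof (rule ccontr)
    assume "m \<noteq> 0"
    then have m_pos: "0 < m" using m0 by simp
    define Q where "Q = (a + b * z) * n"
    define c2 where "c2 = (real c + 2) * s"
    have c20: "0 \<le> c2" by (simp add: c2_def)
    have q0: "0 < a + b * z" using a_pos b_pos z_pos by (simp add: add_pos_pos)
    have "m * x u \<le> (\<Sum>u\<in>L. (n - 1 - d u) * x u)"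
      unfolding u(2) using fL u(1) miss0 x_nonneg by (intro member_le_sum mult_nonneg_nonneg) auto
    then have "(a + b * z) * (m * x u) \<le> (a + b * z) * (\<Sum>u\<in>L. (n - 1 - d u) * x u)"
      using q0 by (intro mult_left_mono) auto
    also have "\<dots> \<le> z * (\<Sum>v\<in>V - L. card (N v - L) * x v)" by (rule test_extremal_vector[OF L])
    also have "\<dots> \<le> z * (\<delta> * ((real c + 2) * card A))" using out z_pos by (intro mult_left_mono) auto
    also have "\<dots> \<le> z * (\<delta> * ((real c + 2) * (s * m)))"
      using A_card z_pos p_pos XA0 by (intro mult_left_mono) (auto simp: \<delta>_def)
    finally have "m * ((a + b * z) * x u) \<le> m * (z * \<delta> * c2)" by (simp add: c2_def mult_ac)
    \<comment> \<open>Of the loss on \<open>L\<close> only the term of \<open>u\<close> is kept. It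
      is proportional to \<open>m\<close>, and so is the gain because \<open>card A\<close> is at
      most \<open>s * m\<close>; thus \<open>m\<close> cancels, however small it is.\<close>
    then have key: "(a + b * z) * x u \<le> z * \<delta> * c2" using m_pos by simp
    have T0: "0 \<le> T" using a_pos b_pos m0 pn0 by (simp add: T_def)
    have zT: "z * T \<le> b * (6 * real s + 4)"
    proof -
      have "z * (a * m) \<le> z * (a * (g * n))" using mg z_pos a_pos by (intro mult_left_mono) auto
      also have "\<dots> = g * (z * (a * n))" by simp
      also have "\<dots> \<le> g * (2 * (b * s))" using zan_bound g by (intro mult_left_mono) auto
      also have "\<dots> = b * (2 * (s * g))" by simp
      also have "\<dots> \<le> b * 1" using sg b_pos by (intro mult_left_mono) auto
      finally have 1: "z * (a * m) \<le> b" by simp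
      have 2: "z * (b * s) \<le> 1 * (b * s)" using z_le_1 b_pos by (intro mult_right_mono) auto
      have "b * (2 * real s + 2) * (z * (p * n)) \<le> b * (2 * real s + 2) * 2"
        using zpn_bound b_pos by (intro mult_left_mono) auto
      then have "z * T \<le> b + b * s + b * (2 * real s + 2) * 2"
        using 1 2 by (simp add: T_def algebra_simps)
      also have "\<dots> = b * (5 + 5 * real s)" by (simp add: algebra_simps)
      also have "\<dots> \<le> b * (6 * real s + 4)" using s_pos' b_pos by (intro mult_left_mono) auto
      finally show ?thesis .
    qed
    have \<delta>0: "0 \<le> \<delta>" using p_pos XA0 by (simp add: \<delta>_def)
    \<comment> \<open>Multiplying \<open>key\<close> by \<open>T\<close> eliminates
      \<open>x u\<close> against the lower bound \<open>xu\<close>. Since \<delta> carries the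
      factor \<open>2 * p\<close> and \<open>z * T\<close> the factor \<open>b\<close>, the common
      factor \<open>b * p / 2\<close> cancels; this explains the 4 in \<open>K\<close>.\<close>
    have "(a + b * z) * (b * (p * n / 2)) \<le> (a + b * z) * (T * x u)"
      using xu q0 by (intro mult_left_mono) auto
    also have "\<dots> = T * ((a + b * z) * x u)" by simp
    also have "\<dots> \<le> T * (z * \<delta> * c2)" using key T0 by (intro mult_left_mono) auto
    also have "\<dots> = (\<delta> * c2) * (z * T)" by simp
    also have "\<dots> \<le> (\<delta> * c2) * (b * (6 * real s + 4))" using zT \<delta>0 c20 by (intro mult_left_mono) auto
    finally have "(b * p / 2) * Q \<le> (b * p / 2) * (K * (real s + 1 + XA))"
      by (simp add: Q_def \<delta>_def K c2_def algebra_simps)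
    then have Q: "Q \<le> K * (real s + 1 + XA)" using b_pos p_pos by simp
    have K0: "0 \<le> K" by (simp add: K)
    \<comment> \<open>\<open>XA\<close> may itself be of the order of \<open>Q\<close>; the
      smallness of \<open>g\<close> makes \<open>K * XA\<close> at most \<open>Q / 2\<close>, so
      that it can be absorbed.\<close>
    have "XA \<le> 2 * c1 * s * g * (2 * Q)"
    proof -
      have "2 * c1 * s * g * (p * n) \<le> 2 * c1 * s * g * (2 * Q)"
        using pn_le c1_ge g by (intro mult_left_mono) (auto simp: Q_def)
      then show ?thesis using XA_n by linarith
    qed
    then have "K * XA \<le> K * (2 * c1 * s * g * (2 * Q))" using K0 by (intro mult_left_mono) auto
    also have "\<dots> = (g * (8 * K * c1 * s)) * (Q / 2)" by simp
    also have "\<dots> \<le> 1 * (Q / 2)" using g q0 by (intro mult_right_mono) (auto simp: Q_def)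
    finally have "Q \<le> 2 * K * (s + 1)" using Q by (simp add: algebra_simps)
    then show False using order_bounded n_large(2,3) unfolding Q_def by fastforce
  qed
  then have A: "A = {}" using A_card sub by simp
  show "\<forall>u\<in>L. N u = V - {u}"
  proof
    fix u assume u: "u \<in> L"
    then have "real (card (V - {u} - N u)) \<le> 0" using card_miss[of u] m_ge[of u] \<open>m = 0\<close> L by auto
    then have "V - {u} - N u = {}" using finite_V by simp
    then show "N u = V - {u}" using N_subset[of u] N_irrefl[of u] by auto
  qed
  show "\<forall>v\<in>V - L. N v = L"
  proof
    fix v assume "v \<in> V - L"
    then have v: "v \<in> B" and VB: "V - L = B" using A by (auto simp: A_def B_def)
    have "N v \<subseteq> L" using B_ind[OF v] N_subset[of v] VB by blast
    then show "N v = L" using v by (auto simp: B_def)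
  qed
qed

end

text \<open>All constants are fixed from \<open>c\<close> and \<open>s\<close> before the graph and
  \<open>a\<close> are given, in the order in which they depend on each other: \<open>K\<close> from
  the last step determines \<open>g\<close>, and \<open>g\<close> determines the data of the
  elimination.\<close>

lemma extremal_structure:
  fixes c s :: nat
  assumes s: "1 \<le> s"
  shows "\<exists>n0. \<forall>(V :: 'a set) N a b \<rho> z x. perron_graph V N c s a b \<rho> z x \<longrightarrow> n0 \<le> card V \<longrightarrow>
    (\<forall>v\<in>V. x v \<le> 1) \<longrightarrow> (\<exists>u\<in>V. x u = 1) \<longrightarrow>
    (\<exists>L\<subseteq>V. card L = s \<and> (\<forall>u\<in>L. N u = V - {u}) \<and> (\<forall>v\<in>V - L. N v = L))"
proof -
  define c1 where "c1 = real s + 1 + real c"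
  define K where "K = 4 * ((real c + 2) * real s * (6 * real s + 4))"
  define g where "g = 1 / (32 * K * c1 * real s)"
  define k where "k = g / (1280 * (real s)\<^sup>2)"
  define M where "M = (4 * (real c + 1) / k)\<^sup>2"
  define h where "h = nat \<lceil>c * M\<rceil>"
  define C where "C = real (s * 2 ^ h * h)"
  define e where "e = h + 2 * C + (real s)\<^sup>2"
  \<comment> \<open>Merges the two smallness conditions on \<open>p\<close>: since
    \<open>p^2 * n\<close> is at most 2, an order of at least \<open>2 * W^2\<close> gives
    \<open>p * W <= 1\<close>, and each summand yields one condition.\<close>
  define W where "W = e * (384 * (real s)\<^sup>2 * (real h + 1)) / g + 8 * (real s + 1)"
  \<comment> \<open>The bound reached for \<open>(a + b * z) * n\<close> when an edge at
    \<open>L\<close> is missing; the summands of \<open>n0\<close> in \<open>K'\<close> exceed both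
    alternatives of \<open>order_bounded\<close>.\<close>
  define K' where "K' = 2 * K * (real s + 1)"
  define n0 where "n0 = nat \<lceil>2 * W\<^sup>2 + 8 * (real s + 1) + 2 * K' + 4 * K' * (K' + real s)\<rceil> + 1"
  have s1: "1 \<le> real s" using s by simp
  have c1: "1 \<le> c1" by (simp add: c1_def)
  have K1: "1 \<le> K"
  proof -
    have "1 * 1 \<le> (real c + 2) * real s" using s1 by (intro mult_mono) auto
    then have "1 * 1 \<le> ((real c + 2) * real s) * (6 * real s + 4)" using s1 by (intro mult_mono) auto
    then show ?thesis by (simp add: K_def)
  qed
  have pos: "0 < K * c1 * real s" using K1 c1 s1 by simp
  then have g0: "0 < g" by (simp add: g_def)
  have "K \<noteq> 0" "c1 \<noteq> 0" "s \<noteq> 0" using K1 c1 s by auto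
  then have gK: "g * (32 * (K * c1 * real s)) = 1" by (simp add: g_def)
  have g1: "g * (8 * K * c1 * real s) \<le> 1" using gK by simp
  have g2: "g * (32 * c1 * real s) \<le> 1"
  proof -
    have "1 * (g * (32 * c1 * real s)) \<le> K * (g * (32 * c1 * real s))"
      using K1 g0 c1 by (intro mult_right_mono) auto
    then show ?thesis using gK by (simp add: mult_ac)
  qed
  have g3: "g \<le> 1"
  proof -
    have "1 * 1 \<le> c1 * real s" using c1 s1 by (intro mult_mono) auto
    then have "g * 1 \<le> g * (32 * c1 * real s)" using g0 by (intro mult_left_mono) auto
    then show ?thesis using g2 by simp
  qed
  have e0: "0 \<le> e" by (simp add: e_def C_def)
  have W1: "1 \<le> W" unfolding W_def using e0 g0 by (simp add: add_increasing)
  have K'0: "0 \<le> K'" using K1 by (simp add: K'_def)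
  show ?thesis
  proof (intro exI[of _ n0] allI impI)
    fix V :: "'a set" and N a b \<rho> z x
    assume "perron_graph V N c s a b \<rho> z x" and n0: "n0 \<le> card V"
      and x1: "\<forall>v\<in>V. x v \<le> 1" "\<exists>u\<in>V. x u = 1"
    then interpret perron_graph V N c s a b \<rho> z x by simp
    have "2 * W\<^sup>2 + 8 * (real s + 1) + 2 * K' + 4 * K' * (K' + real s) < real n0"
      unfolding n0_def by linarith
    also have "\<dots> \<le> n" using n0 by simp
    finally have nn: "2 * W\<^sup>2 + 8 * (real s + 1) + 2 * K' + 4 * K' * (K' + real s) < n" .
    have nonneg: "0 \<le> 2 * W\<^sup>2" "0 \<le> 8 * (real s + 1)" "0 \<le> 2 * K'" "0 \<le> 4 * K' * (K' + real s)"
      using K'0 by simp_all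
    have n1: "2 * W\<^sup>2 \<le> n" and n2: "8 * (real s + 1) \<le> n" and n3: "2 * K' < n"
      and n4: "4 * K' * (K' + real s) < n"
      using nn nonneg s1 by linarith+
    have pW: "p * W \<le> 1"
    proof -
      have "p\<^sup>2 * (2 * W\<^sup>2) \<le> p\<^sup>2 * n" using n1 by (intro mult_left_mono) auto
      then have "(p * W)\<^sup>2 \<le> 1\<^sup>2" using p_square_n_le by (simp add: power_mult_distrib)
      then show ?thesis by (rule power2_le_imp_le) simp
    qed
    have split: "p * W = p * e * (384 * (real s)\<^sup>2 * (real h + 1)) / g + p * (8 * (real s + 1))"
      by (simp add: W_def algebra_simps add_divide_distrib)
    have nn1: "0 \<le> p * e * (384 * (real s)\<^sup>2 * (real h + 1)) / g" "0 \<le> p * (8 * (real s + 1))"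
      using p_pos e0 g0 by simp_all
    have "p * e * (384 * (real s)\<^sup>2 * (real h + 1)) / g \<le> 1" using pW split nn1 by linarith
    then have pe: "p * e * (384 * (real s)\<^sup>2 * (real h + 1)) \<le> g" using g0 by (simp add: field_simps)
    have ps: "p * (8 * (real s + 1)) \<le> 1" using pW split nn1 by linarith
    obtain L where L: "L \<subseteq> V" "card L = s" "\<forall>u\<in>L. n - 1 - d u \<le> g * n"
      using exists_large_degree_set[OF g0 g3 k_def M_def h_def C_def e_def pe] by blast
    obtain u1 where u1: "u1 \<in> V" "x u1 = 1" using x1 by blast
    have "2 * (2 * K * real (s + 1)) < n" "4 * (2 * K * real (s + 1)) * (2 * K * real (s + 1) + real s) < n"
      using n3 n4 by (simp_all add: K'_def add.commute)
    note few = few_missing_imp_none[OF L(1,2) _ _ u1 c1_def K_def g0 g2 g1 ps n2 this]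
    have "\<forall>u\<in>L. N u = V - {u}" "\<forall>v\<in>V - L. N v = L" using few L(3) x1(1) by blast+
    then show "\<exists>L\<subseteq>V. card L = s \<and> (\<forall>u\<in>L. N u = V - {u}) \<and> (\<forall>v\<in>V - L. N v = L)"
      using L by blast
  qed
qed

section \<open>Perron vectors of symmetric nonnegative matrices\<close>

text \<open>A quadratic without constant term that is nowhere negative has its minimum at 0, so its
  derivative vanishes there. The witness \<open>- A / D\<close> with \<open>D\<close> above
  \<open>B\<close> makes it negative otherwise.\<close>

lemma linear_term_zero:
  fixes A B :: real
  assumes "\<And>t. 0 \<le> 2 * t * A + t\<^sup>2 * B"
  shows "A = 0"
proof (rule ccontr)
  assume A: "A \<noteq> 0"
  define D where "D = \<bar>B\<bar> + 1"
  have D: "0 < D" "B < D" by (auto simp: D_def)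
  have "0 \<le> 2 * (- A / D) * A + (- A / D)\<^sup>2 * B" by (rule assms)
  also have "\<dots> = A\<^sup>2 / D * (B / D - 2)" using D by (simp add: power2_eq_square field_simps)
  finally have "0 \<le> A\<^sup>2 / D * (B / D - 2)" .
  moreover have "A\<^sup>2 / D * (B / D - 2) < 0"
  proof (rule mult_pos_neg)
    show "0 < A\<^sup>2 / D" using A D by simp
    have "B / D < 1" using D by simp
    then show "B / D - 2 < 0" by simp
  qed
  ultimately show False by linarith
qed

text \<open>Vectors are total functions; fixing them to 0 off \<open>V\<close> places the sphere in
  a product of compact intervals and singletons, where it is a closed subset.\<close>

lemma compact_unit_sphere:
  fixes V :: "'a set"
  assumes V: "finite V"
  shows "compact {f :: 'a \<Rightarrow> real. (\<forall>v. v \<notin> V \<longrightarrow> f v = 0) \<and> (\<Sum>v\<in>V. (f v)\<^sup>2) = 1}"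
    (is "compact ?S")
proof -
  define K :: "'a \<Rightarrow> real set" where "K = (\<lambda>v. if v \<in> V then {-1..1} else {0})"
  have "compactin (product_topology (\<lambda>_. euclidean) UNIV) (PiE UNIV K)"
    unfolding compactin_PiE by (auto simp: K_def)
  then have "compact (PiE UNIV K)" by (simp add: euclidean_product_topology)
  moreover have "closed {f :: 'a \<Rightarrow> real. (\<Sum>v\<in>V. (f v)\<^sup>2) = 1}"
    by (intro closed_Collect_eq continuous_intros continuous_on_product_coordinates)
  ultimately have "compact (PiE UNIV K \<inter> {f. (\<Sum>v\<in>V. (f v)\<^sup>2) = 1})" by (rule compact_Int_closed)
  moreover have "PiE UNIV K \<inter> {f. (\<Sum>v\<in>V. (f v)\<^sup>2) = 1} = ?S"
  proof (intro equalityI subsetI)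
    fix f assume f: "f \<in> ?S"
    have "f v \<in> K v" for v
    proof (cases "v \<in> V")
      case True
      then have "(f v)\<^sup>2 \<le> (\<Sum>v\<in>V. (f v)\<^sup>2)" using V by (intro member_le_sum) auto
      then have "\<bar>f v\<bar> \<le> 1" using f by (simp add: abs_square_le_1)
      then show ?thesis using True by (auto simp: K_def)
    qed (use f in \<open>auto simp: K_def\<close>)
    then show "f \<in> PiE UNIV K \<inter> {f. (\<Sum>v\<in>V. (f v)\<^sup>2) = 1}" using f by auto
  next
    fix f assume f: "f \<in> PiE UNIV K \<inter> {f. (\<Sum>v\<in>V. (f v)\<^sup>2) = 1}"
    then have "f v \<in> K v" for v by auto
    then have "f v = 0" if "v \<notin> V" for v using that by (metis K_def singletonD)
    then show "f \<in> ?S" using f by auto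
  qed
  ultimately show ?thesis by simp
qed

text \<open>A maximiser of the quadratic form on the unit sphere, taken in absolute value, is an
  eigenvector by first variation, and every real eigenvalue is a value of the Rayleigh quotient.
  Irreducibility is not assumed, hence only nonnegative entries.\<close>

lemma perron_vector_exists:
  fixes m :: "'a \<Rightarrow> 'a \<Rightarrow> real"
  assumes V: "finite V" "V \<noteq> {}" and sym: "\<And>u v. m u v = m v u" and nonneg: "\<And>u v. 0 \<le> m u v"
  shows "\<exists>\<rho> x. (\<forall>v. 0 \<le> x v) \<and> (\<forall>v\<in>V. x v \<le> 1) \<and> (\<exists>u\<in>V. x u = 1) \<and>
    (\<forall>u\<in>V. (\<Sum>v\<in>V. m u v * x v) = \<rho> * x u) \<and>
    (\<forall>k y. (\<exists>v\<in>V. y v \<noteq> 0) \<longrightarrow> (\<forall>u\<in>V. (\<Sum>v\<in>V. m u v * y v) = k * y u) \<longrightarrow> k \<le> \<rho>)"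
proof -
  define S where "S = {f :: 'a \<Rightarrow> real. (\<forall>v. v \<notin> V \<longrightarrow> f v = 0) \<and> (\<Sum>v\<in>V. (f v)\<^sup>2) = 1}"
  define q where "q = (\<lambda>f :: 'a \<Rightarrow> real. \<Sum>u\<in>V. \<Sum>v\<in>V. m u v * f u * f v)"
  define nr where "nr = (\<lambda>f :: 'a \<Rightarrow> real. \<Sum>v\<in>V. (f v)\<^sup>2)"
  obtain v0 where v0: "v0 \<in> V" using V by blast
  have "(\<Sum>v\<in>V. (if v = v0 then 1 else 0 :: real)\<^sup>2) = (\<Sum>v\<in>V. if v = v0 then 1 else 0)"
    by (intro sum.cong) auto
  then have "(\<lambda>v. if v = v0 then 1 else 0) \<in> S" using v0 V by (auto simp: S_def)
  then have "S \<noteq> {}" by blast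
  moreover have "compact S" unfolding S_def by (rule compact_unit_sphere[OF V(1)])
  moreover have "continuous_on S q"
    unfolding q_def by (intro continuous_intros continuous_on_subset[OF continuous_on_product_coordinates subset_UNIV])
  ultimately obtain f where f: "f \<in> S" "\<forall>y\<in>S. q y \<le> q f"
    using continuous_attains_sup by blast
  define \<rho> where "\<rho> = q f"
  have bound: "q y \<le> \<rho> * nr y" for y
  proof (cases "nr y = 0")
    case True
    then have "y v = 0" if "v \<in> V" for v
      using that V unfolding nr_def by (simp add: sum_nonneg_eq_0_iff)
    then have "q y = 0" by (simp add: q_def)
    then show ?thesis using True by simp
  next
    case False
    then have pos: "0 < nr y" unfolding nr_def by (simp add: order_less_le sum_nonneg)
    define r where "r = sqrt (nr y)"
    have r: "r\<^sup>2 = nr y" "0 < r" using pos by (simp_all add: r_def)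
    define w where "w = (\<lambda>v. if v \<in> V then y v / r else 0)"
    have "(\<Sum>v\<in>V. (w v)\<^sup>2) = (\<Sum>v\<in>V. (y v)\<^sup>2 / nr y)"
      by (intro sum.cong) (auto simp: w_def power_divide r)
    also have "\<dots> = 1" using pos by (simp add: nr_def flip: sum_divide_distrib)
    finally have "w \<in> S" by (simp add: S_def w_def)
    then have "q w \<le> \<rho>" using f by (simp add: \<rho>_def)
    moreover have "q w = q y / nr y"
      unfolding q_def sum_divide_distrib
      by (intro sum.cong HOL.refl) (auto simp: w_def r(1)[symmetric] power2_eq_square)
    ultimately show ?thesis using pos by (simp add: field_simps)
  qed
  define x0 where "x0 = (\<lambda>v. \<bar>f v\<bar>)"
  have nr0: "nr x0 = 1" using f by (simp add: nr_def x0_def S_def)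
  have "q f \<le> q x0"
    unfolding q_def
  proof (intro sum_mono)
    fix u v
    have "m u v * (f u * f v) \<le> m u v * \<bar>f u * f v\<bar>" using nonneg by (intro mult_left_mono) auto
    then show "m u v * f u * f v \<le> m u v * x0 u * x0 v" by (simp add: x0_def abs_mult mult.assoc)
  qed
  then have q0: "q x0 = \<rho> * nr x0" using bound[of x0] nr0 by (simp add: \<rho>_def)
  have eig0: "(\<Sum>v\<in>V. m u v * x0 v) = \<rho> * x0 u" if u: "u \<in> V" for u
  proof -
    define A where "A = \<rho> * x0 u - (\<Sum>v\<in>V. m u v * x0 v)"
    \<comment> \<open>First variation in the coordinate \<open>u\<close>: the right side is
      \<open>\<rho>\<close> times the square norm of the perturbed vector minus its form. Symmetry
      of \<open>m\<close> merges the two mixed sums into the factor 2.\<close>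
    have "0 \<le> 2 * t * A + t\<^sup>2 * (\<rho> - m u u)" for t
    proof -
      define y where "y = (\<lambda>v. x0 v + t * (if v = u then 1 else 0))"
      have ind: "(\<Sum>v\<in>V. h v * (if v = u then 1 else 0)) = h u" for h :: "'a \<Rightarrow> real"
        using u V by (simp add: if_distrib cong: if_cong)
      have "nr y = (\<Sum>v\<in>V. (x0 v)\<^sup>2 + (2 * t * x0 v + t\<^sup>2) * (if v = u then 1 else 0))"
        unfolding nr_def y_def by (intro sum.cong) (auto simp: power2_eq_square algebra_simps)
      then have nry: "nr y = nr x0 + 2 * t * x0 u + t\<^sup>2"
        by (simp only: sum.distrib ind nr_def)
      define i where "i = (\<lambda>v. if v = u then 1 else 0 :: real)"
      have i: "(\<Sum>v\<in>V. h v * i v) = h u" for h :: "'a \<Rightarrow> real"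
        unfolding i_def by (rule ind)
      have "m w v * y w * y v = m w v * x0 w * x0 v + (t * m w v * x0 w) * i v +
          (t * m w v * x0 v + (t\<^sup>2 * m w v) * i v) * i w" for w v
      proof -
        have "y w = x0 w + t * i w" "y v = x0 v + t * i v" by (simp_all add: y_def i_def)
        then show ?thesis by (simp add: power2_eq_square algebra_simps)
      qed
      then have "q y = (\<Sum>w\<in>V. (\<Sum>v\<in>V. m w v * x0 w * x0 v) + (\<Sum>v\<in>V. (t * m w v * x0 w) * i v) +
          (\<Sum>v\<in>V. t * m w v * x0 v + (t\<^sup>2 * m w v) * i v) * i w)"
        by (simp only: q_def sum.distrib sum_distrib_right[symmetric])
      also have "\<dots> = q x0 + (\<Sum>w\<in>V. t * m w u * x0 w) + ((\<Sum>v\<in>V. t * m u v * x0 v) + t\<^sup>2 * m u u)"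
        by (simp only: sum.distrib i q_def)
      also have "(\<Sum>w\<in>V. t * m w u * x0 w) = t * (\<Sum>v\<in>V. m u v * x0 v)"
        unfolding sum_distrib_left
      proof (rule sum.cong[OF HOL.refl])
        fix v
        show "t * m v u * x0 v = t * (m u v * x0 v)" using sym[of v u] by simp
      qed
      also have "(\<Sum>v\<in>V. t * m u v * x0 v) = t * (\<Sum>v\<in>V. m u v * x0 v)"
        unfolding sum_distrib_left by (intro sum.cong HOL.refl) simp
      finally have "q y = q x0 + 2 * t * (\<Sum>v\<in>V. m u v * x0 v) + t\<^sup>2 * m u u" by simp
      then show ?thesis using bound[of y] q0 nry by (simp add: A_def algebra_simps)
    qed
    then have "A = 0" by (rule linear_term_zero)
    then show ?thesis by (simp add: A_def)
  qed
  define \<mu> where "\<mu> = Max (x0 ` V)"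
  have "\<mu> \<in> x0 ` V" unfolding \<mu>_def using V by (intro Max_in) auto
  then obtain u where u: "u \<in> V" "x0 u = \<mu>" by blast
  have le: "x0 v \<le> \<mu>" if "v \<in> V" for v using that V by (simp add: \<mu>_def)
  have "\<mu> \<noteq> 0"
  proof
    assume "\<mu> = 0"
    then have "x0 v = 0" if "v \<in> V" for v using le[OF that] by (simp add: x0_def)
    then show False using nr0 by (simp add: nr_def)
  qed
  then have \<mu>: "0 < \<mu>" using u by (auto simp: x0_def)
  show ?thesis
  proof (intro exI[of _ \<rho>] exI[of _ "\<lambda>v. x0 v / \<mu>"] conjI allI impI)
    show "0 \<le> x0 v / \<mu>" for v using \<mu> by (simp add: x0_def)
    show "\<forall>v\<in>V. x0 v / \<mu> \<le> 1" using le \<mu> by simp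
    show "\<exists>u\<in>V. x0 u / \<mu> = 1" using u \<mu> by auto
    show "\<forall>u\<in>V. (\<Sum>v\<in>V. m u v * (x0 v / \<mu>)) = \<rho> * (x0 u / \<mu>)"
      using eig0 by (simp flip: sum_divide_distrib)
    fix k y
    assume y: "\<exists>v\<in>V. y v \<noteq> 0" and eig: "\<forall>u\<in>V. (\<Sum>v\<in>V. m u v * y v) = k * y u"
    have "q y = (\<Sum>u\<in>V. y u * (\<Sum>v\<in>V. m u v * y v))"
      by (simp add: q_def sum_distrib_left mult_ac)
    also have "\<dots> = (\<Sum>u\<in>V. y u * (k * y u))" using eig by (intro sum.cong) auto
    also have "\<dots> = k * nr y" by (simp add: nr_def sum_distrib_left power2_eq_square mult_ac)
    finally have "k * nr y \<le> \<rho> * nr y" using bound[of y] by simp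
    moreover have "0 < nr y"
    proof -
      obtain v where "v \<in> V" "y v \<noteq> 0" using y by blast
      then show ?thesis unfolding nr_def using V by (intro sum_pos2[of V v]) auto
    qed
    ultimately show "k \<le> \<rho>" by simp
  qed
qed

section \<open>The \<open>\<alpha>\<close>-index\<close>

text \<open>Needed for \<open>Max\<close> in \<open>alpha_index\<close> to be meaningful:
  eigenvalues are roots of a monic polynomial.\<close>

lemma finite_eigenvalues: "finite {k. eigenvalue (alpha_matrix \<alpha> G) k}"
proof -
  have A: "alpha_matrix \<alpha> G \<in> carrier_mat (graph_order G) (graph_order G)"
    by (simp add: alpha_matrix_def degree_matrix_def adjacency_matrix_def)
  have "char_poly (alpha_matrix \<alpha> G) \<noteq> 0" using degree_monic_char_poly[OF A] by auto
  then show ?thesis unfolding eigenvalue_root_char_poly[OF A] by (rule poly_roots_finite)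
qed

lemma eigenvalue_iff_neighbours:
  assumes "simple_graph G"
  shows "eigenvalue (alpha_matrix \<alpha> G) k \<longleftrightarrow> (\<exists>x. (\<exists>v\<in>uverts G. x v \<noteq> 0) \<and>
    (\<forall>u\<in>uverts G. \<alpha> * card (neighbours G u) * x u + (1 - \<alpha>) * (\<Sum>v\<in>neighbours G u. x v) = k * x u))"
  using eigenvalue_alpha_matrix_iff[OF simple_graph_finite(1)[OF assms]]
  by (simp add: vertex_degree_def neighbours_def)

lemma alpha_index_perron_vector:
  assumes G: "simple_graph G" "uverts G \<noteq> {}" and \<alpha>: "0 \<le> \<alpha>" "\<alpha> \<le> 1"
  obtains x where "\<And>v. 0 \<le> x v" "\<forall>v\<in>uverts G. x v \<le> 1" "\<exists>u\<in>uverts G. x u = 1"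
    "\<And>u. u \<in> uverts G \<Longrightarrow> alpha_index \<alpha> G * x u =
      \<alpha> * card (neighbours G u) * x u + (1 - \<alpha>) * (\<Sum>v\<in>neighbours G u. x v)"
proof -
  define V where "V = uverts G"
  \<comment> \<open>The entries of \<open>alpha_matrix\<close>, indexed by vertices instead of list
    positions.\<close>
  define m where "m = (\<lambda>u v. \<alpha> * card (neighbours G u) * (if v = u then 1 else 0) +
    (1 - \<alpha>) * (if v \<in> neighbours G u then 1 else 0))"
  have fV: "finite V" using simple_graph_finite(1)[OF G(1)] by (simp add: V_def)
  have sub: "neighbours G u \<subseteq> V" for u by (auto simp: neighbours_def V_def)
  have row: "(\<Sum>v\<in>V. m u v * y v) = \<alpha> * card (neighbours G u) * y u + (1 - \<alpha>) * (\<Sum>v\<in>neighbours G u. y v)"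
    if u: "u \<in> V" for u y
  proof -
    have "(\<Sum>v\<in>V. m u v * y v) = (\<Sum>v\<in>V. if v = u then \<alpha> * card (neighbours G u) * y u else 0) +
        (1 - \<alpha>) * (\<Sum>v\<in>V. if v \<in> neighbours G u then y v else 0)"
      unfolding sum_distrib_left sum.distrib[symmetric] by (intro sum.cong) (auto simp: m_def algebra_simps)
    also have "(\<Sum>v\<in>V. if v \<in> neighbours G u then y v else 0) = (\<Sum>v\<in>V \<inter> neighbours G u. y v)"
      using fV by (simp add: sum.inter_restrict)
    also have "V \<inter> neighbours G u = neighbours G u" using sub by auto
    finally show ?thesis using u fV by simp
  qed
  have m_sym: "m u v = m v u" for u v using neighbours_sym[OF G(1), of u v] by (simp add: m_def)
  have m_nonneg: "0 \<le> m u v" for u v using \<alpha> by (simp add: m_def)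
  have "V \<noteq> {}" using G(2) by (simp add: V_def)
  obtain \<rho> x where *: "(\<forall>v. 0 \<le> x v) \<and> (\<forall>v\<in>V. x v \<le> 1) \<and> (\<exists>u\<in>V. x u = 1) \<and>
    (\<forall>u\<in>V. (\<Sum>v\<in>V. m u v * x v) = \<rho> * x u) \<and>
    (\<forall>k y. (\<exists>v\<in>V. y v \<noteq> 0) \<longrightarrow> (\<forall>u\<in>V. (\<Sum>v\<in>V. m u v * y v) = k * y u) \<longrightarrow> k \<le> \<rho>)"
    using perron_vector_exists[of V m, OF fV \<open>V \<noteq> {}\<close> m_sym m_nonneg] by (elim exE)
  then have x: "\<forall>v. 0 \<le> x v" "\<forall>v\<in>V. x v \<le> 1" "\<exists>u\<in>V. x u = 1"
    "\<forall>u\<in>V. (\<Sum>v\<in>V. m u v * x v) = \<rho> * x u"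
    "\<forall>k y. (\<exists>v\<in>V. y v \<noteq> 0) \<longrightarrow> (\<forall>u\<in>V. (\<Sum>v\<in>V. m u v * y v) = k * y u) \<longrightarrow> k \<le> \<rho>"
    by - (elim conjE, assumption)+
  have "alpha_index \<alpha> G = \<rho>"
    unfolding alpha_index_def
  proof (rule Max_eqI[OF finite_eigenvalues])
    fix k assume "k \<in> {k. eigenvalue (alpha_matrix \<alpha> G) k}"
    then obtain y where y: "\<exists>v\<in>V. y v \<noteq> 0"
      "\<forall>u\<in>V. \<alpha> * card (neighbours G u) * y u + (1 - \<alpha>) * (\<Sum>v\<in>neighbours G u. y v) = k * y u"
      unfolding mem_Collect_eq eigenvalue_iff_neighbours[OF G(1)] V_def[symmetric] by blast
    have "\<forall>u\<in>V. (\<Sum>v\<in>V. m u v * y v) = k * y u" using y(2) row by simp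
    then show "k \<le> \<rho>" using x(5)[THEN spec, THEN spec, THEN mp, THEN mp, OF y(1)] by simp
  next
    have "\<exists>v\<in>V. x v \<noteq> 0" using x(3) by force
    moreover have "\<forall>u\<in>V. \<alpha> * card (neighbours G u) * x u + (1 - \<alpha>) * (\<Sum>v\<in>neighbours G u. x v) = \<rho> * x u"
      using x(4) row by simp
    ultimately show "\<rho> \<in> {k. eigenvalue (alpha_matrix \<alpha> G) k}"
      unfolding mem_Collect_eq eigenvalue_iff_neighbours[OF G(1)] V_def[symmetric] by blast
  qed
  then show thesis
    using x(1-3) x(4) row by (intro that[of x]) (simp_all add: V_def)
qed

lemma graph_iso_sym:
  assumes "graph_iso G H"
  shows "graph_iso H G"
proof -
  obtain f where f: "bij_betw f (uverts G) (uverts H)"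
    "\<forall>u\<in>uverts G. \<forall>v\<in>uverts G. {u, v} \<in> uedges G \<longleftrightarrow> {f u, f v} \<in> uedges H"
    using assms unfolding graph_iso_def by blast
  define g where "g = the_inv_into (uverts G) f"
  have g: "bij_betw g (uverts H) (uverts G)" unfolding g_def by (rule bij_betw_the_inv_into[OF f(1)])
  have gG: "g u \<in> uverts G" "f (g u) = u" if "u \<in> uverts H" for u
    using that g f_the_inv_into_f_bij_betw[OF f(1)] bij_betw_apply[OF g] by (auto simp: g_def)
  have "\<forall>u\<in>uverts H. \<forall>v\<in>uverts H. {u, v} \<in> uedges H \<longleftrightarrow> {g u, g v} \<in> uedges G"
    using f(2) gG by simp
  then show ?thesis using g unfolding graph_iso_def by blast
qed

lemma graph_iso_eigenvalue:
  assumes iso: "graph_iso G H" and GH: "simple_graph G" "simple_graph H"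
    and k: "eigenvalue (alpha_matrix \<alpha> H) k"
  shows "eigenvalue (alpha_matrix \<alpha> G) k"
proof -
  obtain f where f: "bij_betw f (uverts G) (uverts H)"
    "\<forall>u\<in>uverts G. \<forall>v\<in>uverts G. {u, v} \<in> uedges G \<longleftrightarrow> {f u, f v} \<in> uedges H"
    using iso unfolding graph_iso_def by blast
  obtain y where y: "\<exists>v\<in>uverts H. y v \<noteq> 0"
    "\<forall>u\<in>uverts H. \<alpha> * card (neighbours H u) * y u + (1 - \<alpha>) * (\<Sum>v\<in>neighbours H u. y v) = k * y u"
    using k unfolding eigenvalue_iff_neighbours[OF GH(2)] by blast
  have im: "f ` uverts G = uverts H" and inj: "inj_on f (uverts G)"
    using f(1) by (auto simp: bij_betw_def)
  have nb: "bij_betw f (neighbours G u) (neighbours H (f u))" if u: "u \<in> uverts G" for u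
  proof -
    have "f ` neighbours G u = neighbours H (f u)"
    proof
      show "f ` neighbours G u \<subseteq> neighbours H (f u)" using f(2) u im by (auto simp: neighbours_def)
      show "neighbours H (f u) \<subseteq> f ` neighbours G u"
      proof
        fix w assume w: "w \<in> neighbours H (f u)"
        then obtain v where "v \<in> uverts G" "w = f v" using im by (auto simp: neighbours_def)
        then show "w \<in> f ` neighbours G u" using w f(2) u by (auto simp: neighbours_def)
      qed
    qed
    moreover have "inj_on f (neighbours G u)"
      using inj by (rule inj_on_subset) (auto simp: neighbours_def)
    ultimately show ?thesis by (simp add: bij_betw_def)
  qed
  show ?thesis
    unfolding eigenvalue_iff_neighbours[OF GH(1)]
  proof (intro exI[of _ "\<lambda>v. y (f v)"] conjI ballI)
    show "\<exists>v\<in>uverts G. y (f v) \<noteq> 0" using y(1) unfolding im[symmetric] by simp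
    fix u assume u: "u \<in> uverts G"
    have "f u \<in> uverts H" using u im by blast
    then have "\<alpha> * card (neighbours H (f u)) * y (f u) + (1 - \<alpha>) * (\<Sum>v\<in>neighbours H (f u). y v) = k * y (f u)"
      using y(2) by blast
    then show "\<alpha> * card (neighbours G u) * y (f u) + (1 - \<alpha>) * (\<Sum>v\<in>neighbours G u. y (f v)) = k * y (f u)"
      using sum.reindex_bij_betw[OF nb[OF u], of y] bij_betw_same_card[OF nb[OF u]] by simp
  qed
qed

lemma graph_iso_alpha_index:
  assumes "graph_iso G H" "simple_graph G" "simple_graph H"
  shows "alpha_index \<alpha> G = alpha_index \<alpha> H"
proof -
  have "eigenvalue (alpha_matrix \<alpha> G) k \<longleftrightarrow> eigenvalue (alpha_matrix \<alpha> H) k" for k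
    using graph_iso_eigenvalue[OF assms] graph_iso_eigenvalue[OF graph_iso_sym[OF assms(1)] assms(3,2)]
    by blast
  then show ?thesis by (simp add: alpha_index_def)
qed

section \<open>The extremal graph\<close>

definition extremal_graph :: "nat \<Rightarrow> nat \<Rightarrow> nat ugraph" where
  "extremal_graph s n = graph_join (complete_graph {..<s}) (graph_complement (complete_graph {s..<n}))"

lemma extremal_graph_verts: "s \<le> n \<Longrightarrow> uverts (extremal_graph s n) = {..<n}"
  by (auto simp: extremal_graph_def graph_join_def complete_graph_def graph_complement_def)

lemma extremal_graph_edge_iff:
  assumes "s \<le> n"
  shows "{u, v} \<in> uedges (extremal_graph s n) \<longleftrightarrow> u < n \<and> v < n \<and> u \<noteq> v \<and> (u < s \<or> v < s)"
proof -
  have E: "uedges (extremal_graph s n) =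
      {e. e \<subseteq> {..<s} \<and> card e = 2} \<union> {{u, v} | u v. u < s \<and> s \<le> v \<and> v < n}"
    by (auto simp: extremal_graph_def graph_join_def complete_graph_def graph_complement_def)
  show ?thesis using assms unfolding E by (auto simp: card_insert_if doubleton_eq_iff split: if_splits) (metis not_less)+
qed

lemma extremal_graph_simple:
  assumes "s \<le> n"
  shows "simple_graph (extremal_graph s n)"
proof -
  have "e \<subseteq> {..<n} \<and> card e = 2" if "e \<in> uedges (extremal_graph s n)" for e
    using that assms
    by (auto simp: extremal_graph_def graph_join_def complete_graph_def graph_complement_def card_insert_if)
  then show ?thesis using extremal_graph_verts[OF assms] by (simp add: simple_graph_def)
qed

lemma extremal_graph_neighbours:
  assumes "s \<le> n" "u < n"
  shows "neighbours (extremal_graph s n) u = (if u < s then {..<n} - {u} else {..<s})"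
  using assms by (auto simp: neighbours_def extremal_graph_verts extremal_graph_edge_iff)

text \<open>The vector with entries 1 on the clique and \<open>z\<close> off it is an eigenvector:
  clique rows define the eigenvalue, and the other rows are the equation for \<open>z\<close>. For a
  lower bound it suffices that this is some eigenvalue.\<close>

lemma extremal_graph_eigenvalue:
  fixes z :: real
  assumes sn: "1 \<le> s" "s < n"
    and z: "z * (\<alpha> * (real n - 1) + (1 - \<alpha>) * (real s - 1) + (1 - \<alpha>) * (real n - real s) * z - \<alpha> * real s) = (1 - \<alpha>) * real s"
  shows "\<alpha> * (real n - 1) + (1 - \<alpha>) * (real s - 1) + (1 - \<alpha>) * (real n - real s) * z \<le>
    alpha_index \<alpha> (extremal_graph s n)"
proof -
  define l where "l = \<alpha> * (real n - 1) + (1 - \<alpha>) * (real s - 1) + (1 - \<alpha>) * (real n - real s) * z"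
  define y where "y = (\<lambda>v. if v < s then 1 else z)"
  have sn': "s \<le> n" using sn by simp
  note nb = extremal_graph_neighbours[OF sn']
  have tot: "(\<Sum>v<n. y v) = real s + (real n - real s) * z"
  proof -
    have "{..<n} = {..<s} \<union> {s..<n}" using sn by auto
    then have "(\<Sum>v<n. y v) = (\<Sum>v<s. y v) + (\<Sum>v=s..<n. y v)"
      by (metis finite_atLeastLessThan finite_lessThan ivl_disj_int_one(2) sum.union_disjoint)
    also have "(\<Sum>v<s. y v) = (\<Sum>v<s. 1)" by (intro sum.cong) (auto simp: y_def)
    also have "(\<Sum>v=s..<n. y v) = (\<Sum>v=s..<n. z)" by (intro sum.cong) (auto simp: y_def)
    finally show ?thesis using sn by (simp add: of_nat_diff)
  qed
  have "\<exists>v\<in>{..<n}. y v \<noteq> 0" using sn by (intro bexI[of _ 0]) (auto simp: y_def)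
  moreover have "\<alpha> * card (neighbours (extremal_graph s n) u) * y u +
      (1 - \<alpha>) * (\<Sum>v\<in>neighbours (extremal_graph s n) u. y v) = l * y u" if u: "u < n" for u
  proof (cases "u < s")
    case True
    have sum_nb: "(\<Sum>v\<in>{..<n} - {u}. y v) = (\<Sum>v<n. y v) - y u" using u by (simp add: sum_diff1)
    have card_nb: "real (card ({..<n} - {u})) = real n - 1" using u by (simp add: of_nat_diff)
    have yu: "y u = 1" using True by (simp add: y_def)
    have nbu: "neighbours (extremal_graph s n) u = {..<n} - {u}" using nb[OF u] True by simp
    show ?thesis unfolding nbu card_nb sum_nb tot yu l_def by (simp add: algebra_simps)
  next
    case False
    have "(\<Sum>v<s. y v) = (\<Sum>v<s. 1)" by (intro sum.cong) (auto simp: y_def)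
    then have "(\<Sum>v<s. y v) = real s" by simp
    moreover have "l * z = \<alpha> * real s * z + (1 - \<alpha>) * real s" using z by (simp add: l_def algebra_simps)
    ultimately show ?thesis using False by (simp add: nb[OF u] y_def)
  qed
  ultimately have "eigenvalue (alpha_matrix \<alpha> (extremal_graph s n)) l"
    unfolding eigenvalue_iff_neighbours[OF extremal_graph_simple[OF sn']] extremal_graph_verts[OF sn']
    by blast
  then show ?thesis
    unfolding alpha_index_def l_def[symmetric] by (intro Max_ge finite_eigenvalues) simp
qed

lemma graph_iso_extremal:
  assumes G: "simple_graph G" and n: "card (uverts G) = n" and L: "L \<subseteq> uverts G" "card L = s" "s \<le> n"
    and nb: "\<forall>u\<in>L. neighbours G u = uverts G - {u}" "\<forall>v\<in>uverts G - L. neighbours G v = L"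
  shows "graph_iso G (extremal_graph s n)"
proof -
  have fin: "finite (uverts G)" "finite L" using simple_graph_finite[OF G] L finite_subset by auto
  obtain f1 where f1: "bij_betw f1 L {..<s}"
    using finite_same_card_bij[of L "{..<s}"] fin L by auto
  have "card (uverts G - L) = card {s..<n}" using fin L n by (simp add: card_Diff_subset)
  then obtain f2 where f2: "bij_betw f2 (uverts G - L) {s..<n}"
    using finite_same_card_bij[of "uverts G - L" "{s..<n}"] fin by auto
  define f where "f = (\<lambda>v. if v \<in> L then f1 v else f2 v)"
  have "bij_betw f L {..<s}" using f1 by (rule bij_betw_cong[THEN iffD1, rotated]) (simp add: f_def)
  moreover have "bij_betw f (uverts G - L) {s..<n}"
    using f2 by (rule bij_betw_cong[THEN iffD1, rotated]) (simp add: f_def)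
  ultimately have "bij_betw f (L \<union> (uverts G - L)) ({..<s} \<union> {s..<n})"
    by (rule bij_betw_combine) auto
  moreover have "L \<union> (uverts G - L) = uverts G" "{..<s} \<union> {s..<n} = {..<n}" using L by auto
  ultimately have f: "bij_betw f (uverts G) {..<n}" by simp
  have fs: "f v < s \<longleftrightarrow> v \<in> L" if "v \<in> uverts G" for v
  proof (cases "v \<in> L")
    case True
    then show ?thesis using bij_betw_apply[OF f1 True] by (simp add: f_def)
  next
    case False
    then have "f2 v \<in> {s..<n}" using bij_betw_apply[OF f2] that by blast
    then show ?thesis using False by (simp add: f_def)
  qed
  show ?thesis
    unfolding graph_iso_def
  proof (intro exI[of _ f] conjI ballI)
    show "bij_betw f (uverts G) (uverts (extremal_graph s n))"
      using f extremal_graph_verts[OF L(3)] by simp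
    fix u v assume uv: "u \<in> uverts G" "v \<in> uverts G"
    have "f u < n" "f v < n" using uv bij_betw_apply[OF f] by blast+
    moreover have "f u = f v \<longleftrightarrow> u = v" using uv f by (auto simp: bij_betw_def inj_on_def)
    moreover have "{u, v} \<in> uedges G \<longleftrightarrow> u \<noteq> v \<and> (u \<in> L \<or> v \<in> L)"
    proof (cases "u \<in> L")
      case True
      then have "v \<in> neighbours G u \<longleftrightarrow> v \<noteq> u" using nb(1) uv by blast
      then show ?thesis using True edge_in_neighbours_iff[OF G] by blast
    next
      case False
      then have "v \<in> neighbours G u \<longleftrightarrow> v \<in> L" using nb(2) uv by blast
      then show ?thesis using False edge_in_neighbours_iff[OF G] by blast
    qed
    ultimately show "{u, v} \<in> uedges G \<longleftrightarrow> {f u, f v} \<in> uedges (extremal_graph s n)"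
      using fs uv extremal_graph_edge_iff[OF L(3)] by simp
  qed
qed

text \<open>Intermediate values on the unit interval replace solving the quadratic: the left side is
  0 at 0 and at least \<open>b * s\<close> at 1. This also yields \<open>z <= 1\<close>, needed for
  the test vector.\<close>

lemma extremal_root_exists:
  fixes a b n s :: real
  assumes "0 < a" "0 < b" "1 \<le> s" "s + 1 \<le> n"
  obtains z where "0 < z" "z \<le> 1" "z * (a * (n - 1) + b * (s - 1) + b * (n - s) * z - a * s) = b * s"
proof -
  define f where "f = (\<lambda>z. z * (a * (n - 1) + b * (s - 1) + b * (n - s) * z - a * s))"
  have bs: "0 < b * s" using assms by simp
  have "0 \<le> a * (n - 1 - s)" "0 \<le> b * (n - 1 - s)" using assms by simp_all
  then have "b * s \<le> f 1" by (simp add: f_def algebra_simps)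
  moreover have "f 0 \<le> b * s" using bs by (simp add: f_def)
  moreover have "continuous_on {0..1} f" unfolding f_def by (intro continuous_intros)
  ultimately obtain z where z: "0 \<le> z" "z \<le> 1" "f z = b * s" using IVT'[of f 0 "b * s" 1] by auto
  moreover have "z \<noteq> 0" using z(3) bs by (auto simp: f_def)
  ultimately show thesis using that[of z] by (simp add: f_def)
qed

lemma sparse_graph_neighbours:
  assumes G: "simple_graph G" and nm: "\<not> has_clique_minor (s + 2) G" and s: "1 \<le> s"
  shows "sparse_graph (uverts G) (neighbours G) (2 ^ Suc s) s"
proof
  have fin: "finite S" if "S \<subseteq> uverts G" for S using that simple_graph_finite[OF G] finite_subset by blast
  note ed = edge_in_neighbours_iff[OF G]
  show "finite (uverts G)" by (rule simple_graph_finite(1)[OF G])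
  show "neighbours G v \<subseteq> uverts G" for v by (auto simp: neighbours_def)
  show "w \<in> neighbours G v \<longleftrightarrow> v \<in> neighbours G w" for v w by (rule neighbours_sym[OF G])
  show "v \<notin> neighbours G v" for v using simple_graph_edgeD(3)[OF G, of v v] ed by auto
  show "(\<Sum>v\<in>S. card (neighbours G v \<inter> S)) \<le> 2 ^ Suc s * card S" if "S \<subseteq> uverts G" for S
    by (rule degree_sum_less[OF G nm that])
  show "1 \<le> s" by (rule s)
  fix L B v assume L: "L \<subseteq> uverts G" and B: "B \<subseteq> uverts G" and LB: "L \<inter> B = {}"
    and sub: "\<forall>l\<in>L. B \<subseteq> neighbours G l"
  have E: "\<forall>l\<in>L. \<forall>b\<in>B. {l, b} \<in> uedges G" using sub ed by blast
  show "card B \<le> s" if "card L = Suc s"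
    by (rule no_complete_bipartite[OF G nm fin[OF L] fin[OF B] L B LB that E])
  assume cL: "card L = s" and cB: "s + 2 \<le> card B"
  show "neighbours G v \<inter> B = {}" if "v \<in> B"
    using common_neighbours_independent[OF G nm fin[OF L] fin[OF B] L B LB cL E cB that] ed by blast
  show "card (neighbours G v \<inter> B) \<le> 1" if "v \<in> uverts G - L - B"
  proof -
    have "b = b'" if "b \<in> neighbours G v \<inter> B" "b' \<in> neighbours G v \<inter> B" for b b'
      using outside_neighbour_unique[OF G nm fin[OF L] fin[OF B] L B LB cL E cB, of v b b']
        that \<open>v \<in> uverts G - L - B\<close> ed by blast
    then show ?thesis using fin[OF B] by (simp add: card_le_Suc0_iff_eq)
  qed
qed

theorem theorem1p1:
  fixes r :: nat
  assumes "r \<ge> 3"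
  shows "\<exists>N. \<forall>n\<ge>N. \<forall>G :: 'a ugraph.
    simple_graph G \<and> graph_order G = n \<and> minor_free (complete_graph {..<r}) G \<longrightarrow>
    (\<forall>\<alpha>::real. 0 < \<alpha> \<and> \<alpha> < 1 \<longrightarrow>
      (let K = graph_join (complete_graph {..<r - 2})
                 (graph_complement (complete_graph {r - 2..<n}))
       in alpha_index \<alpha> G \<le> alpha_index \<alpha> K \<and>
          (alpha_index \<alpha> G = alpha_index \<alpha> K \<longleftrightarrow> graph_iso G K)))"
proof -
  define s where "s = r - 2"
  have s: "1 \<le> s" "r = s + 2" using assms by (auto simp: s_def)
  obtain n0 where n0: "\<forall>(V :: 'a set) N a b \<rho> z x. perron_graph V N (2 ^ Suc s) s a b \<rho> z x \<longrightarrow>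
      n0 \<le> card V \<longrightarrow> (\<forall>v\<in>V. x v \<le> 1) \<longrightarrow> (\<exists>u\<in>V. x u = 1) \<longrightarrow>
      (\<exists>L\<subseteq>V. card L = s \<and> (\<forall>u\<in>L. N u = V - {u}) \<and> (\<forall>v\<in>V - L. N v = L))"
    using extremal_structure[OF s(1), of "2 ^ Suc s"] by (rule exE)
  \<comment> \<open>The premise is an inequality, not equality, so that this one implication yields
    both claims.\<close>
  have iso: "graph_iso G (extremal_graph s n)"
    if n: "max n0 (4 * (s + 1)) \<le> n" and G: "simple_graph G" "graph_order G = n"
      "minor_free (complete_graph {..<r}) G" and \<alpha>: "0 < \<alpha>" "\<alpha> < 1"
      and le: "alpha_index \<alpha> (extremal_graph s n) \<le> alpha_index \<alpha> G"
    for n and G :: "'a ugraph" and \<alpha> :: real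
  proof -
    have card_V: "card (uverts G) = n" using G(2) by (simp add: graph_order_def)
    have V: "uverts G \<noteq> {}" using card_V n by auto
    have nm: "\<not> has_clique_minor (s + 2) G" using minor_free_no_clique_minor[OF G(3)] s by simp
    have sn: "4 * (s + 1) \<le> n" using n by simp
    then have "real (s + 1) \<le> real n" by (intro of_nat_mono) simp
    then have "real s + 1 \<le> real n" by simp
    then obtain z where z: "0 < z" "z \<le> 1"
      "z * (\<alpha> * (real n - 1) + (1 - \<alpha>) * (real s - 1) + (1 - \<alpha>) * (real n - real s) * z - \<alpha> * real s) = (1 - \<alpha>) * real s"
      using extremal_root_exists[of \<alpha> "1 - \<alpha>" "real s" "real n"] \<alpha> s(1) by auto
    obtain x where x: "\<And>v. 0 \<le> x v" "\<forall>v\<in>uverts G. x v \<le> 1" "\<exists>u\<in>uverts G. x u = 1"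
      "\<And>u. u \<in> uverts G \<Longrightarrow> alpha_index \<alpha> G * x u =
        \<alpha> * card (neighbours G u) * x u + (1 - \<alpha>) * (\<Sum>v\<in>neighbours G u. x v)"
      using alpha_index_perron_vector[OF G(1) V, of \<alpha>] \<alpha> by auto
    have "perron_graph (uverts G) (neighbours G) (2 ^ Suc s) s \<alpha> (1 - \<alpha>) (alpha_index \<alpha> G) z x"
    proof (intro perron_graph.intro perron_graph_axioms.intro)
      show "sparse_graph (uverts G) (neighbours G) (2 ^ Suc s) s"
        by (rule sparse_graph_neighbours[OF G(1) nm s(1)])
      show "\<exists>v\<in>uverts G. x v \<noteq> 0" using x(3) by force
      show "\<alpha> * (real (card (uverts G)) - 1) + (1 - \<alpha>) * (real s - 1) + (1 - \<alpha>) * (real (card (uverts G)) - real s) * z \<le> alpha_index \<alpha> G"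
        unfolding card_V using extremal_graph_eigenvalue[OF s(1) _ z(3)] sn le by simp
    qed (use \<alpha> x z sn card_V in auto)
    moreover have "n0 \<le> card (uverts G)" using n card_V by simp
    ultimately have "\<exists>L\<subseteq>uverts G. card L = s \<and> (\<forall>u\<in>L. neighbours G u = uverts G - {u}) \<and>
        (\<forall>v\<in>uverts G - L. neighbours G v = L)"
      using n0[THEN spec, THEN spec, THEN spec, THEN spec, THEN spec, THEN spec, THEN spec, THEN mp, THEN mp, THEN mp, THEN mp, OF _ _ x(2,3)]
      by simp
    then obtain L where "L \<subseteq> uverts G" "card L = s" "\<forall>u\<in>L. neighbours G u = uverts G - {u}"
      "\<forall>v\<in>uverts G - L. neighbours G v = L"
      by blast
    then show ?thesis using sn by (intro graph_iso_extremal[OF G(1) card_V]) auto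
  qed
  show ?thesis
  proof (intro exI[of _ "max n0 (4 * (s + 1))"] allI impI)
    fix n and G :: "'a ugraph" and \<alpha> :: real
    assume n: "max n0 (4 * (s + 1)) \<le> n"
      and G: "simple_graph G \<and> graph_order G = n \<and> minor_free (complete_graph {..<r}) G"
      and \<alpha>: "0 < \<alpha> \<and> \<alpha> < 1"
    have sn: "s \<le> n" using n by simp
    have "graph_iso G (extremal_graph s n)" if "alpha_index \<alpha> (extremal_graph s n) \<le> alpha_index \<alpha> G"
      using iso[OF n _ _ _ _ _ that] G \<alpha> by blast
    moreover have "alpha_index \<alpha> G = alpha_index \<alpha> (extremal_graph s n)" if "graph_iso G (extremal_graph s n)"
      using graph_iso_alpha_index[OF that] G extremal_graph_simple[OF sn] by blast
    \<comment> \<open>If the index of \<open>G\<close> were larger than that of the join,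
      \<open>G\<close> would be isomorphic to the join and the indices equal; so the bound follows
      from the characterisation by linearity of the order.\<close>
    ultimately have "alpha_index \<alpha> G \<le> alpha_index \<alpha> (extremal_graph s n) \<and>
        (alpha_index \<alpha> G = alpha_index \<alpha> (extremal_graph s n) \<longleftrightarrow> graph_iso G (extremal_graph s n))"
      by (metis linear order_refl)
    then show "let K = graph_join (complete_graph {..<r - 2}) (graph_complement (complete_graph {r - 2..<n}))
       in alpha_index \<alpha> G \<le> alpha_index \<alpha> K \<and> (alpha_index \<alpha> G = alpha_index \<alpha> K \<longleftrightarrow> graph_iso G K)"
      unfolding Let_def extremal_graph_def s_def .
  qed
qed

end
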